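(* Let $n\geqslant 3$. The identity map $(A_{B_n},d_{\mathcal P(A_{B_n})})\to (A_{B_n},d_{\mathcal{NP}(A_{B_n})})$ is Lipschitz but is not a quasi-isometry.
   Context: $A_{B_n}$ is the Artin-Tits group of type $B_n$, with standard generators $\tau_1,\dots,\tau_n$ and relations $\tau_i\tau_j=\tau_j\tau_i$ for $|i-j|\geqslant 2$, $\tau_1\tau_2\tau_1\tau_2=\tau_2\tau_1\tau_2\tau_1$, and $\tau_i\tau_{i+1}\tau_i=\tau_{i+1}\tau_i\tau_{i+1}$ for $2\leqslant i\leqslant n-1$. Its Garside element is $\Delta_{B_n}=(\tau_1\tau_2\cdots\tau_n)^n$. A proper irreducible standard parabolic subgroup of $A_{B_n}$ is a subgroup generated by the $\tau_i$ with $i\in I$, where $I$ is a nonempty proper subset of $\{1,\dots,n\}$ consisting of consecutive integers. $\mathcal{P}(A_{B_n})$ is the union of all proper irreducible standard parabolic subgroups of $A_{B_n}$ together with the cyclic subgroup generated by $\Delta_{B_n}^2$. $\mathcal{NP}(A_{B_n})$ is the set of all elements of $A_{B_n}$ which normalize some proper irreducible standard parabolic subgroup of $A_{B_n}$. Both are generating sets of $A_{B_n}$. For a generating set $\mathcal K$, $d_{\mathcal K}$ is the word metric: $d_{\mathcal K}(g,h)$ is the minimal length of a word in elements of $\mathcal K$ and their inverses representing $g^{-1}h$. *)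

theory Defs
  imports
    "HOL-Algebra.Generated_Groups"
    "HOL-Algebra.Zassenhaus"
    "HOL-Analysis.Abstract_Metric_Spaces"
begin

section \<open>Groups given by generators and relations\<close>

text \<open>The letter \<open>(x, True)\<close> stands for the generator \<open>x\<close> and \<open>(x, False)\<close> for its inverse.\<close>

type_synonym 'a word = "('a \<times> bool) list"

definition words :: "'a set \<Rightarrow> 'a word set" where
  "words S = lists (S \<times> UNIV)"

definition pos_word :: "'a list \<Rightarrow> 'a word" where
  "pos_word xs = map (\<lambda>x. (x, True)) xs"

text \<open>A pair \<open>(r, s) \<in> R\<close> is the defining relation \<open>r = s\<close>.\<close>

inductive_set pres_rel :: "'a set \<Rightarrow> ('a word \<times> 'a word) set \<Rightarrow> ('a word \<times> 'a word) set"
  for S R where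
  refl: "w \<in> words S \<Longrightarrow> (w, w) \<in> pres_rel S R"
| sym: "(v, w) \<in> pres_rel S R \<Longrightarrow> (w, v) \<in> pres_rel S R"
| trans: "(u, v) \<in> pres_rel S R \<Longrightarrow> (v, w) \<in> pres_rel S R \<Longrightarrow> (u, w) \<in> pres_rel S R"
| cancel: "u \<in> words S \<Longrightarrow> v \<in> words S \<Longrightarrow> x \<in> S \<Longrightarrow>
    (u @ [(x, b), (x, \<not> b)] @ v, u @ v) \<in> pres_rel S R"
| rel: "u \<in> words S \<Longrightarrow> v \<in> words S \<Longrightarrow> r \<in> words S \<Longrightarrow> s \<in> words S \<Longrightarrow> (r, s) \<in> R \<Longrightarrow>
    (u @ r @ v, u @ s @ v) \<in> pres_rel S R"

definition presented_group :: "'a set \<Rightarrow> ('a word \<times> 'a word) set \<Rightarrow> 'a word set monoid" where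
  "presented_group S R =
    \<lparr>carrier = words S // pres_rel S R,
     mult = (\<lambda>A B. \<Union>u\<in>A. \<Union>v\<in>B. pres_rel S R `` {u @ v}),
     one = pres_rel S R `` {[]}\<rparr>"

lemma words_append_iff [simp]: "u @ v \<in> words S \<longleftrightarrow> u \<in> words S \<and> v \<in> words S"
  by (auto simp: words_def)

lemma words_Nil [simp]: "[] \<in> words S"
  by (simp add: words_def)

lemma words_Cons [simp]: "a # v \<in> words S \<longleftrightarrow> fst a \<in> S \<and> v \<in> words S"
  by (cases a) (auto simp: words_def)

lemma pres_rel_words: "(u, v) \<in> pres_rel S R \<Longrightarrow> u \<in> words S \<and> v \<in> words S"
  by (induction rule: pres_rel.induct) auto

lemma equiv_pres_rel: "equiv (words S) (pres_rel S R)"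
proof (rule equivI)
  show "pres_rel S R \<subseteq> words S \<times> words S"
    using pres_rel_words by fastforce
  show "refl_on (words S) (pres_rel S R)"
    by (auto intro!: refl_onI pres_rel.refl dest: pres_rel_words)
  show "Relation.sym (pres_rel S R)"
    by (auto intro: symI pres_rel.sym)
  show "Relation.trans (pres_rel S R)"
    by (auto intro: transI pres_rel.trans)
qed

lemma pres_rel_append_left:
  assumes "(u, v) \<in> pres_rel S R" "w \<in> words S"
  shows "(w @ u, w @ v) \<in> pres_rel S R"
  using assms
proof (induction rule: pres_rel.induct)
  case (cancel u v x b)
  then show ?case using pres_rel.cancel[of "w @ u" S v x b R] by simp
next
  case (rel u v r s)
  then show ?case using pres_rel.rel[of "w @ u" S v r s R] by simp
qed (auto intro: pres_rel.refl pres_rel.sym pres_rel.trans)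

lemma pres_rel_append_right:
  assumes "(u, v) \<in> pres_rel S R" "w \<in> words S"
  shows "(u @ w, v @ w) \<in> pres_rel S R"
  using assms
proof (induction rule: pres_rel.induct)
  case (cancel u v x b)
  then show ?case using pres_rel.cancel[of u S "v @ w" x b R] by simp
next
  case (rel u v r s)
  then show ?case using pres_rel.rel[of u S "v @ w" r s R] by simp
qed (auto intro: pres_rel.refl pres_rel.sym pres_rel.trans)

lemma pres_rel_append:
  assumes "(u, u') \<in> pres_rel S R" "(v, v') \<in> pres_rel S R"
  shows "(u @ v, u' @ v') \<in> pres_rel S R"
  using assms pres_rel_append_left pres_rel_append_right pres_rel.trans pres_rel_words
  by metis

lemma presented_group_mult:
  assumes "u \<in> words S" "v \<in> words S"
  shows "pres_rel S R `` {u} \<otimes>\<^bsub>presented_group S R\<^esub> pres_rel S R `` {v} = pres_rel S R `` {u @ v}"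
proof -
  have eq: "pres_rel S R `` {u' @ v'} = pres_rel S R `` {u @ v}"
    if "(u, u') \<in> pres_rel S R" "(v, v') \<in> pres_rel S R" for u' v'
    using pres_rel_append[OF that] equiv_class_eq[OF equiv_pres_rel] by metis
  have "pres_rel S R `` {u} \<otimes>\<^bsub>presented_group S R\<^esub> pres_rel S R `` {v}
      = (\<Union>u'\<in>pres_rel S R `` {u}. \<Union>v'\<in>pres_rel S R `` {v}. pres_rel S R `` {u @ v})"
    unfolding presented_group_def using eq by simp
  also have "\<dots> = pres_rel S R `` {u @ v}"
    using pres_rel.refl[OF assms(1), of R] pres_rel.refl[OF assms(2), of R] by blast
  finally show ?thesis .
qed

lemma presented_group_carrierE:
  assumes "A \<in> carrier (presented_group S R)"
  obtains u where "u \<in> words S" "A = pres_rel S R `` {u}"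
  using assms by (auto simp: presented_group_def elim: quotientE)

lemma presented_group_class_closed:
  "u \<in> words S \<Longrightarrow> pres_rel S R `` {u} \<in> carrier (presented_group S R)"
  by (auto simp: presented_group_def intro: quotientI)

definition inv_word :: "'a word \<Rightarrow> 'a word" where
  "inv_word w = rev (map (\<lambda>(x, b). (x, \<not> b)) w)"

lemma inv_word_words [simp]: "w \<in> words S \<Longrightarrow> inv_word w \<in> words S"
  by (induction w) (auto simp: inv_word_def)

lemma inv_word_left: "w \<in> words S \<Longrightarrow> (inv_word w @ w, []) \<in> pres_rel S R"
proof (induction w)
  case Nil
  then show ?case by (simp add: inv_word_def pres_rel.refl)
next
  case (Cons a w)
  obtain x b where a: "a = (x, b)" by (cases a)
  have x: "x \<in> S" and w: "w \<in> words S" using Cons.prems a by auto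
  have "(inv_word w @ [(x, \<not> b), (x, \<not> \<not> b)] @ w, inv_word w @ w) \<in> pres_rel S R"
    by (rule pres_rel.cancel) (use x w in auto)
  moreover have "inv_word (a # w) @ a # w = inv_word w @ [(x, \<not> b), (x, \<not> \<not> b)] @ w"
    by (simp add: inv_word_def a)
  ultimately show ?case using Cons.IH w pres_rel.trans by metis
qed

lemma one_presented_group: "\<one>\<^bsub>presented_group S R\<^esub> = pres_rel S R `` {[]}"
  by (simp add: presented_group_def)

lemma group_presented_group: "group (presented_group S R)"
proof (rule groupI)
  let ?G = "presented_group S R"
  show "\<one>\<^bsub>?G\<^esub> \<in> carrier ?G"
    by (simp add: one_presented_group presented_group_class_closed)
  fix x y z assume x: "x \<in> carrier ?G"
  obtain u where u: "u \<in> words S" "x = pres_rel S R `` {u}"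
    using x by (rule presented_group_carrierE)
  show "\<one>\<^bsub>?G\<^esub> \<otimes>\<^bsub>?G\<^esub> x = x"
    by (simp add: u one_presented_group presented_group_mult)
  have "pres_rel S R `` {inv_word u} \<otimes>\<^bsub>?G\<^esub> x = pres_rel S R `` {inv_word u @ u}"
    by (simp add: u presented_group_mult)
  also have "\<dots> = \<one>\<^bsub>?G\<^esub>"
    unfolding one_presented_group by (rule equiv_class_eq[OF equiv_pres_rel inv_word_left[OF u(1)]])
  finally show "\<exists>y\<in>carrier ?G. y \<otimes>\<^bsub>?G\<^esub> x = \<one>\<^bsub>?G\<^esub>"
    using presented_group_class_closed[OF inv_word_words[OF u(1)]] by (rule bexI)
  assume y: "y \<in> carrier ?G"
  obtain v where v: "v \<in> words S" "y = pres_rel S R `` {v}"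
    using y by (rule presented_group_carrierE)
  show "x \<otimes>\<^bsub>?G\<^esub> y \<in> carrier ?G"
    by (simp add: u v presented_group_mult presented_group_class_closed)
  assume z: "z \<in> carrier ?G"
  obtain w where w: "w \<in> words S" "z = pres_rel S R `` {w}"
    using z by (rule presented_group_carrierE)
  show "x \<otimes>\<^bsub>?G\<^esub> y \<otimes>\<^bsub>?G\<^esub> z = x \<otimes>\<^bsub>?G\<^esub> (y \<otimes>\<^bsub>?G\<^esub> z)"
    by (simp add: u v w presented_group_mult)
qed


section \<open>Word metrics\<close>

definition list_product :: "('a, 'b) monoid_scheme \<Rightarrow> 'a list \<Rightarrow> 'a" where
  "list_product G xs = foldr (\<lambda>x y. x \<otimes>\<^bsub>G\<^esub> y) xs \<one>\<^bsub>G\<^esub>"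

definition word_length :: "('a, 'b) monoid_scheme \<Rightarrow> 'a set \<Rightarrow> 'a \<Rightarrow> nat" where
  "word_length G K g =
    (LEAST l. \<exists>xs. length xs = l \<and> set xs \<subseteq> K \<union> m_inv G ` K \<and> list_product G xs = g)"

text \<open>The locale \<^locale>\<open>Metric_space\<close> requires symmetry also outside the carrier, whence the
  default value. \<open>word_metric\<close> is only meaningful if \<open>K\<close> generates \<open>G\<close>; see
  \<open>mspace_word_metric\<close> and \<open>mdist_word_metric\<close> below.\<close>

definition word_dist :: "('a, 'b) monoid_scheme \<Rightarrow> 'a set \<Rightarrow> 'a \<Rightarrow> 'a \<Rightarrow> real" where
  "word_dist G K g h =
    (if g \<in> carrier G \<and> h \<in> carrier G then real (word_length G K (inv\<^bsub>G\<^esub> g \<otimes>\<^bsub>G\<^esub> h)) else 0)"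

definition word_metric :: "('a, 'b) monoid_scheme \<Rightarrow> 'a set \<Rightarrow> 'a metric" where
  "word_metric G K = metric (carrier G, word_dist G K)"

context group
begin

lemma list_product_closed: "set xs \<subseteq> carrier G \<Longrightarrow> list_product G xs \<in> carrier G"
  by (induction xs) (auto simp: list_product_def)

lemma list_product_append:
  "set xs \<subseteq> carrier G \<Longrightarrow> set ys \<subseteq> carrier G \<Longrightarrow>
    list_product G (xs @ ys) = list_product G xs \<otimes> list_product G ys"
proof (induction xs)
  case Nil
  then show ?case using list_product_closed[of ys] by (simp add: list_product_def)
next
  case (Cons a xs)
  then show ?case using list_product_closed[of ys] list_product_closed[of xs]
    by (simp add: list_product_def m_assoc)
qed

lemma list_product_inv:
  "set xs \<subseteq> carrier G \<Longrightarrow> list_product G (rev (map (m_inv G) xs)) = inv (list_product G xs)"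
proof (induction xs)
  case Nil
  then show ?case by (simp add: list_product_def)
next
  case (Cons a xs)
  have "list_product G (rev (map (m_inv G) (a # xs)))
      = list_product G (rev (map (m_inv G) xs)) \<otimes> list_product G [inv a]"
    using Cons.prems by (simp, subst list_product_append) auto
  then show ?case using Cons list_product_closed[of xs]
    by (simp add: list_product_def inv_mult_group)
qed

lemma generate_list_product:
  assumes "g \<in> generate G K" "K \<subseteq> carrier G"
  shows "\<exists>xs. set xs \<subseteq> K \<union> m_inv G ` K \<and> list_product G xs = g"
  using assms(1)
proof (induction rule: generate.induct)
  case one
  show ?case by (intro exI[of _ "[]"]) (simp add: list_product_def)
next
  case (incl h)
  then show ?case using assms(2) by (intro exI[of _ "[h]"]) (auto simp: list_product_def)
next
  case (inv h)
  then show ?case using assms(2) by (intro exI[of _ "[inv h]"]) (auto simp: list_product_def)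
next
  case (eng g h)
  then obtain xs ys where
    xs: "set xs \<subseteq> K \<union> m_inv G ` K" "list_product G xs = g" and
    ys: "set ys \<subseteq> K \<union> m_inv G ` K" "list_product G ys = h" by blast
  have "K \<union> m_inv G ` K \<subseteq> carrier G" using assms(2) by auto
  then have "list_product G (xs @ ys) = g \<otimes> h"
    using xs ys list_product_append[of xs ys] by blast
  then show ?case using xs ys by (intro exI[of _ "xs @ ys"]) auto
qed

lemma Metric_space_word_dist:
  assumes gen: "generate G K = carrier G"
  shows "Metric_space (carrier G) (word_dist G K)"
proof -
  have K: "K \<subseteq> carrier G" using gen generate.incl by fastforce
  let ?K = "K \<union> m_inv G ` K"
  have K': "?K \<subseteq> carrier G" using K by auto
  have ex: "\<exists>xs. length xs = word_length G K g \<and> set xs \<subseteq> ?K \<and> list_product G xs = g"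
    if "g \<in> carrier G" for g
    unfolding word_length_def by (rule LeastI_ex) (use generate_list_product[of g K] that gen K in blast)
  have le: "word_length G K (list_product G xs) \<le> length xs" if "set xs \<subseteq> ?K" for xs
    unfolding word_length_def by (rule Least_le) (use that in blast)
  have inv_le: "word_length G K (inv g) \<le> word_length G K g" if g: "g \<in> carrier G" for g
  proof -
    obtain xs where xs: "length xs = word_length G K g" "set xs \<subseteq> ?K" "list_product G xs = g"
      using ex[OF g] by blast
    have "set (rev (map (m_inv G) xs)) \<subseteq> ?K"
    proof
      fix y assume "y \<in> set (rev (map (m_inv G) xs))"
      then have "y \<in> m_inv G ` set xs" by simp
      then obtain x where "x \<in> ?K" "y = inv x" using xs(2) by blast
      then show "y \<in> ?K" using K by auto
    qed
    from le[OF this] show ?thesis using xs K' list_product_inv[of xs] by auto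
  qed
  have inv_eq: "word_length G K (inv g) = word_length G K g" if g: "g \<in> carrier G" for g
    using inv_le[OF g] inv_le[of "inv g"] g by simp
  have mult_le: "word_length G K (g \<otimes> h) \<le> word_length G K g + word_length G K h"
    if g: "g \<in> carrier G" and h: "h \<in> carrier G" for g h
  proof -
    obtain xs where xs: "length xs = word_length G K g" "set xs \<subseteq> ?K" "list_product G xs = g"
      using ex[OF g] by blast
    obtain ys where ys: "length ys = word_length G K h" "set ys \<subseteq> ?K" "list_product G ys = h"
      using ex[OF h] by blast
    have "list_product G (xs @ ys) = g \<otimes> h"
      using xs ys K' list_product_append[of xs ys] by blast
    then show ?thesis using le[of "xs @ ys"] xs ys by simp
  qed
  show ?thesis
  proof
    show "0 \<le> word_dist G K x y" for x y by (simp add: word_dist_def)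
    show "word_dist G K x y = word_dist G K y x" for x y
      using inv_eq[of "inv x \<otimes> y"] by (auto simp: word_dist_def inv_mult_group)
    show "word_dist G K x y = 0 \<longleftrightarrow> x = y" if x: "x \<in> carrier G" and y: "y \<in> carrier G" for x y
    proof
      assume "word_dist G K x y = 0"
      then have "word_length G K (inv x \<otimes> y) = 0" using x y by (simp add: word_dist_def)
      then have "inv x \<otimes> y = \<one>"
        using ex[of "inv x \<otimes> y"] x y by (auto simp: list_product_def)
      then show "x = y" using x y by (metis inv_closed inv_equality inv_inv)
    next
      assume "x = y"
      then show "word_dist G K x y = 0"
        using le[of "[]"] x by (simp add: word_dist_def list_product_def)
    qed
    show "word_dist G K x z \<le> word_dist G K x y + word_dist G K y z"
      if x: "x \<in> carrier G" and y: "y \<in> carrier G" and z: "z \<in> carrier G" for x y z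
    proof -
      have "y \<otimes> (inv y \<otimes> z) = z" using y z by (simp add: m_assoc[symmetric])
      then have "inv x \<otimes> z = (inv x \<otimes> y) \<otimes> (inv y \<otimes> z)"
        using x y z by (simp add: m_assoc)
      then show ?thesis using mult_le[of "inv x \<otimes> y" "inv y \<otimes> z"] x y z
        by (simp add: word_dist_def flip: of_nat_add)
    qed
  qed
qed

lemma mspace_word_metric:
  "generate G K = carrier G \<Longrightarrow> mspace (word_metric G K) = carrier G"
  unfolding word_metric_def by (simp add: Metric_space.mspace_metric Metric_space_word_dist)

lemma mdist_word_metric:
  "generate G K = carrier G \<Longrightarrow> mdist (word_metric G K) = word_dist G K"
  unfolding word_metric_def by (simp add: Metric_space.mdist_metric Metric_space_word_dist)

end


section \<open>Quasi-isometries\<close>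

definition quasi_isometry :: "'a metric \<Rightarrow> 'b metric \<Rightarrow> ('a \<Rightarrow> 'b) \<Rightarrow> bool" where
  "quasi_isometry m1 m2 f \<longleftrightarrow>
    f \<in> mspace m1 \<rightarrow> mspace m2 \<and>
    (\<exists>L\<ge>1. \<exists>C\<ge>0. \<forall>x\<in>mspace m1. \<forall>y\<in>mspace m1.
        mdist m1 x y / L - C \<le> mdist m2 (f x) (f y) \<and>
        mdist m2 (f x) (f y) \<le> L * mdist m1 x y + C) \<and>
    (\<exists>D\<ge>0. \<forall>z\<in>mspace m2. \<exists>x\<in>mspace m1. mdist m2 (f x) z \<le> D)"


section \<open>The Artin--Tits group of type B\<close>

definition artin_B_rels :: "nat \<Rightarrow> (nat word \<times> nat word) set" where
  "artin_B_rels n =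
    {(pos_word [i, j], pos_word [j, i]) | i j.
        i \<in> {1..n} \<and> j \<in> {1..n} \<and> \<bar>int i - int j\<bar> \<ge> 2} \<union>
    {(pos_word [1, 2, 1, 2], pos_word [2, 1, 2, 1])} \<union>
    {(pos_word [i, i + 1, i], pos_word [i + 1, i, i + 1]) | i. 2 \<le> i \<and> i + 1 \<le> n}"

definition artin_B :: "nat \<Rightarrow> nat word set monoid" where
  "artin_B n = presented_group {1..n} (artin_B_rels n)"

definition tau :: "nat \<Rightarrow> nat \<Rightarrow> nat word set" where
  "tau n i = pres_rel {1..n} (artin_B_rels n) `` {pos_word [i]}"

definition Delta_B :: "nat \<Rightarrow> nat word set" where
  "Delta_B n = list_product (artin_B n) (map (tau n) [1..<n + 1]) [^]\<^bsub>artin_B n\<^esub> n"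

definition std_parabolic :: "nat \<Rightarrow> nat set \<Rightarrow> nat word set set" where
  "std_parabolic n I = generate (artin_B n) (tau n ` I)"

definition proper_irred_std_parabolics :: "nat \<Rightarrow> nat word set set set" where
  "proper_irred_std_parabolics n =
    {std_parabolic n I | I. I \<noteq> {} \<and> I \<subset> {1..n} \<and> (\<exists>a b. I = {a..b})}"

definition P_B :: "nat \<Rightarrow> nat word set set" where
  "P_B n = \<Union> (proper_irred_std_parabolics n) \<union>
    generate (artin_B n) {Delta_B n [^]\<^bsub>artin_B n\<^esub> (2::nat)}"

definition NP_B :: "nat \<Rightarrow> nat word set set" where
  "NP_B n = (\<Union>H \<in> proper_irred_std_parabolics n. normalizer (artin_B n) H)"

lemma group_artin_B: "group (artin_B n)"
  by (simp add: artin_B_def group_presented_group)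

lemma tau_closed: "i \<in> {1..n} \<Longrightarrow> tau n i \<in> carrier (artin_B n)"
  by (simp add: tau_def artin_B_def presented_group_class_closed pos_word_def)

lemma generate_tau: "generate (artin_B n) (tau n ` {1..n}) = carrier (artin_B n)"
proof
  interpret group "artin_B n" by (rule group_artin_B)
  let ?r = "pres_rel {1..n} (artin_B_rels n)"
  let ?T = "generate (artin_B n) (tau n ` {1..n})"
  show "?T \<subseteq> carrier (artin_B n)"
    by (rule generate_incl) (use tau_closed in auto)
  have cl: "?r `` {u} \<in> ?T" if "u \<in> words {1..n}" for u
    using that
  proof (induction u)
    case Nil
    then show ?case using generate.one[of "artin_B n"] by (simp add: artin_B_def one_presented_group)
  next
    case (Cons a u)
    obtain x b where a: "a = (x, b)" by (cases a)
    have x: "x \<in> {1..n}" and u: "u \<in> words {1..n}" using Cons.prems a by auto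
    have mult: "?r `` {[a]} \<otimes>\<^bsub>artin_B n\<^esub> ?r `` {u} = ?r `` {a # u}"
      using presented_group_mult[of "[a]" "{1..n}" u "artin_B_rels n"] x u a
      by (simp add: artin_B_def)
    have "?r `` {[a]} \<in> ?T"
    proof (cases b)
      case True
      then have "?r `` {[a]} = tau n x" by (simp add: tau_def a pos_word_def)
      then show ?thesis using x by (auto intro: generate.incl)
    next
      case False
      have "([(x, False), (x, True)], []) \<in> ?r"
        using pres_rel.cancel[of "[]" "{1..n}" "[]" x False "artin_B_rels n"] x by simp
      then have "?r `` {[(x, False), (x, True)]} = ?r `` {[]}"
        using equiv_class_eq[OF equiv_pres_rel] by metis
      then have "?r `` {[a]} \<otimes>\<^bsub>artin_B n\<^esub> tau n x = \<one>\<^bsub>artin_B n\<^esub>"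
        using presented_group_mult[of "[a]" "{1..n}" "[(x, True)]" "artin_B_rels n"] x a False
        by (simp add: artin_B_def tau_def pos_word_def one_presented_group)
      then have "?r `` {[a]} = inv\<^bsub>artin_B n\<^esub> (tau n x)"
        using inv_equality[of "?r `` {[a]}" "tau n x"] tau_closed[OF x] x a
        by (simp add: artin_B_def presented_group_class_closed)
      then show ?thesis using x by (auto intro: generate.inv)
    qed
    then show ?case using Cons.IH u mult generate.eng[of _ "artin_B n"] by metis
  qed
  then show "carrier (artin_B n) \<subseteq> ?T"
    using presented_group_carrierE[of _ "{1..n}" "artin_B_rels n"] by (metis artin_B_def subsetI)
qed

lemma std_parabolic_subgroup:
  assumes "H \<in> proper_irred_std_parabolics n"
  shows "subgroup H (artin_B n)"
proof -
  obtain I where I: "I \<subseteq> {1..n}" "H = std_parabolic n I"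
    using assms by (auto simp: proper_irred_std_parabolics_def)
  have "tau n ` I \<subseteq> carrier (artin_B n)"
    using I(1) tau_closed by blast
  then show ?thesis
    unfolding I(2) std_parabolic_def by (rule group.generate_is_subgroup[OF group_artin_B])
qed

lemma singleton_parabolic:
  assumes "n \<ge> 2" "i \<in> {1..n}"
  shows "std_parabolic n {i} \<in> proper_irred_std_parabolics n"
proof -
  have "{i} \<noteq> {1..n}" using assms by (metis Suc_1 Suc_n_not_le_n atLeastAtMost_iff insertE
        le_numeral_extra(4) le_trans one_le_numeral singletonD order_refl)
  moreover have "{i} = {i..i}" by simp
  ultimately show ?thesis using assms unfolding proper_irred_std_parabolics_def by blast
qed

lemma subgroup_subset_normalizer:
  assumes "subgroup H G" "group G"
  shows "H \<subseteq> normalizer G H"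
  using subgroup.subset[OF normal_imp_subgroup[OF group.subgroup_in_normalizer[OF assms(2,1)]]]
  by simp

lemma generate_eq_carrierI:
  assumes "group G" "T \<subseteq> K" "K \<subseteq> carrier G" "generate G T = carrier G"
  shows "generate G K = carrier G"
proof
  show "generate G K \<subseteq> carrier G" by (rule group.generate_incl[OF assms(1,3)])
  show "carrier G \<subseteq> generate G K"
    using group.mono_generate[OF assms(1,2)] assms(4) by simp
qed

lemma
  assumes n: "n \<ge> 2"
  shows generate_P_B: "generate (artin_B n) (P_B n) = carrier (artin_B n)"
    and generate_NP_B: "generate (artin_B n) (NP_B n) = carrier (artin_B n)"
proof -
  interpret group "artin_B n" by (rule group_artin_B)
  have tau: "tau n i \<in> std_parabolic n {i}" for i
    by (auto simp: std_parabolic_def intro: generate.incl)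
  have T: "tau n ` {1..n} \<subseteq> \<Union> (proper_irred_std_parabolics n)"
    using tau singleton_parabolic[OF n] by blast
  have "Delta_B n \<in> carrier (artin_B n)"
    unfolding Delta_B_def by (intro nat_pow_closed list_product_closed) (auto intro!: tau_closed)
  then have "P_B n \<subseteq> carrier (artin_B n)"
    unfolding P_B_def using subgroup.subset[OF std_parabolic_subgroup]
      generate_incl[of "{Delta_B n [^]\<^bsub>artin_B n\<^esub> (2::nat)}"] by blast
  moreover have "tau n ` {1..n} \<subseteq> P_B n"
    using T unfolding P_B_def by blast
  ultimately show "generate (artin_B n) (P_B n) = carrier (artin_B n)"
    using generate_eq_carrierI[OF group_artin_B _ _ generate_tau] by blast
  have "NP_B n \<subseteq> carrier (artin_B n)"
    by (auto simp: NP_B_def normalizer_def stabilizer_def)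
  moreover have "tau n ` {1..n} \<subseteq> NP_B n"
    using T subgroup_subset_normalizer[OF std_parabolic_subgroup group_artin_B]
    unfolding NP_B_def by blast
  ultimately show "generate (artin_B n) (NP_B n) = carrier (artin_B n)"
    using generate_eq_carrierI[OF group_artin_B _ _ generate_tau] by blast
qed

end

theory Submission
  imports Defs
begin

text \<open>Every element of \<open>P_B n\<close> normalizes a proper irreducible standard parabolic subgroup, since the
  Garside element commutes with \<open>\<tau>\<^sub>2\<close>; hence the identity is Lipschitz. It is not a quasi-isometry because the
  powers of the braid \<open>h = (\<tau>\<^bsub>n-1\<^esub> \<cdots> \<tau>\<^sub>2 \<tau>\<^sub>1 \<tau>\<^sub>2 \<cdots> \<tau>\<^bsub>n-1\<^esub>) \<tau>\<^sub>n\<^sup>-\<^sup>1\<close>, which is pseudo-Anosov outside the curve around the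
  strands \<open>0, \<dots>, n - 2\<close> and centralizes the parabolic subgroup on \<open>{1..n - 2}\<close>, have unbounded length
  with respect to \<open>P_B n\<close>.

  To see this, let the group act by Hurwitz moves on tuples of half-turns about the sides of an ideal
  polygon in the hyperbolic plane with one vertex at infinity. The moves change the polygon, but keep
  it convex, so that by ping-pong its sides cross none of their translates under the group
  generated by the half-turns. A parabolic subgroup in \<open>P_B n\<close> fixes one of the two sides ending at infinity,
  and the Garside element acts as a translation. Since these two sides and their translates do not cross,
  their finite endpoints are close to each other; on the other hand left multiplication by \<open>h\<^sup>2\<close> contracts
  the interval \<open>(0, 1)\<close> of endpoints deep into itself. So multiplication by an element of \<open>P_B n\<close>
  undoes at most one factor \<open>h\<^sup>2\<close>.\<close>

section \<open>Half-turns in \<open>SL\<^sub>2(\<real>)\<close>\<close>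

text \<open>Right multiplication applies moves to the current polygon, whereas left multiplication
  changes the tuple from which the moves start. So a factor from \<open>P_B n\<close> on the right
  is seen through the entry that it fixes, and the square of \<open>h\<close> on the left
  substitutes new half-turns into one and the same word.

  The obstacle is that a parabolic factor controls only one of the two sides at infinity, and the
  next factor may fix the other one. Passing from one side to the other is done under a sharper
  bound than (0, 1) up to translation: with \<open>m = 3 * (n - 1) - 1\<close>, the contraction
  reaches the smaller interval from \<open>m / (m\<^sup>2 + 1)\<close> to \<open>1 / m\<close>. Two
  translates of a side ending there leave the other side no room outside (0, 1) modulo translation.
  So a generator leaves one side under control, and the contraction recovers both.\<close>

datatype mat2 = Mat real real real real

instantiation mat2 :: ring_1
begin

definition zero_mat2 :: mat2 where "0 = Mat 0 0 0 0"

definition one_mat2 :: mat2 where "1 = Mat 1 0 0 1"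

fun plus_mat2 :: "mat2 \<Rightarrow> mat2 \<Rightarrow> mat2" where
  "Mat a b c d + Mat a' b' c' d' = Mat (a + a') (b + b') (c + c') (d + d')"

fun uminus_mat2 :: "mat2 \<Rightarrow> mat2" where
  "- Mat a b c d = Mat (- a) (- b) (- c) (- d)"

definition minus_mat2 :: "mat2 \<Rightarrow> mat2 \<Rightarrow> mat2" where
  "M - N = M + - N" for M N :: mat2

fun times_mat2 :: "mat2 \<Rightarrow> mat2 \<Rightarrow> mat2" where
  "Mat a b c d * Mat a' b' c' d' =
    Mat (a * a' + b * c') (a * b' + b * d') (c * a' + d * c') (c * b' + d * d')"

instance
proof
  fix L M N :: mat2
  show "L + M + N = L + (M + N)" by (cases L; cases M; cases N) simp
  show "M + N = N + M" by (cases M; cases N) simp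
  show "0 + M = M" by (cases M) (simp add: zero_mat2_def)
  show "- M + M = 0" by (cases M) (simp add: zero_mat2_def)
  show "M - N = M + - N" by (rule minus_mat2_def)
  show "L * M * N = L * (M * N)" by (cases L; cases M; cases N) (simp add: algebra_simps)
  show "1 * M = M" by (cases M) (simp add: one_mat2_def)
  show "M * 1 = M" by (cases M) (simp add: one_mat2_def)
  show "(L + M) * N = L * N + M * N" by (cases L; cases M; cases N) (simp add: algebra_simps)
  show "L * (M + N) = L * M + L * N" by (cases L; cases M; cases N) (simp add: algebra_simps)
  show "(0 :: mat2) \<noteq> 1" by (simp add: zero_mat2_def one_mat2_def)
qed

end

fun det2 :: "mat2 \<Rightarrow> real" where
  "det2 (Mat a b c d) = a * d - b * c"

text \<open>For determinant one this is the inverse, obtained without division.\<close>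

fun adj2 :: "mat2 \<Rightarrow> mat2" where
  "adj2 (Mat a b c d) = Mat d (- b) (- c) a"

fun mv :: "mat2 \<Rightarrow> real \<times> real \<Rightarrow> real \<times> real" (infixr "\<bullet>\<^sub>v" 75) where
  "Mat a b c d \<bullet>\<^sub>v (x, y) = (a * x + b * y, c * x + d * y)"

fun cross :: "real \<times> real \<Rightarrow> real \<times> real \<Rightarrow> real" where
  "cross (x, y) (x', y') = x * y' - x' * y"

lemma det2_mult [simp]: "det2 (M * N) = det2 M * det2 N"
  by (cases M; cases N) (simp add: algebra_simps)

lemma det2_uminus [simp]: "det2 (- M) = det2 M"
  by (cases M) simp

lemma det2_one [simp]: "det2 1 = 1"
  by (simp add: one_mat2_def)

lemma adj2_mult: "adj2 (M * N) = adj2 N * adj2 M"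
  by (cases M; cases N) (simp add: algebra_simps)

lemma adj2_one [simp]: "adj2 1 = 1"
  by (simp add: one_mat2_def)

lemma det2_adj2 [simp]: "det2 (adj2 M) = det2 M"
  by (cases M) (simp add: algebra_simps)

lemma adj2_uminus [simp]: "adj2 (- M) = - adj2 M"
  by (cases M) simp

lemma adj2_adj2 [simp]: "adj2 (adj2 M) = M"
  by (cases M) simp

lemma mult_adj2: "det2 M = 1 \<Longrightarrow> M * adj2 M = 1"
  by (cases M) (simp add: one_mat2_def algebra_simps)

lemma adj2_mult_self: "det2 M = 1 \<Longrightarrow> adj2 M * M = 1"
  by (cases M) (simp add: one_mat2_def algebra_simps)

lemma mv_one [simp]: "1 \<bullet>\<^sub>v v = v"
  by (cases v) (simp add: one_mat2_def)

lemma mv_mult: "(M * N) \<bullet>\<^sub>v v = M \<bullet>\<^sub>v N \<bullet>\<^sub>v v"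
  by (cases M; cases N; cases v) (simp add: algebra_simps)

lemma mv_uminus: "(- M) \<bullet>\<^sub>v v = - (M \<bullet>\<^sub>v v)"
  by (cases M; cases v) simp

lemma mv_uminus_right: "M \<bullet>\<^sub>v (- v) = - (M \<bullet>\<^sub>v v)"
  by (cases M; cases v) simp

lemma mv_add: "M \<bullet>\<^sub>v (v + w) = M \<bullet>\<^sub>v v + M \<bullet>\<^sub>v w"
  by (cases M; cases v; cases w) (simp add: algebra_simps)

lemma mv_scaleR: "M \<bullet>\<^sub>v (s *\<^sub>R v) = s *\<^sub>R (M \<bullet>\<^sub>v v)"
  by (cases M; cases v) (simp add: algebra_simps)

lemma cross_mv: "det2 M = 1 \<Longrightarrow> cross (M \<bullet>\<^sub>v v) (M \<bullet>\<^sub>v w) = cross v w"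
proof -
  have "cross (M \<bullet>\<^sub>v v) (M \<bullet>\<^sub>v w) = det2 M * cross v w"
    by (cases M; cases v; cases w) (simp add: algebra_simps)
  then show "det2 M = 1 \<Longrightarrow> ?thesis" by simp
qed

lemma cross_self [simp]: "cross v v = 0"
  by (cases v) simp

lemma cross_swap: "cross v w = - cross w v"
  by (cases v; cases w) simp

lemma cross_uminus_left [simp]: "cross (- v) w = - cross v w"
  by (cases v; cases w) simp

lemma cross_uminus_right [simp]: "cross v (- w) = - cross v w"
  by (cases v; cases w) simp

lemma cross_add_left: "cross (u + v) w = cross u w + cross v w"
  by (cases u; cases v; cases w) (simp add: algebra_simps)

lemma cross_add_right: "cross w (u + v) = cross w u + cross w v"
  by (cases u; cases v; cases w) (simp add: algebra_simps)

lemma cross_scaleR_left: "cross (s *\<^sub>R v) w = s * cross v w"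
  by (cases v; cases w) (simp add: algebra_simps)

lemma cross_scaleR_right: "cross v (s *\<^sub>R w) = s * cross v w"
  by (cases v; cases w) (simp add: algebra_simps)

text \<open>Cramer's rule in the plane. It expresses a moved vertex through its neighbours, and a
  boundary point through the ends of a side.\<close>

lemma cross_basis: "cross v w *\<^sub>R u = cross u w *\<^sub>R v + cross v u *\<^sub>R w"
  by (cases u; cases v; cases w) (simp add: algebra_simps)

definition half_turn :: "mat2 \<Rightarrow> bool" where
  "half_turn M \<longleftrightarrow> M * M = -1 \<and> det2 M = 1"

lemma half_turn_sq: "half_turn M \<Longrightarrow> M * M = -1"
  by (simp add: half_turn_def)

lemma half_turn_sq_left: "half_turn M \<Longrightarrow> M * (M * N) = - N"
  by (simp add: half_turn_def flip: mult.assoc)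

lemma half_turn_det: "half_turn M \<Longrightarrow> det2 M = 1"
  by (simp add: half_turn_def)

lemma half_turn_adj2: "half_turn M \<Longrightarrow> adj2 M = - M"
proof -
  assume M: "half_turn M"
  have "M = (adj2 M * M) * M"
    using adj2_mult_self[of M] M by (simp add: half_turn_def)
  also have "\<dots> = - adj2 M"
    using M by (simp add: half_turn_def mult.assoc)
  finally show ?thesis by (metis minus_minus)
qed

lemma half_turn_mv: "half_turn M \<Longrightarrow> M \<bullet>\<^sub>v M \<bullet>\<^sub>v v = - v"
  using half_turn_sq[of M] mv_mult[of M M v] by (simp add: mv_uminus)

lemmas half_turn_simps = half_turn_sq half_turn_sq_left

lemma half_turn_conj: "half_turn M \<Longrightarrow> half_turn N \<Longrightarrow> half_turn (- (M * N * M))"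
  unfolding half_turn_def
  by (simp add: mult.assoc half_turn_simps[unfolded half_turn_def])


section \<open>Hurwitz moves\<close>

text \<open>A half-turn has its negative as inverse, so the new entry is the conjugate of
  \<open>y (Suc i)\<close> by \<open>y i\<close>. With this sign the braid relations hold for
  matrices and not merely up to sign.\<close>

definition move :: "nat \<Rightarrow> (nat \<Rightarrow> mat2) \<Rightarrow> nat \<Rightarrow> mat2" where
  "move i y = y(i := - (y i * y (Suc i) * y i), Suc i := y i)"

definition unmove :: "nat \<Rightarrow> (nat \<Rightarrow> mat2) \<Rightarrow> nat \<Rightarrow> mat2" where
  "unmove i y = y(i := y (Suc i), Suc i := - (y (Suc i) * y i * y (Suc i)))"

definition half_turns :: "(nat \<Rightarrow> mat2) \<Rightarrow> bool" where
  "half_turns y \<longleftrightarrow> (\<forall>i. half_turn (y i))"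

lemma half_turnsD: "half_turns y \<Longrightarrow> half_turn (y i)"
  by (simp add: half_turns_def)

lemma half_turns_sq: "half_turns y \<Longrightarrow> y i * y i = -1"
  and half_turns_sq_left: "half_turns y \<Longrightarrow> y i * (y i * M) = - M"
  by (simp_all add: half_turnsD half_turn_simps)

lemma half_turns_move [simp]: "half_turns y \<Longrightarrow> half_turns (move i y)"
  by (auto simp: half_turns_def move_def half_turn_conj)

lemma half_turns_unmove [simp]: "half_turns y \<Longrightarrow> half_turns (unmove i y)"
  by (auto simp: half_turns_def unmove_def half_turn_conj)

lemma unmove_move: "half_turns y \<Longrightarrow> unmove i (move i y) = y"
  by (rule ext) (simp add: move_def unmove_def mult.assoc half_turns_sq half_turns_sq_left)

lemma move_unmove: "half_turns y \<Longrightarrow> move i (unmove i y) = y"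
  by (rule ext) (simp add: move_def unmove_def mult.assoc half_turns_sq half_turns_sq_left)

lemma move_commute: "Suc i < j \<Longrightarrow> move i (move j y) = move j (move i y)"
  by (rule ext) (auto simp: move_def)

lemma move_braid:
  "half_turns y \<Longrightarrow>
    move i (move (Suc i) (move i y)) = move (Suc i) (move i (move (Suc i) y))"
  by (rule ext) (simp add: move_def mult.assoc half_turns_sq half_turns_sq_left)

text \<open>\<open>\<tau>\<^sub>1\<close> acts as the square of a braid generator: type \<open>B\<^sub>n\<close> is the group of braids on the strands
  \<open>0, \<dots>, n\<close> that fix the strand \<open>0\<close>.\<close>

definition letter_act :: "nat \<times> bool \<Rightarrow> (nat \<Rightarrow> mat2) \<Rightarrow> nat \<Rightarrow> mat2" where
  "letter_act l y =
    (let m = (if snd l then move else unmove) (fst l - 1)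
     in if fst l = 1 then m (m y) else m y)"

definition hurwitz :: "nat word \<Rightarrow> (nat \<Rightarrow> mat2) \<Rightarrow> nat \<Rightarrow> mat2" where
  "hurwitz w y = fold letter_act w y"

lemma hurwitz_Nil [simp]: "hurwitz [] y = y"
  and hurwitz_Cons: "hurwitz (l # w) y = hurwitz w (letter_act l y)"
  and hurwitz_append: "hurwitz (v @ w) y = hurwitz w (hurwitz v y)"
  by (simp_all add: hurwitz_def)

lemma half_turns_letter_act [simp]: "half_turns y \<Longrightarrow> half_turns (letter_act l y)"
  by (simp add: letter_act_def Let_def)

lemma half_turns_hurwitz [simp]: "half_turns y \<Longrightarrow> half_turns (hurwitz w y)"
  by (induction w arbitrary: y) (simp_all add: hurwitz_Cons)

lemma letter_act_cancel: "half_turns y \<Longrightarrow> letter_act (i, \<not> b) (letter_act (i, b) y) = y"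
  by (cases b) (simp_all add: letter_act_def Let_def unmove_move move_unmove)

lemma letter_act_commute:
  assumes "\<bar>int i - int j\<bar> \<ge> 2" "i \<ge> 1" "j \<ge> 1"
  shows "letter_act (i, True) (letter_act (j, True) y) = letter_act (j, True) (letter_act (i, True) y)"
proof -
  have *: "letter_act (i, True) (letter_act (j, True) y) = letter_act (j, True) (letter_act (i, True) y)"
    if ij: "i \<ge> 1" "j \<ge> i + 2" for i j
  proof -
    obtain a c where "i = Suc a" "j = Suc c" "Suc a < c"
      using ij by (cases i; cases j) auto
    moreover from this have "move a (move c z) = move c (move a z)" for z
      by (intro move_commute)
    ultimately show ?thesis by (cases "a = 0") (simp_all add: letter_act_def Let_def)
  qed
  consider "j \<ge> i + 2" | "i \<ge> j + 2" using assms(1) by linarith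
  then show ?thesis using *[of i j] *[of j i] assms by cases auto
qed

text \<open>Both sides are the full twist on three strands; the braid relation of
  \<open>move 0\<close> and \<open>move 1\<close> alone connects them.\<close>

lemma move_braid4:
  assumes y: "half_turns y"
  shows "move 1 (move 0 (move 0 (move 1 (move 0 (move 0 y))))) =
    move 0 (move 0 (move 1 (move 0 (move 0 (move 1 y)))))"
proof -
  have B: "move 0 (move 1 (move 0 z)) = move 1 (move 0 (move 1 z))" if "half_turns z" for z
    using move_braid[OF that, of 0] by simp
  have "move 1 (move 0 (move 0 (move 1 (move 0 (move 0 y))))) =
      move 1 (move 0 (move 1 (move 0 (move 1 (move 0 y)))))"
    using B[of "move 0 y"] y by simp
  also have "\<dots> = move 0 (move 1 (move 0 (move 1 (move 0 (move 1 y)))))"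
    using B[of y] B[of "move 0 (move 1 (move 0 y))"] y by simp
  also have "\<dots> = move 0 (move 0 (move 1 (move 0 (move 0 (move 1 y)))))"
    using B[of "move 0 (move 1 y)"] y by simp
  finally show ?thesis .
qed

lemma hurwitz_pres_rel:
  assumes "(v, w) \<in> pres_rel {1..n} (artin_B_rels n)" "half_turns y"
  shows "hurwitz v y = hurwitz w y"
  using assms
proof (induction arbitrary: y rule: pres_rel.induct)
  case (cancel u v x b)
  then show ?case by (simp add: hurwitz_append hurwitz_Cons letter_act_cancel)
next
  case (rel u v r s)
  have "hurwitz r z = hurwitz s z" if z: "half_turns z" for z
  proof -
    consider i j where "r = pos_word [i, j]" "s = pos_word [j, i]" "i \<ge> 1" "j \<ge> 1" "\<bar>int i - int j\<bar> \<ge> 2"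
      | "r = pos_word [1, 2, 1, 2]" "s = pos_word [2, 1, 2, 1]"
      | i where "r = pos_word [i, i + 1, i]" "s = pos_word [i + 1, i, i + 1]" "2 \<le> i"
      using rel.hyps(5) by (auto simp: artin_B_rels_def)
    then show ?thesis
    proof cases
      case 1
      then show ?thesis using letter_act_commute[of i j]
        by (simp add: pos_word_def hurwitz_Cons)
    next
      case 2
      then show ?thesis using move_braid4[OF z]
        by (simp add: pos_word_def hurwitz_Cons letter_act_def Let_def)
    next
      case 3
      then obtain k where "i = Suc k" "k \<ge> 1" by (cases i) auto
      then show ?thesis using 3 move_braid[OF z, of k]
        by (simp add: pos_word_def hurwitz_Cons letter_act_def Let_def)
    qed
  qed
  then show ?case using rel.prems by (simp add: hurwitz_append)
qed simp_all

section \<open>Words in the entries of a tuple\<close>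

text \<open>Half-turns have order two only modulo sign, as they square to \<open>-1\<close>.
  Cancelling equal neighbours in a word therefore changes its value by a sign, which is invisible on
  the boundary.\<close>

definition eq_pm :: "mat2 \<Rightarrow> mat2 \<Rightarrow> bool" (infix "\<simeq>" 50) where
  "M \<simeq> N \<longleftrightarrow> M = N \<or> M = - N"

lemma eq_pm_refl [simp, intro]: "M \<simeq> M"
  by (simp add: eq_pm_def)

lemma eq_pm_sym: "M \<simeq> N \<Longrightarrow> N \<simeq> M"
  by (auto simp: eq_pm_def)

lemma eq_pm_trans [trans]: "L \<simeq> M \<Longrightarrow> M \<simeq> N \<Longrightarrow> L \<simeq> N"
  by (auto simp: eq_pm_def)

lemma eq_pm_mult: "M \<simeq> M' \<Longrightarrow> N \<simeq> N' \<Longrightarrow> M * N \<simeq> M' * N'"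
  by (auto simp: eq_pm_def)

lemma eq_pm_uminus: "- M \<simeq> M"
  by (simp add: eq_pm_def)

definition ev :: "(nat \<Rightarrow> mat2) \<Rightarrow> nat list \<Rightarrow> mat2" where
  "ev y u = foldr (\<lambda>a M. y a * M) u 1"

lemma ev_Nil [simp]: "ev y [] = 1"
  and ev_Cons [simp]: "ev y (a # u) = y a * ev y u"
  by (simp_all add: ev_def)

lemma ev_append [simp]: "ev y (u @ v) = ev y u * ev y v"
  by (induction u) (simp_all add: mult.assoc)

lemma det2_ev: "half_turns y \<Longrightarrow> det2 (ev y u) = 1"
  by (induction u) (simp_all add: half_turns_def half_turn_def)

lemma adj2_ev: "half_turns y \<Longrightarrow> adj2 (ev y u) \<simeq> ev y (rev u)"
proof (induction u)
  case (Cons a u)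
  have "adj2 (ev y (a # u)) = adj2 (ev y u) * - y a"
    using Cons.prems by (simp add: adj2_mult half_turn_adj2 half_turnsD)
  also have "\<dots> \<simeq> ev y (rev u) * y a"
    by (intro eq_pm_mult eq_pm_uminus Cons)
  finally show ?case by simp
qed simp

text \<open>The reduced word is chosen before the tuple. This later allows the base polygon and that
  of \<open>anosov2 n\<close> to be compared letter by letter.\<close>

lemma ev_reduced:
  "\<exists>u'. distinct_adj u' \<and> set u' \<subseteq> set u \<and> (\<forall>y. half_turns y \<longrightarrow> ev y u \<simeq> ev y u')"
proof (induction u)
  case (Cons a u)
  then obtain u' where u': "distinct_adj u'" "set u' \<subseteq> set u" "\<And>y. half_turns y \<Longrightarrow> ev y u \<simeq> ev y u'"
    by blast
  show ?case
  proof (cases "u' \<noteq> [] \<and> hd u' = a")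
    case True
    then obtain v where v: "u' = a # v" by (cases u') auto
    have "ev y (a # u) \<simeq> ev y v" if y: "half_turns y" for y
    proof -
      have "ev y (a # u) \<simeq> y a * ev y u'" using u'(3)[OF y] eq_pm_mult by auto
      also have "\<dots> \<simeq> ev y v" using y by (simp add: v half_turns_sq_left eq_pm_uminus)
      finally show ?thesis .
    qed
    moreover have "distinct_adj v" using u'(1) v distinct_adj_ConsD by auto
    ultimately show ?thesis using u'(2) v by (intro exI[of _ v]) auto
  next
    case False
    have "distinct_adj (a # u')"
      using False u'(1) by (cases u') auto
    moreover have "ev y (a # u) \<simeq> ev y (a # u')" if "half_turns y" for y
      using u'(3)[OF that] eq_pm_mult by auto
    ultimately show ?thesis using u'(2) by (intro exI[of _ "a # u'"]) auto
  qed
qed auto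

text \<open>The word may depend on the position \<open>a\<close> but not on \<open>y\<close>: such
  an \<open>F\<close> is a substitution in the free product of \<open>n + 1\<close> groups of order
  two.\<close>

definition expressible :: "nat \<Rightarrow> ((nat \<Rightarrow> mat2) \<Rightarrow> nat \<Rightarrow> mat2) \<Rightarrow> bool" where
  "expressible n F \<longleftrightarrow>
    (\<forall>a\<le>n. \<exists>u. set u \<subseteq> {..n} \<and> (\<forall>y. half_turns y \<longrightarrow> F y a \<simeq> ev y u))"

lemma ev_substitute:
  assumes "\<And>b. b \<in> set u \<Longrightarrow> y' b \<simeq> ev y (s b)"
  shows "ev y' u \<simeq> ev y (concat (map s u))"
  using assms by (induction u) (auto intro: eq_pm_mult)

lemma expressible_id: "expressible n (\<lambda>y. y)"
  unfolding expressible_def by (intro allI impI exI[of _ "[_]"]) auto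

lemma expressible_compose:
  assumes F: "expressible n F" and G: "expressible n G"
    and G_half: "\<And>y. half_turns y \<Longrightarrow> half_turns (G y)"
  shows "expressible n (\<lambda>y. F (G y))"
  unfolding expressible_def
proof (intro allI impI)
  fix a assume "a \<le> n"
  then obtain u where u: "set u \<subseteq> {..n}" "\<And>y. half_turns y \<Longrightarrow> F y a \<simeq> ev y u"
    using F unfolding expressible_def by blast
  obtain s where s: "\<And>b. b \<le> n \<Longrightarrow> set (s b) \<subseteq> {..n}"
    "\<And>b y. b \<le> n \<Longrightarrow> half_turns y \<Longrightarrow> G y b \<simeq> ev y (s b)"
    using G unfolding expressible_def by metis
  have "F (G y) a \<simeq> ev y (concat (map s u))" if y: "half_turns y" for y
  proof -
    have "F (G y) a \<simeq> ev (G y) u" using u(2) G_half[OF y] .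
    also have "\<dots> \<simeq> ev y (concat (map s u))"
      by (rule ev_substitute) (use u(1) s(2) y in auto)
    finally show ?thesis .
  qed
  moreover have "set (concat (map s u)) \<subseteq> {..n}" using u(1) s(1) by fastforce
  ultimately show "\<exists>u. set u \<subseteq> {..n} \<and> (\<forall>y. half_turns y \<longrightarrow> F (G y) a \<simeq> ev y u)" by blast
qed

lemma expressible_move: "i < n \<Longrightarrow> expressible n (move i)"
  unfolding expressible_def
proof (intro allI impI)
  fix a assume "i < n" "a \<le> n"
  then show "\<exists>u. set u \<subseteq> {..n} \<and> (\<forall>y. half_turns y \<longrightarrow> move i y a \<simeq> ev y u)"
    by (intro exI[of _ "if a = i then [i, Suc i, i] else if a = Suc i then [i] else [a]"])
      (auto simp: move_def mult.assoc eq_pm_uminus)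
qed

lemma expressible_unmove: "i < n \<Longrightarrow> expressible n (unmove i)"
  unfolding expressible_def
proof (intro allI impI)
  fix a assume "i < n" "a \<le> n"
  then show "\<exists>u. set u \<subseteq> {..n} \<and> (\<forall>y. half_turns y \<longrightarrow> unmove i y a \<simeq> ev y u)"
    by (intro exI[of _ "if a = i then [Suc i] else if a = Suc i then [Suc i, i, Suc i] else [a]"])
      (auto simp: unmove_def mult.assoc eq_pm_uminus)
qed

lemma letter_act_cases:
  "\<exists>m. (m = move (i - 1) \<or> m = unmove (i - 1)) \<and>
    (\<forall>y. letter_act (i, b) y = (if i = 1 then m (m y) else m y))"
  by (rule exI[of _ "(if b then move else unmove) (i - 1)"]) (auto simp: letter_act_def Let_def)

lemma expressible_letter_act:
  assumes "fst l \<in> {1..n}"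
  shows "expressible n (letter_act l)"
proof -
  obtain i b where l: "l = (i, b)" by (cases l)
  obtain m where m: "m = move (i - 1) \<or> m = unmove (i - 1)"
    "\<And>y. letter_act (i, b) y = (if i = 1 then m (m y) else m y)"
    using letter_act_cases by metis
  have m1: "expressible n m" using m(1) assms l expressible_move expressible_unmove by auto
  have m2: "expressible n (\<lambda>y. m (m y))"
    by (rule expressible_compose[OF m1 m1]) (use m(1) in auto)
  have "letter_act l = (if i = 1 then (\<lambda>y. m (m y)) else m)" using l m(2) by auto
  then show ?thesis using m1 m2 by simp
qed

lemma expressible_hurwitz: "w \<in> words {1..n} \<Longrightarrow> expressible n (hurwitz w)"
proof (induction w)
  case Nil
  have "hurwitz [] = (\<lambda>y. y)" by (rule ext) (rule hurwitz_Nil)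
  then show ?case using expressible_id[of n] by simp
next
  case (Cons l w)
  then have "expressible n (\<lambda>y. hurwitz w (letter_act l y))"
    using expressible_compose[of n "hurwitz w" "letter_act l"] expressible_letter_act[of l n] by simp
  moreover have "hurwitz (l # w) = (\<lambda>y. hurwitz w (letter_act l y))"
    by (rule ext) (rule hurwitz_Cons)
  ultimately show ?case by simp
qed

section \<open>The group generated by the entries, up to sign\<close>

definition gens :: "nat \<Rightarrow> (nat \<Rightarrow> mat2) \<Rightarrow> mat2 set" where
  "gens n y = {M. \<exists>u. set u \<subseteq> {..n} \<and> M \<simeq> ev y u}"

lemma gens_mult: "M \<in> gens n y \<Longrightarrow> N \<in> gens n y \<Longrightarrow> M * N \<in> gens n y"
proof -
  assume "M \<in> gens n y" "N \<in> gens n y"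
  then obtain u v where "set u \<subseteq> {..n}" "M \<simeq> ev y u" "set v \<subseteq> {..n}" "N \<simeq> ev y v"
    unfolding gens_def by blast
  then have "set (u @ v) \<subseteq> {..n}" "M * N \<simeq> ev y (u @ v)"
    by (simp_all add: eq_pm_mult)
  then show ?thesis unfolding gens_def by blast
qed

lemma gens_one: "1 \<in> gens n y"
  unfolding gens_def by (auto intro!: exI[of _ "[]"])

lemma gens_power: "M \<in> gens n y \<Longrightarrow> M ^ k \<in> gens n y"
  by (induction k) (simp_all add: gens_one gens_mult)

lemma gens_uminus: "M \<in> gens n y \<Longrightarrow> - M \<in> gens n y"
  unfolding gens_def using eq_pm_trans[OF eq_pm_uminus[of M]] by blast

lemma gens_adj2: "half_turns y \<Longrightarrow> M \<in> gens n y \<Longrightarrow> adj2 M \<in> gens n y"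
proof -
  assume y: "half_turns y" and "M \<in> gens n y"
  then obtain u where u: "set u \<subseteq> {..n}" "M \<simeq> ev y u" unfolding gens_def by blast
  have "adj2 M \<simeq> adj2 (ev y u)" using u(2) by (auto simp: eq_pm_def)
  also have "\<dots> \<simeq> ev y (rev u)" by (rule adj2_ev[OF y])
  finally show ?thesis using u(1) unfolding gens_def by (auto intro!: exI[of _ "rev u"])
qed

lemma gens_entry: "a \<le> n \<Longrightarrow> y a \<in> gens n y"
  unfolding gens_def by (auto intro!: exI[of _ "[a]"])

lemma gens_hurwitz_subset:
  assumes "w \<in> words {1..n}" "half_turns y"
  shows "gens n (hurwitz w y) \<subseteq> gens n y"
proof
  fix M assume "M \<in> gens n (hurwitz w y)"
  then obtain u where u: "set u \<subseteq> {..n}" "M \<simeq> ev (hurwitz w y) u" unfolding gens_def by blast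
  obtain s where s: "\<And>b. b \<le> n \<Longrightarrow> set (s b) \<subseteq> {..n}"
    "\<And>b y. b \<le> n \<Longrightarrow> half_turns y \<Longrightarrow> hurwitz w y b \<simeq> ev y (s b)"
    using expressible_hurwitz[OF assms(1)] unfolding expressible_def by metis
  have "ev (hurwitz w y) u \<simeq> ev y (concat (map s u))"
    by (rule ev_substitute) (use u(1) s(2) assms in auto)
  moreover have "set (concat (map s u)) \<subseteq> {..n}" using u(1) s(1) by fastforce
  ultimately show "M \<in> gens n y" using eq_pm_trans[OF u(2)] unfolding gens_def by blast
qed

text \<open>The inverse braid recovers the old entries from the new ones. So every polygon in the
  orbit may be compared with translates by elements written in the base half-turns.\<close>

lemma gens_hurwitz:
  assumes "w \<in> words {1..n}" "half_turns y"
  shows "gens n (hurwitz w y) = gens n y"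
proof
  have "hurwitz (inv_word (inv_word w) @ inv_word w) y = hurwitz [] y"
    by (rule hurwitz_pres_rel[where n = n, OF inv_word_left]) (use assms in simp_all)
  moreover have "inv_word (inv_word w) = w"
    by (simp add: inv_word_def rev_map comp_def case_prod_beta)
  ultimately have "hurwitz (inv_word w) (hurwitz w y) = y"
    by (simp add: hurwitz_append)
  then show "gens n y \<subseteq> gens n (hurwitz w y)"
    using gens_hurwitz_subset[of "inv_word w" n "hurwitz w y"] assms by simp
qed (rule gens_hurwitz_subset[OF assms])


section \<open>Ideal polygons\<close>

primrec vert :: "(nat \<Rightarrow> mat2) \<Rightarrow> nat \<Rightarrow> real \<times> real" where
  "vert y 0 = (- 1, 0)"
| "vert y (Suc j) = y j \<bullet>\<^sub>v vert y j"

declare vert.simps(2) [simp del]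

lemmas vert_Suc = vert.simps(2)

text \<open>The vectors \<open>vert y j\<close> represent the vertices of an ideal polygon in the hyperbolic plane whose
  sides are preserved by the half-turns \<open>y j\<close>. Both \<open>vert y 0\<close> and \<open>vert y (n + 1)\<close> stand for the point
  at infinity.\<close>

definition polygon :: "nat \<Rightarrow> (nat \<Rightarrow> mat2) \<Rightarrow> bool" where
  "polygon n y \<longleftrightarrow> half_turns y \<and> vert y (Suc n) = (1, 0) \<and>
    (\<forall>i j. i < j \<and> j \<le> Suc n \<longrightarrow> cross (vert y i) (vert y j) \<le> 0) \<and>
    (\<forall>i\<le>n. cross (vert y i) (vert y (Suc i)) < 0)"

lemma polygon_half_turns: "polygon n y \<Longrightarrow> half_turns y"
  by (simp add: polygon_def)

lemma polygon_cross: "polygon n y \<Longrightarrow> i \<le> j \<Longrightarrow> j \<le> Suc n \<Longrightarrow> cross (vert y i) (vert y j) \<le> 0"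
  by (cases "i = j") (auto simp: polygon_def)

lemma polygon_side: "polygon n y \<Longrightarrow> i \<le> n \<Longrightarrow> cross (vert y i) (vert y (Suc i)) < 0"
  by (simp add: polygon_def)

text \<open>Only one vertex changes, and its new position is a nonnegative combination of the old
  one and a neighbour. The convexity inequalities are linear in that vertex, so they survive; the
  positive weight \<open>p\<close> keeps the two sides at it nondegenerate.\<close>

lemma polygon_replace:
  assumes y: "polygon n y" and y': "half_turns y'" and i: "i < n"
    and same: "\<And>j. j \<noteq> Suc i \<Longrightarrow> j \<le> Suc n \<Longrightarrow> vert y' j = vert y j"
    and k: "k = i \<or> k = Suc (Suc i)"
    and comb: "l *\<^sub>R vert y' (Suc i) = p *\<^sub>R vert y (Suc i) + q *\<^sub>R vert y k" "l > 0" "p > 0" "q \<ge> 0"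
  shows "polygon n y'"
proof -
  let ?V = "vert y" and ?w = "vert y' (Suc i)"
  have left: "l * cross v ?w = p * cross v (?V (Suc i)) + q * cross v (?V k)" for v
    using arg_cong[OF comb(1), of "cross v"] by (simp add: cross_scaleR_right cross_add_right)
  have right: "l * cross ?w v = p * cross (?V (Suc i)) v + q * cross (?V k) v" for v
    using arg_cong[OF comb(1), of "\<lambda>w. cross w v"] by (simp add: cross_scaleR_left cross_add_left)
  have lw: "cross (?V j) ?w \<le> 0" if "j \<le> i" for j
  proof -
    have "p * cross (?V j) (?V (Suc i)) \<le> 0" "q * cross (?V j) (?V k) \<le> 0"
      using polygon_cross[OF y, of j] that i k comb by (auto intro!: mult_nonneg_nonpos)
    then show ?thesis using left[of "?V j"] comb(2) by (smt (verit) mult_pos_pos)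
  qed
  have rw: "cross ?w (?V j) \<le> 0" if "Suc (Suc i) \<le> j" "j \<le> Suc n" for j
  proof -
    have "p * cross (?V (Suc i)) (?V j) \<le> 0" "q * cross (?V k) (?V j) \<le> 0"
      using polygon_cross[OF y, of _ j] that i k comb by (auto intro!: mult_nonneg_nonpos)
    then show ?thesis using right[of "?V j"] comb(2) by (smt (verit) mult_pos_pos)
  qed
  have lw': "cross (?V i) ?w < 0"
  proof -
    have "p * cross (?V i) (?V (Suc i)) < 0" "q * cross (?V i) (?V k) \<le> 0"
      using polygon_cross[OF y, of i] polygon_side[OF y, of i] i k comb
      by (auto intro!: mult_nonneg_nonpos mult_pos_neg)
    then show ?thesis using left[of "?V i"] comb(2) by (smt (verit) mult_nonneg_nonneg)
  qed
  have rw': "cross ?w (?V (Suc (Suc i))) < 0"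
  proof -
    have "p * cross (?V (Suc i)) (?V (Suc (Suc i))) < 0" "q * cross (?V k) (?V (Suc (Suc i))) \<le> 0"
      using polygon_cross[OF y, of _ "Suc (Suc i)"] polygon_side[OF y, of "Suc i"] i k comb
      by (auto intro!: mult_nonneg_nonpos mult_pos_neg)
    then show ?thesis using right[of "?V (Suc (Suc i))"] comb(2) by (smt (verit) mult_nonneg_nonneg)
  qed
  show ?thesis
    unfolding polygon_def
  proof (intro conjI allI impI)
    show "vert y' (Suc n) = (1, 0)" using same[of "Suc n"] i y by (simp add: polygon_def)
    show "cross (vert y' j) (vert y' k) \<le> 0" if jk: "j < k \<and> k \<le> Suc n" for j k
    proof -
      consider "j = Suc i" "k \<noteq> Suc i" | "k = Suc i" "j \<noteq> Suc i" | "j \<noteq> Suc i" "k \<noteq> Suc i"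
        using jk by auto
      then show ?thesis
      proof cases
        case 1
        then show ?thesis using rw[of k] jk same[of k] by (simp)
      next
        case 2
        then show ?thesis using lw[of j] jk same[of j] by (simp)
      next
        case 3
        then show ?thesis using same[of j] same[of k] jk polygon_cross[OF y, of j k] by simp
      qed
    qed
    show "cross (vert y' j) (vert y' (Suc j)) < 0" if j: "j \<le> n" for j
    proof -
      consider "j = i" | "j = Suc i" | "j \<noteq> i" "j \<noteq> Suc i" by blast
      then show ?thesis
      proof cases
        case 1
        then show ?thesis using lw' same[of i] i by (simp)
      next
        case 2
        then show ?thesis using rw' same[of "Suc (Suc i)"] i by (simp)
      next
        case 3
        then show ?thesis using polygon_side[OF y j] same[of j] same[of "Suc j"] j
          by (simp)
      qed
    qed
  qed (rule y')
qed

lemma polygon_move: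
  assumes y: "polygon n y" and i: "i < n"
  shows "polygon n (move i y)"
proof -
  let ?V = "vert y" and ?W = "vert (move i y)"
  have h: "half_turn (y i)" using polygon_half_turns[OF y] by (rule half_turnsD)
  have W0: "?W j = ?V j" if "j \<le> i" for j
    using that by (induction j) (auto simp: move_def vert_Suc)
  \<comment> \<open>The half-turn \<open>y i\<close> carries the vertex \<open>i + 2\<close>, which
    lies outside the side \<open>i\<close>, to a point between the ends of this side.\<close>
  have W1: "?W (Suc i) = - (y i \<bullet>\<^sub>v ?V (Suc (Suc i)))"
    by (simp add: vert_Suc[of "move i y" i] W0) (simp add: move_def mv_uminus mv_mult vert_Suc)
  have W2: "?W (Suc (Suc i)) = ?V (Suc (Suc i))"
  proof -
    have "?W (Suc (Suc i)) = y i \<bullet>\<^sub>v ?W (Suc i)"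
      unfolding vert_Suc[of "move i y" "Suc i"] by (simp add: move_def)
    then show ?thesis unfolding W1 by (simp add: mv_uminus_right half_turn_mv[OF h])
  qed
  have W3: "?W (Suc (Suc i) + j) = ?V (Suc (Suc i) + j)" for j
  proof (induction j)
    case 0
    then show ?case using W2 by simp
  next
    case (Suc j)
    have "move i y (Suc (Suc i) + j) = y (Suc (Suc i) + j)" by (simp add: move_def)
    then show ?case using Suc by (simp add: vert_Suc)
  qed
  have same: "?W j = ?V j" if j: "j \<noteq> Suc i" for j
  proof (cases "j \<le> i")
    case False
    then obtain k where "j = Suc (Suc i) + k"
      using j less_iff_Suc_add[of "Suc i" j] by auto
    then show ?thesis using W3[of k] by simp
  qed (rule W0)
  have "cross (?V i) (?V (Suc i)) *\<^sub>R ?V (Suc (Suc i)) =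
      cross (?V (Suc (Suc i))) (?V (Suc i)) *\<^sub>R ?V i + cross (?V i) (?V (Suc (Suc i))) *\<^sub>R ?V (Suc i)"
    by (rule cross_basis)
  from arg_cong[OF this, of "(\<bullet>\<^sub>v) (y i)"]
  have "cross (?V i) (?V (Suc i)) *\<^sub>R (y i \<bullet>\<^sub>v ?V (Suc (Suc i))) =
      cross (?V (Suc (Suc i))) (?V (Suc i)) *\<^sub>R ?V (Suc i) - cross (?V i) (?V (Suc (Suc i))) *\<^sub>R ?V i"
    using half_turn_mv[OF h, of "?V i"] unfolding mv_add mv_scaleR vert_Suc[of y i, symmetric] by simp
  then have comb: "(- cross (?V i) (?V (Suc i))) *\<^sub>R ?W (Suc i) =
      (- cross (?V (Suc i)) (?V (Suc (Suc i)))) *\<^sub>R ?V (Suc i) + (- cross (?V i) (?V (Suc (Suc i)))) *\<^sub>R ?V i"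
    unfolding W1 cross_swap[of "?V (Suc i)" "?V (Suc (Suc i))"] by (simp)
  show ?thesis
    by (rule polygon_replace[OF y _ i same _ comb])
      (use y i polygon_side[OF y, of i] polygon_side[OF y, of "Suc i"] polygon_cross[OF y, of i "Suc (Suc i)"]
        polygon_half_turns[OF y] in auto)
qed

lemma polygon_unmove:
  assumes y: "polygon n y" and i: "i < n"
  shows "polygon n (unmove i y)"
proof -
  let ?V = "vert y" and ?W = "vert (unmove i y)"
  have h: "half_turn (y i)" "half_turn (y (Suc i))"
    using polygon_half_turns[OF y] by (simp_all add: half_turnsD)
  have W0: "?W j = ?V j" if "j \<le> i" for j
    using that by (induction j) (auto simp: unmove_def vert_Suc)
  have W1: "?W (Suc i) = y (Suc i) \<bullet>\<^sub>v ?V i"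
    by (simp add: vert_Suc[of "unmove i y" i] W0) (simp add: unmove_def)
  have W2: "?W (Suc (Suc i)) = ?V (Suc (Suc i))"
  proof -
    have "?W (Suc (Suc i)) = (- (y (Suc i) * y i * y (Suc i))) \<bullet>\<^sub>v ?W (Suc i)"
      unfolding vert_Suc[of "unmove i y" "Suc i"] by (simp add: unmove_def)
    then show ?thesis unfolding W1 by (simp add: mv_uminus mv_uminus_right mv_mult half_turn_mv[OF h(2)] vert_Suc)
  qed
  have W3: "?W (Suc (Suc i) + j) = ?V (Suc (Suc i) + j)" for j
  proof (induction j)
    case 0
    then show ?case using W2 by simp
  next
    case (Suc j)
    have "unmove i y (Suc (Suc i) + j) = y (Suc (Suc i) + j)" by (simp add: unmove_def)
    then show ?case using Suc by (simp add: vert_Suc)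
  qed
  have same: "?W j = ?V j" if j: "j \<noteq> Suc i" for j
  proof (cases "j \<le> i")
    case False
    then obtain k where "j = Suc (Suc i) + k"
      using j less_iff_Suc_add[of "Suc i" j] by auto
    then show ?thesis using W3[of k] by simp
  qed (rule W0)
  have y2: "y (Suc i) \<bullet>\<^sub>v ?V (Suc i) = ?V (Suc (Suc i))" "y (Suc i) \<bullet>\<^sub>v ?V (Suc (Suc i)) = - ?V (Suc i)"
    by (simp_all add: vert_Suc[of y "Suc i"] half_turn_mv[OF h(2)])
  have "cross (?V (Suc i)) (?V (Suc (Suc i))) *\<^sub>R ?V i =
      cross (?V i) (?V (Suc (Suc i))) *\<^sub>R ?V (Suc i) + cross (?V (Suc i)) (?V i) *\<^sub>R ?V (Suc (Suc i))"
    by (rule cross_basis)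
  from arg_cong[OF this, of "(\<bullet>\<^sub>v) (y (Suc i))"]
  have "cross (?V (Suc i)) (?V (Suc (Suc i))) *\<^sub>R ?W (Suc i) =
      cross (?V i) (?V (Suc (Suc i))) *\<^sub>R ?V (Suc (Suc i)) - cross (?V (Suc i)) (?V i) *\<^sub>R ?V (Suc i)"
    unfolding mv_add mv_scaleR y2 W1 by simp
  then have comb: "(- cross (?V (Suc i)) (?V (Suc (Suc i)))) *\<^sub>R ?W (Suc i) =
      (- cross (?V i) (?V (Suc i))) *\<^sub>R ?V (Suc i) + (- cross (?V i) (?V (Suc (Suc i)))) *\<^sub>R ?V (Suc (Suc i))"
    unfolding cross_swap[of "?V i" "?V (Suc i)"] by (simp)
  show ?thesis
    by (rule polygon_replace[OF y _ i same _ comb])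
      (use y i polygon_side[OF y, of i] polygon_side[OF y, of "Suc i"] polygon_cross[OF y, of i "Suc (Suc i)"]
        polygon_half_turns[OF y] in auto)
qed

lemma polygon_hurwitz: "w \<in> words {1..n} \<Longrightarrow> polygon n y \<Longrightarrow> polygon n (hurwitz w y)"
proof (induction w arbitrary: y)
  case (Cons l w)
  obtain i b where l: "l = (i, b)" by (cases l)
  obtain m where m: "m = move (i - 1) \<or> m = unmove (i - 1)"
    "\<And>y. letter_act (i, b) y = (if i = 1 then m (m y) else m y)"
    using letter_act_cases by metis
  have "polygon n (m z)" if "polygon n z" for z
    using m(1) polygon_move[OF that, of "i - 1"] polygon_unmove[OF that, of "i - 1"] Cons.prems(1) l by auto
  then have "polygon n (letter_act l y)" using Cons.prems(2) l m(2) by simp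
  then show ?case using Cons by (simp add: hurwitz_Cons)
qed simp

section \<open>Sectors and ping-pong\<close>

text \<open>The product of two cross products is unchanged by \<open>v \<mapsto> - v\<close>, so it
  describes boundary points. This arc and its complement below are both closed, so that the ends of
  the side belong to both.\<close>

definition in_sector :: "(nat \<Rightarrow> mat2) \<Rightarrow> nat \<Rightarrow> real \<times> real \<Rightarrow> bool" where
  "in_sector y a v \<longleftrightarrow> cross (vert y a) v * cross v (vert y (Suc a)) \<ge> 0"

definition out_of_sector :: "(nat \<Rightarrow> mat2) \<Rightarrow> nat \<Rightarrow> real \<times> real \<Rightarrow> bool" where
  "out_of_sector y a v \<longleftrightarrow> cross (vert y a) v * cross v (vert y (Suc a)) \<le> 0"

lemma in_sector_comb:
  assumes y: "polygon n y" and b: "b \<le> n" and v: "in_sector y b v"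
  obtains s p q where "s \<noteq> 0" "p \<ge> 0" "q \<ge> 0" "s *\<^sub>R v = p *\<^sub>R vert y b + q *\<^sub>R vert y (Suc b)"
proof -
  let ?l = "cross (vert y b) (vert y (Suc b))"
  let ?p = "cross v (vert y (Suc b))" and ?q = "cross (vert y b) v"
  have l: "?l \<noteq> 0" using polygon_side[OF y b] by simp
  have eq: "?l *\<^sub>R v = ?p *\<^sub>R vert y b + ?q *\<^sub>R vert y (Suc b)" by (rule cross_basis)
  have "?p \<ge> 0 \<and> ?q \<ge> 0 \<or> ?p \<le> 0 \<and> ?q \<le> 0"
    using v by (auto simp: in_sector_def zero_le_mult_iff)
  then show thesis
  proof
    assume "?p \<ge> 0 \<and> ?q \<ge> 0"
    then show thesis using that[OF l _ _ eq] by blast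
  next
    assume neg: "?p \<le> 0 \<and> ?q \<le> 0"
    have "(- ?l) *\<^sub>R v = (- ?p) *\<^sub>R vert y b + (- ?q) *\<^sub>R vert y (Suc b)"
      using eq by simp
    from that[OF _ _ _ this] show thesis using l neg by simp
  qed
qed

text \<open>A nonnegative combination of the ends of side \<open>b\<close> compares with the other
  vertices as these ends do. The factor \<open>s\<^sup>2\<close> absorbs the unknown sign of
  \<open>v\<close>.\<close>

lemma in_sector_side:
  assumes y: "polygon n y" and b: "b \<le> n" and v: "in_sector y b v"
    and ij: "i \<le> Suc n" "j \<le> Suc n"
  shows "i \<le> b \<Longrightarrow> b < j \<Longrightarrow> cross (vert y i) v * cross v (vert y j) \<ge> 0"
    and "i \<le> b \<Longrightarrow> j \<le> b \<Longrightarrow> cross (vert y i) v * cross v (vert y j) \<le> 0"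
    and "b < i \<Longrightarrow> b < j \<Longrightarrow> cross (vert y i) v * cross v (vert y j) \<le> 0"
proof -
  obtain s p q where s: "s \<noteq> 0" and pq: "p \<ge> 0" "q \<ge> 0"
    and eq: "s *\<^sub>R v = p *\<^sub>R vert y b + q *\<^sub>R vert y (Suc b)"
    by (rule in_sector_comb[OF y b v])
  define L where "L = p * cross (vert y i) (vert y b) + q * cross (vert y i) (vert y (Suc b))"
  define R where "R = p * cross (vert y b) (vert y j) + q * cross (vert y (Suc b)) (vert y j)"
  have "s * cross (vert y i) v = L" "s * cross v (vert y j) = R"
    using arg_cong[OF eq, of "cross (vert y i)"] arg_cong[OF eq, of "\<lambda>w. cross w (vert y j)"]
    by (simp_all add: L_def R_def cross_scaleR_left cross_scaleR_right cross_add_left cross_add_right)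
  then have LR: "s\<^sup>2 * (cross (vert y i) v * cross v (vert y j)) = L * R"
    by (auto simp: power2_eq_square)
  have s2: "s\<^sup>2 > 0" using s by simp
  have neg: "cross (vert y k) (vert y l) \<le> 0" if "k \<le> l" "l \<le> Suc n" for k l
    using polygon_cross[OF y that] .
  have pos: "cross (vert y l) (vert y k) \<ge> 0" if "k \<le> l" "l \<le> Suc n" for k l
    using neg[OF that] cross_swap[of "vert y l" "vert y k"] by simp
  have L: "i \<le> b \<Longrightarrow> L \<le> 0" "b < i \<Longrightarrow> L \<ge> 0"
    using pq b ij neg[of i] pos[of _ i] unfolding L_def
    by (auto intro!: add_nonpos_nonpos add_nonneg_nonneg mult_nonneg_nonpos mult_nonneg_nonneg)
  have R: "b < j \<Longrightarrow> R \<le> 0" "j \<le> b \<Longrightarrow> R \<ge> 0"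
    using pq b ij neg[of _ j] pos[of j] unfolding R_def
    by (auto intro!: add_nonpos_nonpos add_nonneg_nonneg mult_nonneg_nonpos mult_nonneg_nonneg)
  show "i \<le> b \<Longrightarrow> b < j \<Longrightarrow> cross (vert y i) v * cross v (vert y j) \<ge> 0"
    using LR L R s2 mult_nonpos_nonpos[of L R] by (metis zero_le_mult_iff not_less)
  show "i \<le> b \<Longrightarrow> j \<le> b \<Longrightarrow> cross (vert y i) v * cross v (vert y j) \<le> 0"
    using LR L R s2 mult_nonpos_nonneg[of L R] by (metis mult_le_0_iff not_less)
  show "b < i \<Longrightarrow> b < j \<Longrightarrow> cross (vert y i) v * cross v (vert y j) \<le> 0"
    using LR L R s2 mult_nonneg_nonpos[of L R] by (metis mult_le_0_iff not_less)
qed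

lemma in_sector_out_of_sector:
  assumes "polygon n y" "a \<le> n" "b \<le> n" "a \<noteq> b" "in_sector y b v"
  shows "out_of_sector y a v"
  unfolding out_of_sector_def
  using in_sector_side(2,3)[OF assms(1,3,5), of a "Suc a"] assms by (cases "a < b") auto

lemma out_of_sector_vert:
  assumes y: "polygon n y" and "a \<le> n" "j \<le> Suc n"
  shows "out_of_sector y a (vert y j)"
proof (cases "j \<le> a")
  case True
  then show ?thesis
    using polygon_cross[OF y, of j a] polygon_cross[OF y, of j "Suc a"] assms
      cross_swap[of "vert y a" "vert y j"]
    unfolding out_of_sector_def by (intro mult_nonneg_nonpos) auto
next
  case False
  then show ?thesis
    using polygon_cross[OF y, of a j] polygon_cross[OF y, of "Suc a" j] assms
      cross_swap[of "vert y j" "vert y (Suc a)"]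
    unfolding out_of_sector_def by (intro mult_nonpos_nonneg) auto
qed

lemma in_sector_half_turn:
  assumes y: "polygon n y" and v: "out_of_sector y a v"
  shows "in_sector y a (y a \<bullet>\<^sub>v v)"
proof -
  have h: "half_turn (y a)" using polygon_half_turns[OF y] by (rule half_turnsD)
  have "vert y a = - (y a \<bullet>\<^sub>v vert y (Suc a))"
    by (simp add: vert_Suc half_turn_mv[OF h])
  then have "cross (vert y a) (y a \<bullet>\<^sub>v v) = cross v (vert y (Suc a))"
    using cross_mv[OF half_turn_det[OF h], of "vert y (Suc a)" v]
      cross_swap[of v "vert y (Suc a)"] by simp
  moreover have "cross (y a \<bullet>\<^sub>v v) (vert y (Suc a)) = - cross (vert y a) v"
    unfolding vert_Suc cross_mv[OF half_turn_det[OF h]] by (rule cross_swap)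
  ultimately show ?thesis using v by (simp add: in_sector_def out_of_sector_def mult.commute)
qed

text \<open>Ping-pong: the half-turn \<open>y a\<close> maps the complement of the side \<open>a\<close> into the sector cut off by
  that side.\<close>

lemma in_sector_ev:
  assumes y: "polygon n y" and "distinct_adj (a # u)" "set (a # u) \<subseteq> {..n}" "j \<le> Suc n"
  shows "in_sector y a (ev y (a # u) \<bullet>\<^sub>v vert y j)"
  using assms(2,3)
proof (induction u arbitrary: a)
  case Nil
  then show ?case using in_sector_half_turn[OF y out_of_sector_vert[OF y]] assms(4) by simp
next
  case (Cons b u)
  then have "in_sector y b (ev y (b # u) \<bullet>\<^sub>v vert y j)" by simp
  then have "out_of_sector y a (ev y (b # u) \<bullet>\<^sub>v vert y j)"
    using in_sector_out_of_sector[OF y, of a b] Cons.prems by auto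
  from in_sector_half_turn[OF y this] show ?case by (simp add: mv_mult)
qed

text \<open>A nonempty reduced word maps all vertices into the sector of its first letter, and this
  sector lies on one side of the diagonal from infinity to \<open>vert y k\<close>. So the diagonal
  does not separate the two image points.\<close>

lemma noncrossing:
  assumes y: "polygon n y" and f: "f \<in> gens n y" and jk: "j \<le> Suc n" "k \<le> Suc n"
  shows "(cross (vert y 0) (f \<bullet>\<^sub>v vert y 0) * cross (f \<bullet>\<^sub>v vert y 0) (vert y k)) *
    (cross (vert y 0) (f \<bullet>\<^sub>v vert y j) * cross (f \<bullet>\<^sub>v vert y j) (vert y k)) \<ge> 0"
proof -
  let ?S = "\<lambda>v. cross (vert y 0) v * cross v (vert y k)"
  have h: "half_turns y" by (rule polygon_half_turns[OF y])
  obtain u where u: "set u \<subseteq> {..n}" "f \<simeq> ev y u" using f by (auto simp: gens_def)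
  obtain u' where u': "distinct_adj u'" "set u' \<subseteq> {..n}" "ev y u \<simeq> ev y u'"
    using ev_reduced[of u] u(1) h by blast
  have eq: "?S (f \<bullet>\<^sub>v v) = ?S (ev y u' \<bullet>\<^sub>v v)" for v
    using eq_pm_trans[OF u(2) u'(3)] by (auto simp: eq_pm_def mv_uminus)
  show ?thesis
  proof (cases u')
    case Nil
    then show ?thesis unfolding eq by simp
  next
    case (Cons a w)
    have sec: "in_sector y a (ev y u' \<bullet>\<^sub>v vert y i)" if "i \<le> Suc n" for i
      using in_sector_ev[OF y, of a w i] u' that by (simp add: Cons)
    have a: "a \<le> n" using u'(2) Cons by simp
    show ?thesis
      unfolding eq using in_sector_side(1,2)[OF y a sec, of _ 0 k] jk
      by (cases "a < k") (auto simp del: vert.simps intro!: mult_nonneg_nonneg mult_nonpos_nonpos)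
  qed
qed


section \<open>Points on the boundary of the hyperbolic plane\<close>

text \<open>The image of the point at infinity; \<open>pt M = 0\<close> is a junk value if \<open>M\<close> fixes it.\<close>

fun pt :: "mat2 \<Rightarrow> real" where
  "pt (Mat p q r s) = p / r"

fun fixes_infinity :: "mat2 \<Rightarrow> bool" where
  "fixes_infinity (Mat p q r s) \<longleftrightarrow> r = 0"

lemma pt_uminus [simp]: "pt (- M) = pt M"
  by (cases M) simp

lemma pt_eq_pm: "M \<simeq> N \<Longrightarrow> pt M = pt N"
  by (auto simp: eq_pm_def)

lemma vert_end:
  assumes y: "polygon n y"
  shows "vert y n = y n \<bullet>\<^sub>v vert y 0"
proof -
  have "y n \<bullet>\<^sub>v vert y n = - vert y 0"
    using y by (simp add: polygon_def vert_Suc)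
  then have "y n \<bullet>\<^sub>v (y n \<bullet>\<^sub>v vert y n) = - (y n \<bullet>\<^sub>v vert y 0)"
    by (simp only: mv_uminus_right)
  then show ?thesis using half_turn_mv[OF half_turnsD[OF polygon_half_turns[OF y]]] by simp
qed

lemma polygon_end_vert:
  assumes y: "polygon n y" and a: "a \<in> {0, n}"
  obtains j where "j \<le> Suc n" "vert y j = y a \<bullet>\<^sub>v vert y 0"
  using a vert_end[OF y] that[of 1] that[of n] by (auto simp: vert_Suc)

text \<open>This excludes the junk value of \<open>pt\<close>: the two sides at infinity are
  nondegenerate, so their other ends are finite.\<close>

lemma polygon_finite:
  assumes y: "polygon n y" and a: "a \<in> {0, n}"
  shows "\<not> fixes_infinity (y a)"
proof -
  obtain p q r s where ya: "y a = Mat p q r s" by (cases "y a")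
  have "cross (vert y 0) (y a \<bullet>\<^sub>v vert y 0) \<noteq> 0"
  proof (cases "a = 0")
    case True
    then show ?thesis using polygon_side[OF y, of 0] by (simp add: vert_Suc)
  next
    case False
    have "vert y (Suc n) = - vert y 0" using y by (simp add: polygon_def)
    then have "cross (vert y n) (vert y 0) > 0"
      using polygon_side[OF y order_refl] by (simp del: vert.simps)
    moreover have "a = n" using False a by simp
    ultimately show ?thesis
      using vert_end[OF y] cross_swap[of "vert y 0" "vert y n"] by (simp del: vert.simps)
  qed
  then show ?thesis by (simp add: ya)
qed

lemma noncrossing_pt:
  assumes y: "polygon n y" and f: "f \<in> gens n y" and a: "a \<in> {0, n}" and a': "a' \<in> {0, n}"
    and fin: "\<not> fixes_infinity f" "\<not> fixes_infinity (f * y a)"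
  shows "(pt f - pt (y a')) * (pt (f * y a) - pt (y a')) \<ge> 0"
proof -
  obtain j where j: "j \<le> Suc n" "vert y j = y a \<bullet>\<^sub>v vert y 0" by (rule polygon_end_vert[OF y a])
  obtain k where k: "k \<le> Suc n" "vert y k = y a' \<bullet>\<^sub>v vert y 0" by (rule polygon_end_vert[OF y a'])
  obtain p q r s where ya: "y a' = Mat p q r s" by (cases "y a'")
  have r: "r \<noteq> 0" using polygon_finite[OF y a'] by (simp add: ya)
  \<comment> \<open>The unknown sign of \<open>r\<close> is the same for both image points and drops
    out of the product; the other factor is a square.\<close>
  have side: "cross (vert y 0) (M \<bullet>\<^sub>v vert y 0) * cross (M \<bullet>\<^sub>v vert y 0) (vert y k) =
      (pt M - pt (y a')) * (r * c\<^sup>2)"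
    if "M = Mat p' q' c s'" "c \<noteq> 0" for M p' q' c s'
    using that r by (simp add: k ya power2_eq_square field_simps)
  obtain p1 q1 r1 s1 where f1: "f = Mat p1 q1 r1 s1" by (cases f)
  obtain p2 q2 r2 s2 where f2: "f * y a = Mat p2 q2 r2 s2" by (cases "f * y a")
  have fin': "r1 \<noteq> 0" "r2 \<noteq> 0" using fin unfolding f2 by (simp_all add: f1)
  have "f \<bullet>\<^sub>v vert y j = (f * y a) \<bullet>\<^sub>v vert y 0" by (simp add: j mv_mult)
  then have "((pt f - pt (y a')) * (r * r1\<^sup>2)) * ((pt (f * y a) - pt (y a')) * (r * r2\<^sup>2)) \<ge> 0"
    using noncrossing[OF y f j(1) k(1)] side[OF f1 fin'(1)] side[OF f2 fin'(2)] by simp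
  then have "((pt f - pt (y a')) * (pt (f * y a) - pt (y a'))) * (r * r1 * r2)\<^sup>2 \<ge> 0"
    by (simp add: power2_eq_square algebra_simps)
  moreover have "(r * r1 * r2)\<^sup>2 > 0" using r fin' by simp
  ultimately show ?thesis by (simp add: zero_le_mult_iff)
qed

definition shift :: "real \<Rightarrow> mat2" where
  "shift s = Mat 1 s 0 1"

lemma pt_shift: "\<not> fixes_infinity M \<Longrightarrow> pt (shift s * M) = pt M + s"
  and fixes_infinity_shift: "fixes_infinity (shift s * M) = fixes_infinity M"
  by (cases M; simp add: shift_def field_simps)+

lemma shift_add: "shift s * shift t = shift (s + t)"
  by (simp add: shift_def)

lemma shift_power: "shift s ^ k = shift (real k * s)"
  by (induction k) (simp_all add: shift_add algebra_simps, simp add: shift_def one_mat2_def)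

lemma adj2_shift: "adj2 (shift s) = shift (- s)"
  by (simp add: shift_def)

lemma shift_int_gens:
  assumes "half_turns y" "shift s \<in> gens n y"
  shows "shift (of_int q * s) \<in> gens n y"
proof (cases "q \<ge> 0")
  case True
  then show ?thesis using gens_power[OF assms(2), of "nat q"] by (simp add: shift_power)
next
  case False
  have "shift (- s) \<in> gens n y" using gens_adj2[OF assms] by (simp add: adj2_shift)
  from gens_power[OF this, of "nat (- q)"] show ?thesis using False by (simp add: shift_power)
qed

text \<open>The translates of the side through \<open>pt (y a)\<close> by \<open>shift (K * q) * b\<close> and \<open>shift (K * q) * A * b\<close>
  confine \<open>pt (y a')\<close>.\<close>

lemma adjacent_point:
  fixes m K :: real
  defines "b \<equiv> Mat 0 1 (- 1) 0" and "A \<equiv> Mat m (m\<^sup>2 + 1) (- 1) (- m)"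
  assumes y: "polygon n y" and a: "a \<in> {0, n}" and a': "a' \<in> {0, n}"
    and m: "m > 0" "K = m + 1"
    and gens: "shift K \<in> gens n y" "b \<in> gens n y" "A \<in> gens n y"
    and t: "m / (m\<^sup>2 + 1) < pt (y a)" "pt (y a) < 1 / m"
  shows "\<exists>q. 0 < pt (y a') - of_int q * K \<and> pt (y a') - of_int q * K < 1"
proof -
  define x where "x = pt (y a')"
  define q where "q = \<lfloor>x / K\<rfloor>"
  have h: "half_turns y" by (rule polygon_half_turns[OF y])
  have K: "K > 0" using m by simp
  have x: "of_int q * K \<le> x" "x < of_int (q + 1) * K"
    using floor_divide_lower[OF K, of x] floor_divide_upper[OF K, of x] by (simp_all add: q_def)
  obtain p c r s where ya: "y a = Mat p c r s" by (cases "y a")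
  have r: "r \<noteq> 0" using polygon_finite[OF y a] by (simp add: ya)
  have m2: "m\<^sup>2 + 1 > 0" by (simp add: add_nonneg_pos)
  have t0: "p / r > 0" using t(1) m m2 ya by (smt (verit) divide_pos_pos pt.simps)
  then have p: "p \<noteq> 0" by auto
  \<comment> \<open>The bounds on \<open>pt (y a)\<close> are made for the two translates below:
    \<open>b\<close> sends \<open>1 / m\<close> to \<open>- m\<close>, that is to
    \<open>1 - K\<close>, and \<open>A * b\<close> sends \<open>m / (m\<^sup>2 + 1)\<close> to
    \<open>0\<close>.\<close>
  have inv_t: "r / p > m" "m * (r / p) < m\<^sup>2 + 1"
  proof -
    have "r / p = 1 / (p / r)" by simp
    moreover have "1 / (p / r) > m"
      using t(2) t0 m ya by (simp add: pos_less_divide_eq mult.commute del: divide_divide_eq_right)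
    moreover have "m * (1 / (p / r)) < m\<^sup>2 + 1"
      using t(1) t0 m2 ya by (simp add: pos_divide_less_eq mult.commute del: divide_divide_eq_right)
    ultimately show "r / p > m" "m * (r / p) < m\<^sup>2 + 1" by simp_all
  qed
  have shifts: "shift (of_int i * K) \<in> gens n y" for i by (rule shift_int_gens[OF h gens(1)])
  \<comment> \<open>One translate of the side runs from \<open>of_int (q + 1) * K\<close> to a point
    left of \<open>of_int q * K + 1\<close>. If \<open>x\<close> were between, the vertical side
    ending at \<open>x\<close> would cross it.\<close>
  have "x < of_int q * K + 1"
  proof (rule ccontr)
    assume neg: "\<not> x < of_int q * K + 1"
    let ?f = "shift (of_int (q + 1) * K) * b"
    have f: "?f \<in> gens n y" by (intro gens_mult shifts gens)
    have b1: "pt ?f = of_int (q + 1) * K" by (subst pt_shift) (simp_all add: b_def)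
    have b2: "pt (?f * y a) = of_int (q + 1) * K - r / p"
      unfolding mult.assoc by (subst pt_shift) (use p in \<open>simp_all add: b_def ya\<close>)
    have "(pt ?f - x) * (pt (?f * y a) - x) \<ge> 0"
      unfolding x_def
      by (rule noncrossing_pt[OF y f a a'])
        (use p in \<open>simp_all add: mult.assoc fixes_infinity_shift, simp_all add: b_def ya\<close>)
    moreover have "pt ?f - x > 0" using x b1 by simp
    moreover have "pt (?f * y a) - x < 0"
      using neg b2 inv_t m by (simp add: algebra_simps)
    ultimately show False using mult_pos_neg[of "pt ?f - x" "pt (?f * y a) - x"] by linarith
  qed
  \<comment> \<open>This translate runs from the left of \<open>of_int q * K\<close> to its right,
    which rules out the left end of the period.\<close>
  moreover have "of_int q * K \<noteq> x"
  proof
    assume eq: "of_int q * K = x"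
    let ?f = "shift (of_int q * K) * (A * b)"
    have Ab: "A * b = Mat (- (m\<^sup>2 + 1)) m m (- 1)" by (simp add: A_def b_def)
    have f: "?f \<in> gens n y" by (intro gens_mult shifts gens)
    have b1: "pt ?f = of_int q * K + (- (m\<^sup>2 + 1)) / m"
      by (subst pt_shift) (use m in \<open>simp_all add: Ab\<close>)
    have d: "m * p - r \<noteq> 0" using inv_t(1) p by (auto simp: field_simps)
    have b2: "pt (?f * y a) = of_int q * K + (- (m\<^sup>2 + 1) * p + m * r) / (m * p - r)"
      unfolding mult.assoc[of _ "A * b"] by (subst pt_shift) (use d in \<open>simp_all add: Ab ya\<close>)
    have "(- (m\<^sup>2 + 1) * p + m * r) / (m * p - r) = (m * (r / p) - (m\<^sup>2 + 1)) / (m - r / p)"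
      using p by (simp add: divide_simps) (simp add: algebra_simps)
    also have "\<dots> > 0" using inv_t by (intro divide_neg_neg) simp_all
    finally have "pt (?f * y a) - x > 0" using b2 eq by simp
    moreover have "(- (m\<^sup>2 + 1)) / m < 0" using m m2 by (intro divide_neg_pos) simp_all
    then have "pt ?f - x < 0" using b1 eq by simp
    moreover have "(pt ?f - x) * (pt (?f * y a) - x) \<ge> 0"
      unfolding x_def
      by (rule noncrossing_pt[OF y f a a'])
        (use m d in \<open>simp_all add: mult.assoc[of _ "A * b"] fixes_infinity_shift, simp_all add: Ab ya\<close>)
    ultimately show False using mult_neg_pos[of "pt ?f - x" "pt (?f * y a) - x"] by linarith
  qed
  ultimately show ?thesis using x by (intro exI[of _ q]) (simp add: x_def)
qed

section \<open>The base polygon\<close>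

text \<open>The half-turns about the sides of the ideal polygon with vertices \<open>\<infinity>, 1 - n, \<dots>, - 1, 0\<close>.\<close>

definition base :: "nat \<Rightarrow> nat \<Rightarrow> mat2" where
  "base n j =
    (if j = 0 then Mat (real n - 1) ((real n - 1)\<^sup>2 + 1) (- 1) (1 - real n)
     else if j = n then Mat 0 1 (- 1) 0
     else let p = real j - real n in Mat (- (2 * p + 1)) ((p + 1)\<^sup>2 + p\<^sup>2) (- 2) (2 * p + 1))"

lemma half_turns_base [simp]: "half_turns (base n)"
  unfolding half_turns_def half_turn_def base_def
  by (auto simp: one_mat2_def Let_def power2_eq_square algebra_simps)

lemma base_last: "n \<ge> 1 \<Longrightarrow> base n n = Mat 0 1 (- 1) 0"
  by (simp add: base_def)

lemma base_penultimate: "n \<ge> 2 \<Longrightarrow> base n (n - Suc 0) = Mat 1 1 (- 2) (- 1)"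
  by (simp add: base_def Let_def of_nat_diff)

lemma vert_base: "j < n \<Longrightarrow> vert (base n) (Suc j) = (real (Suc j) - real n, 1)"
proof (induction j)
  case 0
  then show ?case by (simp add: vert_Suc base_def)
next
  case (Suc j)
  then show ?case
    by (simp add: vert_Suc[of _ "Suc j"]) (simp add: base_def Let_def power2_eq_square algebra_simps)
qed

lemma vert_base_end: "n \<ge> 1 \<Longrightarrow> vert (base n) (Suc n) = (1, 0)"
  using vert_base[of "n - 1" n] by (simp add: vert_Suc[of _ n] base_last)

lemma polygon_base: "n \<ge> 1 \<Longrightarrow> polygon n (base n)"
  unfolding polygon_def
proof (intro conjI allI impI)
  assume n: "n \<ge> 1"
  have cr: "cross (vert (base n) i) (vert (base n) j) \<le> 0 \<and>
      (j = Suc i \<longrightarrow> cross (vert (base n) i) (vert (base n) j) < 0)" if "i < j" "j \<le> Suc n" for i j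
  proof -
    obtain j' where j': "j = Suc j'" "j' \<le> n" using \<open>i < j\<close> \<open>j \<le> Suc n\<close> by (cases j) auto
    have vj: "vert (base n) j = (if j' = n then (1, 0) else (real (Suc j') - real n, 1))"
      using j' vert_base[of j' n] vert_base_end[OF n] by auto
    show ?thesis
    proof (cases i)
      case 0
      then show ?thesis unfolding vj using n j'(1) by auto
    next
      case (Suc i')
      then have vi: "vert (base n) i = (real (Suc i') - real n, 1)"
        using vert_base[of i' n] j' that by simp
      show ?thesis unfolding vi vj using Suc j' that by auto
    qed
  qed
  show "vert (base n) (Suc n) = (1, 0)" by (rule vert_base_end[OF n])
  show "cross (vert (base n) i) (vert (base n) j) \<le> 0" if "i < j \<and> j \<le> Suc n" for i j
    using cr that by blast
  show "cross (vert (base n) i) (vert (base n) (Suc i)) < 0" if "i \<le> n" for i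
    using cr[of i "Suc i"] that by blast
qed simp

section \<open>The ordered product of the entries, an invariant of the moves\<close>

definition full :: "nat \<Rightarrow> (nat \<Rightarrow> mat2) \<Rightarrow> mat2" where
  "full n y = ev y [0..<Suc n]"

text \<open>The base polygon is a fan of \<open>n - 1\<close> triangles of the Farey tessellation.
  The half-turns identify all its vertices, and the resulting single cusp gains one unit of width
  from each of the \<open>3 * (n - 1)\<close> corners.\<close>

lemma full_base:
  assumes n: "n \<ge> 1"
  shows "full n (base n) \<simeq> shift (- (3 * (real n - 1)))"
proof -
  \<comment> \<open>Here \<open>c\<close> is the vertex \<open>j + 1\<close>, which the partial
    product sends to infinity, and \<open>s\<close> is the image of infinity. Every further side
    lowers \<open>s\<close> by two.\<close>
  have part: "ev (base n) [0..<Suc j] \<simeq>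
      (let s = 1 - real n - 2 * real j; c = real (Suc j) - real n in Mat s (- (s * c) - 1) 1 (- c))"
    if "j < n" for j
    using that
  proof (induction j)
    case 0
    then show ?case by (simp add: base_def eq_pm_def power2_eq_square algebra_simps)
  next
    case (Suc j)
    define s c where "s = 1 - real n - 2 * real j" and "c = real (Suc j) - real n"
    have "ev (base n) [0..<Suc (Suc j)] = ev (base n) [0..<Suc j] * base n (Suc j)"
      by (simp add: mult.assoc)
    also have "\<dots> \<simeq> Mat s (- (s * c) - 1) 1 (- c) * base n (Suc j)"
      using Suc by (intro eq_pm_mult) (simp_all add: s_def c_def Let_def)
    also have "\<dots> \<simeq> Mat (s - 2) (- ((s - 2) * (c + 1)) - 1) 1 (- (c + 1))"
      using Suc.prems by (simp add: base_def Let_def c_def eq_pm_def power2_eq_square algebra_simps)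
    finally show ?case by (simp add: Let_def s_def c_def algebra_simps)
  qed
  define s where "s = 1 - real n - 2 * real (n - 1)"
  have "full n (base n) = ev (base n) [0..<Suc (n - 1)] * base n n"
    using n by (simp add: full_def)
  also have "\<dots> \<simeq> Mat s (- 1) 1 0 * Mat 0 1 (- 1) 0"
    using part[of "n - 1"] n by (intro eq_pm_mult) (simp_all add: base_last Let_def s_def)
  also have "\<dots> \<simeq> shift (- (3 * (real n - 1)))"
    using n by (simp add: shift_def eq_pm_def s_def of_nat_diff)
  finally show ?thesis .
qed

lemma ev_cong: "(\<And>a. a \<in> set u \<Longrightarrow> y a = y' a) \<Longrightarrow> ev y u = ev y' u"
  by (induction u) auto

lemma full_split:
  assumes "i < n" "\<And>j. j \<noteq> i \<Longrightarrow> j \<noteq> Suc i \<Longrightarrow> y' j = y j" "y' i * y' (Suc i) = y i * y (Suc i)"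
  shows "full n y' = full n y"
proof -
  have "[0..<Suc n] = [0..<i] @ [i, Suc i] @ [Suc (Suc i)..<Suc n]"
    using assms(1) upt_add_eq_append[of 0 i "Suc n - i"] by (simp add: upt_conv_Cons del: upt_Suc)
  moreover have "ev y' [0..<i] = ev y [0..<i]" "ev y' [Suc (Suc i)..<Suc n] = ev y [Suc (Suc i)..<Suc n]"
    by (intro ev_cong assms(2); auto)+
  ultimately show ?thesis using assms(3) by (simp add: full_def del: upt_Suc flip: mult.assoc)
qed

lemma full_move: "half_turns y \<Longrightarrow> i < n \<Longrightarrow> full n (move i y) = full n y"
  by (rule full_split[of i]) (auto simp: move_def mult.assoc half_turns_sq)

lemma full_unmove: "half_turns y \<Longrightarrow> i < n \<Longrightarrow> full n (unmove i y) = full n y"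
  by (rule full_split[of i]) (auto simp: unmove_def mult.assoc half_turns_sq_left)

lemma full_hurwitz: "w \<in> words {1..n} \<Longrightarrow> half_turns y \<Longrightarrow> full n (hurwitz w y) = full n y"
proof (induction w arbitrary: y)
  case (Cons l w)
  obtain i b where l: "l = (i, b)" by (cases l)
  have i: "i - 1 < n" using Cons.prems l by auto
  have "full n (letter_act l y) = full n y"
    using Cons.prems(2) full_move[OF _ i] full_unmove[OF _ i]
    by (auto simp: l letter_act_def Let_def)
  then show ?case using Cons by (simp add: hurwitz_Cons)
qed simp


section \<open>The Garside element acts as a translation\<close>

definition cnj :: "mat2 \<Rightarrow> mat2 \<Rightarrow> mat2" where
  "cnj Z M = Z * M * adj2 Z"

lemma cnj_mult: "cnj (Y * Z) M = cnj Y (cnj Z M)"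
  by (simp add: cnj_def adj2_mult mult.assoc)

lemma cnj_eq_pm: "Y \<simeq> Z \<Longrightarrow> cnj Y M = cnj Z M"
  by (auto simp: eq_pm_def cnj_def)

lemma cnj_half_turn: "half_turn Z \<Longrightarrow> cnj Z M = - (Z * M * Z)"
  by (simp add: cnj_def half_turn_adj2)

lemma cnj_self: "det2 Z = 1 \<Longrightarrow> cnj Z Z = Z"
  by (simp add: cnj_def mult_adj2 mult.assoc)

lemma hurwitz_delta_partial:
  assumes y: "half_turns y" and Y: "Y = cnj (y 0) (y 1)" and "k \<ge> 1"
  shows "hurwitz (pos_word [1..<Suc k]) y =
    (\<lambda>a. if a = 0 then cnj Y (y 0) else if a < k then cnj Y (y (Suc a)) else if a = k then Y else y a)"
  using assms(3)
proof (induction k rule: nat_induct_at_least)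
  case base
  have Yh: "half_turn Y" using y unfolding Y by (simp add: cnj_half_turn half_turnsD half_turn_conj)
  show ?case
    by (rule ext)
      (simp add: pos_word_def hurwitz_Cons letter_act_def Let_def move_def cnj_half_turn[OF Yh],
        simp add: Y cnj_half_turn half_turnsD[OF y] mult.assoc half_turns_sq[OF y] half_turns_sq_left[OF y])
next
  case (Suc k)
  have Yh: "half_turn Y" using y unfolding Y by (simp add: cnj_half_turn half_turnsD half_turn_conj)
  have "hurwitz (pos_word [1..<Suc (Suc k)]) y = move k (hurwitz (pos_word [1..<Suc k]) y)"
    using Suc.hyps by (simp add: pos_word_def hurwitz_append hurwitz_Cons letter_act_def)
  then show ?case
    unfolding Suc.IH using Suc.hyps by (auto simp: move_def cnj_half_turn[OF Yh] less_Suc_eq)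
qed

definition delta_word :: "nat \<Rightarrow> nat word" where
  "delta_word n = pos_word [1..<Suc n]"

text \<open>Each \<open>delta_word n\<close> rotates the positions \<open>1, \<dots>, n\<close> by
  one place, while entry \<open>0\<close> keeps its position. An entry that has passed the end picks
  up a further conjugation by \<open>y 0\<close>. After \<open>n\<close> rounds every entry is back,
  conjugated by the product of all.\<close>

lemma hurwitz_delta_power:
  assumes y: "half_turns y" and n: "n \<ge> 1" and "k \<le> n" and a: "a \<le> n"
  shows "hurwitz (concat (replicate k (delta_word n))) y a =
    (let Z = ev y [0..<Suc k] * adj2 (y 0)
     in if a = 0 then cnj Z (y 0) else if a + k \<le> n then cnj Z (y (a + k))
     else cnj (Z * y 0) (y (a + k - n)))"
  using assms(3) a
proof (induction k arbitrary: a)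
  case 0
  have "y 0 * adj2 (y 0) = 1" using y by (simp add: mult_adj2 half_turnsD half_turn_det)
  then show ?case using 0 by (simp add: Let_def cnj_def)
next
  case (Suc k)
  define t where "t = hurwitz (concat (replicate k (delta_word n))) y"
  define Z where "Z = ev y [0..<Suc k] * adj2 (y 0)"
  define Z' where "Z' = ev y [0..<Suc (Suc k)] * adj2 (y 0)"
  have t: "t a = (if a = 0 then cnj Z (y 0) else if a + k \<le> n then cnj Z (y (a + k))
     else cnj (Z * y 0) (y (a + k - n)))" if "a \<le> n" for a
    using Suc.IH[of a] Suc.prems(1) that by (simp add: t_def Z_def Let_def)
  have th: "half_turns t" using y by (simp add: t_def)
  have y0: "y 0 * adj2 (y 0) = 1" "adj2 (y 0) * y 0 = 1"
    using y by (simp_all add: mult_adj2 adj2_mult_self half_turnsD half_turn_det)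
  have Zd: "det2 Z = 1" using det2_ev[OF y] y by (simp add: Z_def half_turnsD half_turn_det)
  have adjZ: "adj2 Z * Z = 1" by (rule adj2_mult_self[OF Zd])
  define Y where "Y = cnj (t 0) (t 1)"
  have t01: "t 0 = cnj Z (y 0)" "t 1 = cnj Z (y (Suc k))"
    using t[of 0] t[of 1] n Suc.prems(1) by simp_all
  have Y: "Y = Z * (y 0 * y (Suc k) * adj2 (y 0)) * adj2 Z"
  proof -
    have c: "adj2 Z * (Z * X) = X" for X using adjZ by (simp flip: mult.assoc)
    show ?thesis unfolding Y_def t01 by (simp add: cnj_def adj2_mult mult.assoc c)
  qed
  have Z0: "Z * y 0 = ev y [0..<Suc k]" using y0 by (simp add: Z_def mult.assoc)
  have YZ: "Y * Z = Z'"
  proof -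
    have "Y * Z = Z * y 0 * y (Suc k) * adj2 (y 0)" using adjZ by (simp add: Y mult.assoc)
    then show ?thesis unfolding Z0 by (simp add: Z'_def mult.assoc)
  qed
  have Y': "Y = cnj (Z' * y 0) (y (Suc k))"
  proof -
    have "Z' * y 0 = Z * y 0 * y (Suc k)"
      unfolding Z0 using y0 by (simp add: Z'_def mult.assoc)
    then have "cnj (Z' * y 0) (y (Suc k)) = cnj (Z * y 0) (cnj (y (Suc k)) (y (Suc k)))"
      by (simp add: cnj_mult)
    also have "\<dots> = cnj (Z * y 0) (y (Suc k))"
      using y by (simp add: cnj_self half_turnsD half_turn_det)
    also have "\<dots> = Y" by (simp add: Y cnj_def adj2_mult mult.assoc)
    finally show ?thesis by simp
  qed
  have "concat (replicate (Suc k) (delta_word n)) = concat (replicate k (delta_word n)) @ delta_word n"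
    by (simp add: replicate_append_same[symmetric] del: replicate_append_same)
  then have step: "hurwitz (concat (replicate (Suc k) (delta_word n))) y = hurwitz (delta_word n) t"
    by (simp add: hurwitz_append t_def)
  have "hurwitz (delta_word n) t a =
      (if a = 0 then cnj Y (t 0) else if a < n then cnj Y (t (Suc a)) else if a = n then Y else t a)"
    unfolding delta_word_def hurwitz_delta_partial[OF th Y_def n] by simp
  also have "\<dots> = (if a = 0 then cnj Z' (y 0) else if a + Suc k \<le> n then cnj Z' (y (a + Suc k))
     else cnj (Z' * y 0) (y (a + Suc k - n)))"
    using Suc.prems t[of 0] t[of "Suc a"] Y' by (auto simp flip: YZ simp: cnj_mult)
  finally show ?case unfolding step Z'_def Let_def .
qed

lemma hurwitz_garside:
  assumes y: "half_turns y" and n: "n \<ge> 1" and a: "a \<le> n"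
  shows "hurwitz (concat (replicate n (delta_word n))) y a = cnj (full n y) (y a)"
proof -
  have y0: "adj2 (y 0) * y 0 = 1" "cnj (adj2 (y 0)) (y 0) = y 0"
    using y by (simp_all add: adj2_mult_self half_turnsD half_turn_det cnj_def)
  have "ev y [0..<Suc n] * adj2 (y 0) * y 0 = full n y"
    using y0(1) by (simp add: full_def mult.assoc)
  then show ?thesis
    using hurwitz_delta_power[OF y n order_refl a] a y0(2)
    by (auto simp: Let_def cnj_mult full_def)
qed

lemma pt_cnj_shift: "\<not> fixes_infinity M \<Longrightarrow> pt (cnj (shift s) M) = pt M + s"
  by (cases M) (simp add: cnj_def shift_def field_simps)

section \<open>A pseudo-Anosov element\<close>

text \<open>The strand \<open>k\<close> runs once around the strands \<open>0, \<dots>, k - 1\<close>.\<close>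

fun twist :: "nat \<Rightarrow> nat list" where
  "twist 0 = []"
| "twist (Suc k) = (if k = 0 then [1] else Suc k # twist k @ [Suc k])"

definition anosov_word :: "nat \<Rightarrow> nat word" where
  "anosov_word n = pos_word (twist (n - 1)) @ [(n, False)]"

lemma pos_word_append [simp]: "pos_word (u @ v) = pos_word u @ pos_word v"
  and pos_word_Cons [simp]: "pos_word (i # u) = (i, True) # pos_word u"
  and pos_word_Nil [simp]: "pos_word [] = []"
  by (simp_all add: pos_word_def)

lemma hurwitz_twist:
  assumes "half_turns y" "k \<ge> 1"
  shows "hurwitz (pos_word (twist k)) y k = cnj (ev y [0..<k]) (y k) \<and>
    (\<forall>j>k. hurwitz (pos_word (twist k)) y j = y j)"
  using assms(2,1)
proof (induction k arbitrary: y rule: nat_induct_at_least)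
  case base
  then show ?case
    by (auto simp: hurwitz_Cons letter_act_def Let_def move_def cnj_half_turn half_turnsD)
next
  case (Suc k)
  define z where "z = move k y"
  have "hurwitz (pos_word (twist (Suc k))) y = move k (hurwitz (pos_word (twist k)) z)"
    using Suc.hyps by (simp add: z_def hurwitz_Cons hurwitz_append letter_act_def)
  moreover have "hurwitz (pos_word (twist k)) z k = cnj (ev z [0..<k]) (z k)"
    and "\<And>j. j > k \<Longrightarrow> hurwitz (pos_word (twist k)) z j = z j"
    using Suc.IH[of z] Suc.prems by (simp_all add: z_def)
  moreover have "ev z [0..<k] = ev y [0..<k]" by (rule ev_cong) (simp add: z_def move_def)
  moreover have "z k = cnj (y k) (y (Suc k))"
    using Suc.prems by (simp add: z_def move_def cnj_half_turn half_turnsD)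
  moreover have "z j = y j" if "j > Suc k" for j using that by (simp add: z_def move_def)
  ultimately show ?case by (simp add: move_def cnj_mult)
qed

text \<open>The twist conjugates by the first \<open>n - 1\<close> entries, and this is rewritten
  through \<open>full n y\<close>, which is invariant. The last two entries thus evolve by
  themselves, and from the base tuple \<open>n\<close> enters only through the translation
  length.\<close>

lemma hurwitz_anosov:
  assumes y: "half_turns y" and n: "n \<ge> 2"
  shows "hurwitz (anosov_word n) y (n - 1) = y n"
    and "hurwitz (anosov_word n) y n =
      - (y n * cnj (full n y) (- (y n * y (n - 1) * y n)) * y n)"
proof -
  define z where "z = hurwitz (pos_word (twist (n - 1))) y"
  define C where "C = ev y [0..<n - 1]"
  have "n - 1 \<noteq> n" "Suc (n - 1) = n" using n by simp_all
  have "z (n - 1) = cnj C (y (n - 1))" "z n = y n"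
    using hurwitz_twist[OF y, of "n - 1"] n by (simp_all add: z_def C_def)
  moreover have "hurwitz (anosov_word n) y = unmove (n - 1) z"
    using n by (simp add: anosov_word_def hurwitz_append hurwitz_Cons letter_act_def z_def)
  moreover have "cnj C (y (n - 1)) = cnj (full n y) (- (y n * y (n - 1) * y n))"
  proof -
    have "[0..<Suc n] = [0..<n - 1] @ [n - 1, n]"
      using n upt_add_eq_append[of 0 "n - 1" 2] by (simp add: numeral_2_eq_2 Suc_diff_Suc upt_conv_Cons)
    then have "full n y = C * y (n - 1) * y n"
      by (simp add: full_def C_def mult.assoc del: upt_Suc)
    then show ?thesis
      by (simp add: cnj_mult) (simp add: cnj_half_turn half_turnsD[OF y] mult.assoc
        half_turns_sq[OF y] half_turns_sq_left[OF y])
  qed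
  ultimately show "hurwitz (anosov_word n) y (n - 1) = y n"
    and "hurwitz (anosov_word n) y n = - (y n * cnj (full n y) (- (y n * y (n - 1) * y n)) * y n)"
    using \<open>n - 1 \<noteq> n\<close> \<open>Suc (n - 1) = n\<close> by (simp_all add: unmove_def)
qed

lemma twist_letters: "set (twist k) \<subseteq> {1..k}"
  by (induction k) auto

lemma pos_word_words: "pos_word u \<in> words S \<longleftrightarrow> set u \<subseteq> S"
  by (induction u) auto

lemma anosov_word_words: "n \<ge> 1 \<Longrightarrow> anosov_word n \<in> words {1..n}"
  using subset_trans[OF twist_letters[of "n - 1"], of "{1..n}"] by (simp add: anosov_word_def pos_word_words)

abbreviation anosov2 :: "nat \<Rightarrow> nat \<Rightarrow> mat2" where
  "anosov2 n \<equiv> hurwitz (anosov_word n @ anosov_word n) (base n)"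

lemma anosov2_entries:
  fixes n :: nat
  defines "m \<equiv> 3 * (real n - 1) - 1"
  assumes n: "n \<ge> 2"
  defines "p \<equiv> 1 + 2*m + 3*m^2 + 6*m^3 + 9*m^4 + 9*m^5 + 8*m^6 + 5*m^7 + 2*m^8 + m^9"
    and "q \<equiv> 1 + 2*m + 3*m^2 + 4*m^3 + 6*m^4 + 6*m^5 + 4*m^6 + 2*m^7 + m^8"
    and "r \<equiv> 2 + 4*m^2 + 8*m^3 + 11*m^4 + 16*m^5 + 13*m^6 + 10*m^7 + 6*m^8 + 2*m^9 + m^10"
  shows "anosov2 n (n - 1) = Mat (- m) 1 (- (m^2 + 1)) m" "anosov2 n n = Mat (- p) q (- r) p"
proof -
  let ?b = "Mat 0 1 (- 1) 0"
  define y where "y = hurwitz (anosov_word n) (base n)"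
  have y: "half_turns y" by (simp add: y_def)
  have full: "full n y \<simeq> shift (- (m + 1))" "full n (base n) \<simeq> shift (- (m + 1))"
    using full_hurwitz[OF anosov_word_words half_turns_base] full_base[of n] n
    by (simp_all add: y_def m_def)
  \<comment> \<open>A single factor moves the last finite vertex only to
    \<open>m / (m\<^sup>2 + 1)\<close>, an end of the interval whose interior must be reached; hence
    the second factor.\<close>
  have y1: "y (n - 1) = ?b" "y n = Mat (- m) 1 (- (m^2 + 1)) m"
    unfolding y_def hurwitz_anosov[OF half_turns_base n] cnj_eq_pm[OF full(2)]
    using n by (simp_all add: base_last base_penultimate cnj_def shift_def power2_eq_square algebra_simps)
  show "anosov2 n (n - 1) = Mat (- m) 1 (- (m^2 + 1)) m"
    unfolding hurwitz_append y_def[symmetric] hurwitz_anosov[OF y n] by (rule y1)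
  show "anosov2 n n = Mat (- p) q (- r) p"
    unfolding hurwitz_append y_def[symmetric] hurwitz_anosov[OF y n] cnj_eq_pm[OF full(1)] y1
    by (simp add: cnj_def shift_def p_def q_def r_def) (simp add: power_def algebra_simps)
qed

text \<open>\<open>P\<close> and \<open>Q\<close> represent the images of infinity and of the vertex
  \<open>n - 1\<close> under the last half-turn. They bound the arc onto which it maps the arc from
  infinity to that vertex.\<close>

lemma attracting_interval:
  fixes n :: nat
  defines "m \<equiv> 3 * (real n - 1) - 1"
  defines "P \<equiv> anosov2 n n \<bullet>\<^sub>v (- 1, 0)"
    and "Q \<equiv> (anosov2 n n * anosov2 n (n - 1) * anosov2 n n) \<bullet>\<^sub>v (1, 0)"
  assumes n: "n \<ge> 2"
  shows "snd P > 0" "snd Q > 0"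
    and "m / (m\<^sup>2 + 1) < fst P / snd P" "fst P / snd P < 1 / m"
    and "m / (m\<^sup>2 + 1) < fst Q / snd Q" "fst Q / snd Q < 1 / m"
proof -
  define p where "p = 1 + 2*m + 3*m^2 + 6*m^3 + 9*m^4 + 9*m^5 + 8*m^6 + 5*m^7 + 2*m^8 + m^9"
  define q where "q = 1 + 2*m + 3*m^2 + 4*m^3 + 6*m^4 + 6*m^5 + 4*m^6 + 2*m^7 + m^8"
  define r where "r = 2 + 4*m^2 + 8*m^3 + 11*m^4 + 16*m^5 + 13*m^6 + 10*m^7 + 6*m^8 + 2*m^9 + m^10"
  have m: "m \<ge> 1" using n by (simp add: m_def)
  have pos: "m ^ k > 0" for k using m by simp
  have p: "p > 0" unfolding p_def using m by (intro add_pos_nonneg) simp_all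
  have q: "q > 0" unfolding q_def using m by (intro add_pos_nonneg) simp_all
  have r: "r > 0" unfolding r_def using m by (intro add_pos_nonneg) simp_all
  \<comment> \<open>Positivity of \<open>\<alpha>\<close> and \<open>\<beta>\<close> puts
    \<open>p / r\<close> into the interval. They are also the coefficients of \<open>Q\<close> with
    respect to (p, r) and (q, p), so it remains to put \<open>q / p\<close> into the interval as
    well.\<close>
  define \<alpha> where "\<alpha> = r - m * p"
  define \<beta> where "\<beta> = (m\<^sup>2 + 1) * p - m * r"
  have "\<alpha> = 2 - m + 2*m^2 + 5*m^3 + 5*m^4 + 7*m^5 + 4*m^6 + 2*m^7 + m^8"
    unfolding \<alpha>_def p_def r_def by (simp add: power_def algebra_simps)
  moreover have "m ^ 2 \<ge> m" using m by (simp add: power2_eq_square)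
  ultimately have \<alpha>: "\<alpha> > 0" using m pos[of 3] pos[of 4] pos[of 5] pos[of 6] pos[of 7] pos[of 8] by linarith
  have "\<beta> = 1 + 4*m^2 + 4*m^3 + 4*m^4 + 4*m^5 + m^6 + m^7"
    unfolding \<beta>_def p_def r_def by (simp add: power_def algebra_simps)
  then have \<beta>: "\<beta> > 0"
    using pos[of 2] pos[of 3] pos[of 4] pos[of 5] pos[of 6] pos[of 7] by linarith
  have "p - m * q = 1 + m + m^2 + 3*m^3 + 5*m^4 + 3*m^5 + 2*m^6 + m^7"
    unfolding p_def q_def by (simp add: power_def algebra_simps)
  then have pq: "m * q < p"
    using m pos[of 2] pos[of 3] pos[of 4] pos[of 5] pos[of 6] pos[of 7] by linarith
  have "(m\<^sup>2 + 1) * q - m * p = 1 + m + 2*m^2 + 3*m^3 + 3*m^4 + m^5 + m^6"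
    unfolding p_def q_def by (simp add: power_def algebra_simps)
  then have qp: "m * p < (m\<^sup>2 + 1) * q"
    using m pos[of 2] pos[of 3] pos[of 4] pos[of 5] pos[of 6] by linarith
  have P: "P = (p, r)"
    unfolding P_def using anosov2_entries[OF n] by (simp add: m_def p_def r_def)
  have Q: "Q = (p * \<alpha> + q * \<beta>, r * \<alpha> + p * \<beta>)"
    unfolding Q_def anosov2_entries[OF n, folded m_def, folded p_def q_def r_def] \<alpha>_def \<beta>_def
    by (simp add: algebra_simps)
  show "snd P > 0" "snd Q > 0" using p r \<alpha> \<beta> by (simp_all add: P Q add_pos_pos)
  have m2: "m\<^sup>2 + 1 > 0" by (simp add: add_nonneg_pos)
  have crit: "m / (m\<^sup>2 + 1) < x / z \<and> x / z < 1 / m"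
    if "z > 0" "m * z < (m\<^sup>2 + 1) * x" "m * x < z" for x z
    using that m m2 by (simp add: divide_less_eq less_divide_eq field_simps)
  show "m / (m\<^sup>2 + 1) < fst P / snd P" "fst P / snd P < 1 / m"
    using crit[of r p] r \<alpha> \<beta> by (simp_all add: P \<alpha>_def \<beta>_def)
  have "m * (r * \<alpha> + p * \<beta>) < (m\<^sup>2 + 1) * (p * \<alpha> + q * \<beta>)"
  proof -
    have "m * r * \<alpha> < (m\<^sup>2 + 1) * p * \<alpha>" "m * p * \<beta> < (m\<^sup>2 + 1) * q * \<beta>"
      using \<alpha> \<beta> qp by (simp_all add: \<beta>_def)
    then show ?thesis by (simp add: algebra_simps)
  qed
  moreover have "m * (p * \<alpha> + q * \<beta>) < r * \<alpha> + p * \<beta>"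
  proof -
    have "m * p * \<alpha> < r * \<alpha>" "m * q * \<beta> < p * \<beta>"
      using \<alpha> \<beta> pq by (simp_all add: \<alpha>_def)
    then show ?thesis by (simp add: algebra_simps)
  qed
  ultimately show "m / (m\<^sup>2 + 1) < fst Q / snd Q" "fst Q / snd Q < 1 / m"
    using crit[of "snd Q" "fst Q"] \<open>snd Q > 0\<close> by (simp_all add: Q)
qed

text \<open>Since both second coordinates are positive, the arc given by the sign condition avoids
  infinity and is the segment between the two quotients.\<close>

lemma between:
  assumes "w \<noteq> (0, 0)" and z: "snd P > 0" "snd Q > 0" and PQ: "cross P w * cross w Q \<ge> 0"
    and "s < fst P / snd P" "fst P / snd P < t" "s < fst Q / snd Q" "fst Q / snd Q < t"
  shows "s < fst w / snd w \<and> fst w / snd w < t"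
proof -
  obtain x z where w: "w = (x, z)" by (cases w)
  obtain p1 z1 p2 z2 where P: "P = (p1, z1)" and Q: "Q = (p2, z2)" by (cases P; cases Q)
  have z12: "z1 > 0" "z2 > 0" using z by (simp_all add: P Q)
  have z0: "z \<noteq> 0"
  proof
    assume z0: "z = 0"
    then have "x \<noteq> 0" using assms(1) by (simp add: w)
    moreover have "cross P w * cross w Q = - (x\<^sup>2 * (z1 * z2))"
      by (simp add: w P Q z0 power2_eq_square)
    ultimately show False using PQ z12 by (simp add: mult_le_0_iff)
  qed
  have "cross P w * cross w Q = (p1 / z1 - x / z) * (x / z - p2 / z2) * (z1 * z2 * z\<^sup>2)"
    using z12 z0 by (simp add: w P Q power2_eq_square field_simps)
  moreover have "z1 * z2 * z\<^sup>2 > 0" using z12 z0 by simp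
  ultimately have "(p1 / z1 - x / z) * (x / z - p2 / z2) \<ge> 0"
    using PQ by (simp add: zero_le_mult_iff)
  then have "x / z \<le> p1 / z1 \<and> p2 / z2 \<le> x / z \<or> p1 / z1 \<le> x / z \<and> x / z \<le> p2 / z2"
    by (auto simp: zero_le_mult_iff)
  then show ?thesis using assms(5-8) by (auto simp: w P Q)
qed

text \<open>The points of (0, 1) lie beyond side \<open>n\<close>, which joins 0 to infinity. The
  half-turn \<open>base n n\<close> takes them to points less than -1, which lie neither beyond side
  \<open>n\<close> nor beyond side \<open>n - 1\<close> from -1 to 0.\<close>

lemma base_first_letters:
  assumes n: "n \<ge> 2" and u: "distinct_adj u" "set u \<subseteq> {..n}"
    and pt: "0 < pt (ev (base n) u)" "pt (ev (base n) u) < 1"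
  obtains j w where "u = n # j # w" "j < n - 1"
proof -
  have y: "polygon n (base n)" using n by (simp add: polygon_base)
  have vn: "vert (base n) n = (0, 1)" "vert (base n) (n - 1) = (- 1, 1)"
    using n vert_base[of "n - 1" n] vert_base[of "n - 2" n]
    by (simp_all add: Suc_diff_Suc numeral_2_eq_2)
  obtain p q r s where eu: "ev (base n) u = Mat p q r s" by (cases "ev (base n) u")
  have pr: "p * r > 0" using pt(1) by (auto simp: eu zero_less_divide_iff zero_less_mult_iff)
  obtain a u' where au: "u = a # u'" using pt(1) by (cases u) (auto simp: one_mat2_def)
  have sec: "in_sector (base n) a (ev (base n) u \<bullet>\<^sub>v vert (base n) 0)"
    unfolding au by (rule in_sector_ev[OF y]) (use u au in auto)
  have "\<not> a < n"
  proof
    assume "a < n"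
    then have "0 \<le> cross (vert (base n) 0) (ev (base n) u \<bullet>\<^sub>v vert (base n) 0) *
        cross (ev (base n) u \<bullet>\<^sub>v vert (base n) 0) (vert (base n) n)"
      using in_sector_side(1)[OF y _ sec, of 0 n] by simp
    then show False using pr by (simp add: eu vn mult.commute)
  qed
  then have a: "a = n" using u(2) au by simp
  obtain p' q' r' s' where eu': "ev (base n) u' = Mat p' q' r' s'" by (cases "ev (base n) u'")
  have pt': "0 < - (r' / p')" "- (r' / p') < 1"
    using pt n by (simp_all add: au a eu' base_last)
  obtain j w where jw: "u' = j # w" using pt'(1) eu' by (cases u') (auto simp: one_mat2_def)
  have jn: "j \<noteq> n" "j \<le> n" using u jw au a by auto
  have "j \<noteq> n - 1"
  proof
    assume j: "j = n - 1"
    have "in_sector (base n) j (ev (base n) u' \<bullet>\<^sub>v vert (base n) 0)"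
      using in_sector_ev[OF y, of j w 0] u au jw by simp
    then have "(r' + p') * p' \<le> 0"
      using n vn by (simp add: in_sector_def j eu' algebra_simps)
    moreover have "p' \<noteq> 0" using pt'(1) by auto
    ultimately have "(r' + p') * p' / p'\<^sup>2 \<le> 0" by (simp add: divide_le_0_iff)
    moreover have "(r' + p') * p' / p'\<^sup>2 = r' / p' + 1"
      using \<open>p' \<noteq> 0\<close> by (simp add: power2_eq_square add_divide_distrib)
    ultimately have "r' / p' + 1 \<le> 0" by simp
    then show False using pt'(2) by simp
  qed
  then have "j < n - 1" using jn by auto
  then show thesis using that au a jw by blast
qed

text \<open>Replacing the base tuple by \<open>anosov2 n\<close> amounts to multiplying by the square of the
  pseudo-Anosov element from the left: the same reduced word \<open>u\<close> is evaluated in both polygons.\<close>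

lemma anosov2_contracts:
  fixes n :: nat
  defines "m \<equiv> 3 * (real n - 1) - 1"
  assumes n: "n \<ge> 2" and w: "w \<in> words {1..n}" and a: "a \<le> n"
    and pt: "0 < pt (hurwitz w (base n) a)" "pt (hurwitz w (base n) a) < 1"
  shows "m / (m\<^sup>2 + 1) < pt (hurwitz w (anosov2 n) a) \<and> pt (hurwitz w (anosov2 n) a) < 1 / m"
proof -
  let ?y = "anosov2 n"
  have yw: "anosov_word n @ anosov_word n \<in> words {1..n}"
    using n anosov_word_words[of n] by simp
  have y: "polygon n ?y" using polygon_hurwitz[OF yw polygon_base] n by simp
  have yh: "half_turns ?y" by simp
  obtain u0 where u0: "set u0 \<subseteq> {..n}" "\<And>y. half_turns y \<Longrightarrow> hurwitz w y a \<simeq> ev y u0"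
    using expressible_hurwitz[OF w] a unfolding expressible_def by blast
  obtain u where u: "distinct_adj u" "set u \<subseteq> {..n}"
    "\<And>y. half_turns y \<Longrightarrow> ev y u0 \<simeq> ev y u"
    using ev_reduced[of u0] u0(1) by blast
  have hu: "hurwitz w y a \<simeq> ev y u" if "half_turns y" for y
    using eq_pm_trans[OF u0(2)[OF that] u(3)[OF that]] .
  obtain j v where j: "u = n # j # v" "j < n - 1"
    using base_first_letters[OF n u(1,2)] pt pt_eq_pm[OF hu[OF half_turns_base]] by metis
  define x where "x = ev ?y (j # v) \<bullet>\<^sub>v vert ?y 0"
  have "in_sector ?y j x"
    unfolding x_def using in_sector_ev[OF y, of j v 0] u(1,2) j by simp
  then have "cross (vert ?y 0) x * cross x (vert ?y (n - 1)) \<ge> 0"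
    using in_sector_side(1)[OF y, of j x 0 "n - 1"] j by simp
  then have cr: "cross (?y n \<bullet>\<^sub>v vert ?y 0) (?y n \<bullet>\<^sub>v x) * cross (?y n \<bullet>\<^sub>v x) (?y n \<bullet>\<^sub>v vert ?y (n - 1)) \<ge> 0"
    using cross_mv[OF half_turn_det[OF half_turnsD[OF yh]]] by simp
  have "vert ?y n = ?y (n - 1) \<bullet>\<^sub>v vert ?y (n - 1)"
    using n vert_Suc[of ?y "n - 1"] by simp
  then have "?y (n - 1) \<bullet>\<^sub>v vert ?y n = - vert ?y (n - 1)"
    by (simp only: half_turn_mv[OF half_turnsD[OF yh]])
  then have "vert ?y (n - 1) = - (?y (n - 1) \<bullet>\<^sub>v ?y n \<bullet>\<^sub>v vert ?y 0)"
    unfolding vert_end[OF y] by (metis minus_minus)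
  then have Q: "?y n \<bullet>\<^sub>v vert ?y (n - 1) = (?y n * ?y (n - 1) * ?y n) \<bullet>\<^sub>v (1, 0)"
    using mv_uminus_right[of "?y n * ?y (n - 1) * ?y n" "(- 1, 0)"]
    by (simp add: mv_uminus_right mv_mult)
  have W: "?y n \<bullet>\<^sub>v x = ev ?y u \<bullet>\<^sub>v (- 1, 0)" by (simp add: j(1) x_def mv_mult)
  obtain p q r s where M: "ev ?y u = Mat p q r s" by (cases "ev ?y u")
  have "p \<noteq> 0 \<or> r \<noteq> 0" using det2_ev[OF yh, of u] by (auto simp: M)
  then have "ev ?y u \<bullet>\<^sub>v (- 1, 0) \<noteq> (0, 0)" by (simp add: M)
  from between[OF this attracting_interval(1,2)[OF n] cr[unfolded Q W vert.simps(1)]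
      attracting_interval(3-6)[OF n]]
  show ?thesis using pt_eq_pm[OF hu[OF yh]] by (simp add: M m_def)
qed

section \<open>Relations between positive words\<close>

definition peq :: "nat \<Rightarrow> nat list \<Rightarrow> nat list \<Rightarrow> bool" where
  "peq n u v \<longleftrightarrow> (pos_word u, pos_word v) \<in> pres_rel {1..n} (artin_B_rels n)"

lemma peq_sym: "peq n u v \<Longrightarrow> peq n v u"
  unfolding peq_def by (rule pres_rel.sym)

lemma peq_trans [trans]: "peq n u v \<Longrightarrow> peq n v w \<Longrightarrow> peq n u w"
  unfolding peq_def by (rule pres_rel.trans)

lemma peq_refl: "set u \<subseteq> {1..n} \<Longrightarrow> peq n u u"
  by (simp add: peq_def pres_rel.refl pos_word_words)

lemma peq_context:
  "peq n u v \<Longrightarrow> set x \<subseteq> {1..n} \<Longrightarrow> set z \<subseteq> {1..n} \<Longrightarrow> peq n (x @ u @ z) (x @ v @ z)"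
  by (simp add: peq_def pres_rel_append_left pres_rel_append_right pos_word_words)

lemma peq_rel:
  "(pos_word u, pos_word v) \<in> artin_B_rels n \<Longrightarrow> set u \<subseteq> {1..n} \<Longrightarrow> set v \<subseteq> {1..n} \<Longrightarrow> peq n u v"
  using pres_rel.rel[of "[]" "{1..n}" "[]" "pos_word u" "pos_word v" "artin_B_rels n"]
  by (simp add: peq_def pos_word_words)

lemma peq_commute_letter:
  "i \<in> {1..n} \<Longrightarrow> j \<in> {1..n} \<Longrightarrow> \<bar>int i - int j\<bar> \<ge> 2 \<Longrightarrow> peq n [i, j] [j, i]"
  by (rule peq_rel) (auto simp: artin_B_rels_def simp del: pos_word_Cons)

lemma peq_braid: "2 \<le> i \<Longrightarrow> Suc i \<le> n \<Longrightarrow> peq n [i, Suc i, i] [Suc i, i, Suc i]"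
  by (rule peq_rel) (auto simp: artin_B_rels_def simp del: pos_word_Cons)

lemma peq_braid4: "2 \<le> n \<Longrightarrow> peq n [1, 2, 1, 2] [2, 1, 2, 1]"
  by (rule peq_rel) (auto simp: artin_B_rels_def simp del: pos_word_Cons)

lemma peq_commute:
  assumes "i \<in> {1..n}" "set u \<subseteq> {1..n}" "\<And>j. j \<in> set u \<Longrightarrow> \<bar>int i - int j\<bar> \<ge> 2"
  shows "peq n (i # u) (u @ [i])"
  using assms(2,3)
proof (induction u)
  case Nil
  then show ?case using assms(1) by (simp add: peq_refl)
next
  case (Cons j u)
  have "peq n ([] @ [i, j] @ u) ([] @ [j, i] @ u)"
    by (rule peq_context[OF peq_commute_letter]) (use Cons.prems assms(1) in auto)
  also have "peq n ([j] @ (i # u) @ []) ([j] @ (u @ [i]) @ [])"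
    by (rule peq_context) (use Cons assms(1) in auto)
  then have "peq n ([] @ [j, i] @ u) ((j # u) @ [i])" by simp
  finally show ?case by simp
qed

text \<open>Strand \<open>k\<close> circles the earlier strands as a block, and a braid inside the
  block slides through. In words, the critical letter is \<open>i = k - 1\<close>: it needs two
  braid relations, or the relation of length four if \<open>k = 2\<close>.\<close>

lemma twist_commute:
  assumes "1 \<le> i" "i < k" "k \<le> n"
  shows "peq n (i # twist k) (twist k @ [i])"
  using assms
proof (induction k)
  case (Suc k)
  have tw: "set (twist j) \<subseteq> {1..n}" if "j \<le> k" for j
    using subset_trans[OF twist_letters[of j], of "{1..n}"] that Suc.prems by simp
  have k0: "k \<noteq> 0" using Suc.prems by simp
  consider "i < k" | "i = 1" "k = 1" | "i = k" "k \<ge> 2" using Suc.prems by linarith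
  then show ?case
  proof cases
    case 1
    have c: "peq n [i, Suc k] [Suc k, i]" by (rule peq_commute_letter) (use 1 Suc.prems in auto)
    have "peq n ([] @ [i, Suc k] @ (twist k @ [Suc k])) ([] @ [Suc k, i] @ (twist k @ [Suc k]))"
      by (rule peq_context[OF c]) (use tw[of k] Suc.prems in auto)
    also have "peq n ([Suc k] @ (i # twist k) @ [Suc k]) ([Suc k] @ (twist k @ [i]) @ [Suc k])"
      by (rule peq_context[OF Suc.IH]) (use 1 Suc.prems in auto)
    then have "peq n ([] @ [Suc k, i] @ (twist k @ [Suc k])) ((Suc k # twist k) @ [i, Suc k] @ [])" by simp
    also have "peq n ((Suc k # twist k) @ [i, Suc k] @ []) ((Suc k # twist k) @ [Suc k, i] @ [])"
      by (rule peq_context[OF c]) (use tw[of k] Suc.prems in auto)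
    finally show ?thesis using k0 by simp
  next
    case 2
    show ?thesis unfolding 2 using peq_braid4[of n] Suc.prems 2 by (simp add: numeral_2_eq_2)
  next
    case 3
    then obtain l where l: "k = Suc l" "l \<ge> 1" by (cases k) auto
    let ?T = "twist l"
    have T: "set ?T \<subseteq> {1..n}" "set ?T \<subseteq> {1..l}" using tw[of l] twist_letters[of l] l by auto
    have b: "peq n [k, Suc k, k] [Suc k, k, Suc k]" by (rule peq_braid) (use 3 Suc.prems in auto)
    have "peq n ([] @ [k, Suc k, k] @ (?T @ [k, Suc k])) ([] @ [Suc k, k, Suc k] @ (?T @ [k, Suc k]))"
      by (rule peq_context[OF b]) (use T(1) 3 Suc.prems in auto)
    also have "peq n ([Suc k, k] @ (Suc k # ?T) @ [k, Suc k]) ([Suc k, k] @ (?T @ [Suc k]) @ [k, Suc k])"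
    proof (rule peq_context)
      show "peq n (Suc k # ?T) (?T @ [Suc k])"
        by (rule peq_commute) (use T l Suc.prems in force)+
    qed (use 3 Suc.prems in auto)
    then have "peq n ([] @ [Suc k, k, Suc k] @ (?T @ [k, Suc k])) (([Suc k, k] @ ?T) @ [Suc k, k, Suc k] @ [])"
      by simp
    also have "peq n (([Suc k, k] @ ?T) @ [Suc k, k, Suc k] @ []) (([Suc k, k] @ ?T) @ [k, Suc k, k] @ [])"
      by (rule peq_context[OF peq_sym[OF b]]) (use T(1) 3 Suc.prems in auto)
    finally show ?thesis using 3 l by simp
  qed
qed simp

text \<open>The start \<open>j\<close> is left open for two uses: the whole product with
  \<open>j = 1\<close>, and its tail with \<open>j = 2\<close>, from which its square is
  computed.\<close>

lemma interval_shift: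
  assumes "1 \<le> j" "2 \<le> i" "j \<le> i" "i < n"
  shows "peq n ([j..<Suc n] @ [i]) (Suc i # [j..<Suc n])"
proof -
  let ?A = "[j..<i]" and ?B = "[Suc (Suc i)..<Suc n]"
  have dec: "[j..<Suc n] = ?A @ [i, Suc i] @ ?B"
    using assms upt_add_eq_append[of j i "Suc n - i"] by (simp add: upt_conv_Cons del: upt_Suc)
  have A: "set ?A \<subseteq> {1..n}" and B: "set ?B \<subseteq> {1..n}" using assms by auto
  have "peq n ((?A @ [i, Suc i]) @ (i # ?B) @ []) ((?A @ [i, Suc i]) @ (?B @ [i]) @ [])"
    by (rule peq_context[OF peq_commute]) (use A B assms in \<open>auto simp del: upt_Suc\<close>)
  then have "peq n ([j..<Suc n] @ [i]) ((?A @ [i, Suc i]) @ (i # ?B) @ [])"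
    unfolding dec by - (rule peq_sym, simp)
  also have "peq n (?A @ [i, Suc i, i] @ ?B) (?A @ [Suc i, i, Suc i] @ ?B)"
    by (rule peq_context[OF peq_braid]) (use A B assms in auto)
  then have "peq n ((?A @ [i, Suc i]) @ (i # ?B) @ []) ([] @ (?A @ [Suc i]) @ ([i, Suc i] @ ?B))"
    by simp
  also have "peq n ([] @ (?A @ [Suc i]) @ ([i, Suc i] @ ?B)) ([] @ (Suc i # ?A) @ ([i, Suc i] @ ?B))"
    by (rule peq_context[OF peq_sym[OF peq_commute]]) (use A B assms in \<open>auto simp del: upt_Suc\<close>)
  finally show ?thesis by (simp add: dec del: upt_Suc)
qed

lemma interval_shift_list:
  assumes "2 \<le> i" "i \<le> k" "k \<le> n"
  shows "peq n ([2..<Suc n] @ [i..<k]) ([Suc i..<Suc k] @ [2..<Suc n])"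
  using assms(2,3)
proof (induction k rule: dec_induct)
  case base
  then show ?case by (auto intro!: peq_refl simp del: upt_Suc)
next
  case (step k)
  let ?s = "[2..<Suc n]"
  have "peq n ([] @ (?s @ [i..<k]) @ [k]) ([] @ ([Suc i..<Suc k] @ ?s) @ [k])"
    by (rule peq_context[OF step.IH]) (use step assms in auto)
  also have "peq n ([Suc i..<Suc k] @ (?s @ [k]) @ []) ([Suc i..<Suc k] @ (Suc k # ?s) @ [])"
    by (rule peq_context[OF interval_shift]) (use step assms in auto)
  then have "peq n ([] @ ([Suc i..<Suc k] @ ?s) @ [k]) ([Suc i..<Suc k] @ (Suc k # ?s) @ [])" by simp
  finally show ?case using step assms by (simp add: upt_Suc_append del: upt_Suc)
qed

text \<open>The shift of indices by one stops at \<open>n\<close>; two more factors carry the last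
  generator back to \<open>2\<close>. This is where the relation of length four enters.\<close>

lemma delta_square_shift:
  assumes n: "n \<ge> 3"
  shows "peq n ([1..<Suc n] @ [1..<Suc n] @ [n]) (2 # [1..<Suc n] @ [1..<Suc n])"
proof -
  let ?s = "[2..<Suc n]" and ?r = "[3..<Suc n]"
  have s: "?s = 2 # ?r" "[1..<Suc n] = 1 # ?s" and s': "?s = [2..<n] @ [n]"
    using n upt_conv_Cons[of 2 "Suc n"] upt_conv_Cons[of 1 "Suc n"] upt_Suc_append[of 2 n]
    by (simp_all add: numeral_2_eq_2 numeral_3_eq_3 del: upt_Suc)
  have sub: "set ?r \<subseteq> {1..n}" "set ?s \<subseteq> {1..n}" using n by auto
  have "peq n (?s @ [2..<n]) (?r @ ?s)"
    using interval_shift_list[of 2 n n] n by (simp del: upt_Suc)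
  from peq_context[OF peq_sym[OF this], of "[]" "[n]"]
  have "peq n ([] @ (?r @ ?s) @ [n]) ([] @ (?s @ [2..<n]) @ [n])"
    using n by simp
  then have shift: "peq n (?r @ ?s @ [n]) (2 # ?r @ ?s)"
    using s s' by (simp del: upt_Suc)
  have c: "peq n (1 # ?r) (?r @ [1])" by (rule peq_commute) (use n sub in auto)
  have twice: "peq n ([1..<Suc n] @ [1..<Suc n]) ([1, 2, 1] @ ?r @ ?s)"
  proof -
    have "peq n ([1, 2] @ (?r @ [1]) @ ?s) ([1, 2] @ (1 # ?r) @ ?s)"
      by (rule peq_context[OF peq_sym[OF c]]) (use n sub in \<open>auto simp del: upt_Suc\<close>)
    then show ?thesis unfolding s by (simp del: upt_Suc)
  qed
  have "peq n ([] @ ([1..<Suc n] @ [1..<Suc n]) @ [n]) ([] @ ([1, 2, 1] @ ?r @ ?s) @ [n])"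
    by (rule peq_context[OF twice]) (use n in auto)
  also have "peq n ([1, 2, 1] @ (?r @ ?s @ [n]) @ []) ([1, 2, 1] @ (2 # ?r @ ?s) @ [])"
    by (rule peq_context[OF shift]) (use n in auto)
  then have "peq n ([] @ ([1, 2, 1] @ ?r @ ?s) @ [n]) ([] @ [1, 2, 1, 2] @ (?r @ ?s))" by simp
  also have "peq n ([] @ [1, 2, 1, 2] @ (?r @ ?s)) ([] @ [2, 1, 2, 1] @ (?r @ ?s))"
    by (rule peq_context[OF peq_braid4]) (use n sub in \<open>auto simp del: upt_Suc\<close>)
  also have "peq n ([2] @ ([1, 2, 1] @ ?r @ ?s) @ []) ([2] @ ([1..<Suc n] @ [1..<Suc n]) @ [])"
    by (rule peq_context[OF peq_sym[OF twice]]) (use n in auto)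
  then have "peq n ([] @ [2, 1, 2, 1] @ (?r @ ?s)) (2 # [1..<Suc n] @ [1..<Suc n])" by simp
  finally show ?thesis by (simp del: upt_Suc)
qed

lemma delta_power_shift:
  assumes "n \<ge> 3" "k + 2 \<le> n"
  shows "peq n (concat (replicate k [1..<Suc n]) @ [2]) ((k + 2) # concat (replicate k [1..<Suc n]))"
  using assms(2)
proof (induction k)
  case 0
  then show ?case by (simp add: peq_refl numeral_2_eq_2)
next
  case (Suc k)
  let ?d = "[1..<Suc n]" and ?D = "concat (replicate k [1..<Suc n])"
  have D: "set ?D \<subseteq> {1..n}" by (auto simp del: upt_Suc)
  have "peq n (?d @ (?D @ [2]) @ []) (?d @ ((k + 2) # ?D) @ [])"
    by (rule peq_context[OF Suc.IH]) (use Suc.prems in auto)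
  also have "peq n ([] @ (?d @ [k + 2]) @ ?D) ([] @ (Suc (k + 2) # ?d) @ ?D)"
    by (rule peq_context[OF interval_shift]) (use Suc.prems in auto)
  then have "peq n (?d @ ((k + 2) # ?D) @ []) ((Suc k + 2) # ?d @ ?D)" by (simp del: upt_Suc)
  finally show ?case by (simp del: upt_Suc)
qed

text \<open>The \<open>n\<close> factors split into \<open>n - 2\<close>, which move the index from
  \<open>2\<close> up to \<open>n\<close>, and two more, which bring it back.\<close>

lemma garside_commutes:
  assumes n: "n \<ge> 3"
  shows "peq n (concat (replicate n [1..<Suc n]) @ [2]) (2 # concat (replicate n [1..<Suc n]))"
proof -
  let ?d = "[1..<Suc n]" and ?D = "concat (replicate (n - 2) [1..<Suc n])"
  have D: "set ?D \<subseteq> {1..n}" by (auto simp del: upt_Suc)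
  have e: "n - 2 + 2 = n" using n by simp
  have "n = Suc (Suc (n - 2))" using n by simp
  then have dec: "concat (replicate n ?d) = ?d @ ?d @ ?D"
    by (metis concat.simps(2) replicate_Suc)
  have "peq n ((?d @ ?d) @ (?D @ [2]) @ []) ((?d @ ?d) @ (n # ?D) @ [])"
    by (rule peq_context[OF delta_power_shift[OF n, of "n - 2", unfolded e]]) (use n in auto)
  also have "peq n ([] @ (?d @ ?d @ [n]) @ ?D) ([] @ (2 # ?d @ ?d) @ ?D)"
    by (rule peq_context[OF delta_square_shift[OF n]]) (use n in auto)
  then have "peq n ((?d @ ?d) @ (n # ?D) @ []) (2 # ?d @ ?d @ ?D)"
    by (simp del: upt_Suc)
  finally show ?thesis unfolding dec by (simp del: upt_Suc)
qed

section \<open>The action of the Artin group\<close>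

lemma (in group) nat_pow_subgroup: "subgroup H G \<Longrightarrow> x \<in> H \<Longrightarrow> x [^] (k :: nat) \<in> H"
  by (induction k) (auto intro: subgroup.one_closed subgroup.m_closed)

definition cls :: "nat \<Rightarrow> nat word \<Rightarrow> nat word set" where
  "cls n w = pres_rel {1..n} (artin_B_rels n) `` {w}"

lemma cls_eq: "(v, w) \<in> pres_rel {1..n} (artin_B_rels n) \<Longrightarrow> cls n v = cls n w"
  unfolding cls_def by (rule equiv_class_eq[OF equiv_pres_rel])

lemma cls_closed: "w \<in> words {1..n} \<Longrightarrow> cls n w \<in> carrier (artin_B n)"
  by (simp add: cls_def artin_B_def presented_group_class_closed)

lemma carrier_cls: "g \<in> carrier (artin_B n) \<Longrightarrow> \<exists>w\<in>words {1..n}. g = cls n w"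
  unfolding artin_B_def cls_def using presented_group_carrierE by metis

lemma cls_mult:
  "v \<in> words {1..n} \<Longrightarrow> w \<in> words {1..n} \<Longrightarrow> cls n v \<otimes>\<^bsub>artin_B n\<^esub> cls n w = cls n (v @ w)"
  by (simp add: cls_def artin_B_def presented_group_mult)

lemma cls_Nil: "cls n [] = \<one>\<^bsub>artin_B n\<^esub>"
  by (simp add: cls_def artin_B_def one_presented_group)

lemma tau_cls: "tau n i = cls n (pos_word [i])"
  by (simp add: tau_def cls_def)

lemma inv_cls: "w \<in> words {1..n} \<Longrightarrow> inv\<^bsub>artin_B n\<^esub> (cls n w) = cls n (inv_word w)"
  by (rule group.inv_equality[OF group_artin_B])
    (simp_all add: cls_closed cls_mult cls_eq[OF inv_word_left] cls_Nil)

lemma cls_power: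
  "w \<in> words {1..n} \<Longrightarrow> cls n w [^]\<^bsub>artin_B n\<^esub> (k :: nat) = cls n (concat (replicate k w))"
proof (induction k)
  case 0
  then show ?case using monoid.nat_pow_0[OF group.is_monoid[OF group_artin_B]] by (simp add: cls_Nil)
next
  case (Suc k)
  have "concat (replicate k w) \<in> words {1..n}" using Suc.prems by (induction k) auto
  then show ?case
    using Suc monoid.nat_pow_Suc[OF group.is_monoid[OF group_artin_B]]
    by (simp add: cls_mult replicate_append_same[symmetric] del: replicate_append_same)
qed

lemma delta_word_words: "delta_word n \<in> words {1..n}"
  by (auto simp: delta_word_def pos_word_words)

lemma Delta_cls: "Delta_B n = cls n (concat (replicate n (delta_word n)))"
proof -
  have lp: "list_product (artin_B n) (map (tau n) xs) = cls n (pos_word xs)" if "set xs \<subseteq> {1..n}" for xs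
    using that
  proof (induction xs)
    case Nil
    then show ?case by (simp add: list_product_def cls_Nil)
  next
    case (Cons i xs)
    then show ?case
      using cls_mult[of "pos_word [i]" n "pos_word xs"]
      by (simp add: list_product_def tau_cls pos_word_words)
  qed
  have "set [1..<Suc n] \<subseteq> {1..n}" by auto
  from lp[OF this] have "list_product (artin_B n) (map (tau n) [1..<n + 1]) = cls n (delta_word n)"
    by (simp add: delta_word_def del: upt_Suc)
  then show ?thesis unfolding Delta_B_def by (simp add: cls_power[OF delta_word_words])
qed

lemma Delta_closed: "Delta_B n \<in> carrier (artin_B n)"
  unfolding Delta_cls using delta_word_words[of n] by (intro cls_closed) (auto simp: words_def)

definition act :: "nat \<Rightarrow> nat word set \<Rightarrow> nat \<Rightarrow> mat2" where
  "act n g = hurwitz (SOME w. w \<in> g) (base n)"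

lemma act_cls:
  assumes "w \<in> words {1..n}"
  shows "act n (cls n w) = hurwitz w (base n)"
proof -
  have "w \<in> cls n w" using pres_rel.refl[OF assms] by (simp add: cls_def)
  then have "(SOME v. v \<in> cls n w) \<in> cls n w" by (rule someI)
  then have "(w, SOME v. v \<in> cls n w) \<in> pres_rel {1..n} (artin_B_rels n)" by (simp add: cls_def)
  from hurwitz_pres_rel[OF this half_turns_base] show ?thesis by (simp add: act_def)
qed

lemma act_mult_cls:
  assumes "g \<in> carrier (artin_B n)" "w \<in> words {1..n}"
  shows "act n (g \<otimes>\<^bsub>artin_B n\<^esub> cls n w) = hurwitz w (act n g)"
proof -
  obtain v where v: "v \<in> words {1..n}" "g = cls n v" using carrier_cls[OF assms(1)] by blast
  then show ?thesis using assms(2) by (simp add: cls_mult act_cls hurwitz_append)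
qed

lemma act_polygon:
  assumes "n \<ge> 1" "g \<in> carrier (artin_B n)"
  shows "polygon n (act n g)" "gens n (act n g) = gens n (base n)" "full n (act n g) = full n (base n)"
proof -
  obtain v where v: "v \<in> words {1..n}" "g = cls n v" using carrier_cls[OF assms(2)] by blast
  show "polygon n (act n g)" "gens n (act n g) = gens n (base n)" "full n (act n g) = full n (base n)"
    using v polygon_hurwitz[OF v(1) polygon_base[OF assms(1)]] gens_hurwitz[OF v(1) half_turns_base]
      full_hurwitz[OF v(1) half_turns_base] by (simp_all add: act_cls)
qed

text \<open>As \<open>fix_a\<close> holds for every tuple, no step along the word touches the entry.
  An inverse generator is handled backwards, starting from \<open>g\<close> times that
  inverse.\<close>

lemma act_parabolic:
  assumes I: "I \<subseteq> {1..n}" and fix_a: "\<And>i y. i \<in> I \<Longrightarrow> letter_act (i, True) y a = y a"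
    and x: "x \<in> std_parabolic n I" and g: "g \<in> carrier (artin_B n)"
  shows "act n (g \<otimes>\<^bsub>artin_B n\<^esub> x) a = act n g a"
proof -
  interpret G: group "artin_B n" by (rule group_artin_B)
  have tau: "act n (g \<otimes>\<^bsub>artin_B n\<^esub> tau n i) a = act n g a"
    if "i \<in> I" "g \<in> carrier (artin_B n)" for g i
    using that I fix_a act_mult_cls[of g n "pos_word [i]"] by (auto simp: tau_cls hurwitz_Cons)
  have tI: "tau n ` I \<subseteq> carrier (artin_B n)" using tau_closed I by blast
  from x g show ?thesis
    unfolding std_parabolic_def
  proof (induction arbitrary: g rule: generate.induct)
    case (incl h)
    then show ?case using tau by auto
  next
    case (inv h)
    then obtain i where i: "i \<in> I" "h = tau n i" by blast
    have h: "h \<in> carrier (artin_B n)" using i tI by blast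
    have "g \<otimes>\<^bsub>artin_B n\<^esub> inv\<^bsub>artin_B n\<^esub> h \<otimes>\<^bsub>artin_B n\<^esub> h = g"
      using h inv.prems by (simp add: G.m_assoc)
    then show ?case using tau[OF i(1), of "g \<otimes>\<^bsub>artin_B n\<^esub> inv\<^bsub>artin_B n\<^esub> h"] i(2) h inv.prems
      by simp
  next
    case (eng h1 h2)
    have "h1 \<in> carrier (artin_B n)" "h2 \<in> carrier (artin_B n)"
      using eng.hyps G.generate_in_carrier[OF tI] by blast+
    then show ?case using eng.IH(1)[OF eng.prems] eng.IH(2)[of "g \<otimes>\<^bsub>artin_B n\<^esub> h1"] eng.prems
      by (simp add: G.m_assoc)
  qed simp
qed

text \<open>\<open>near n g a\<close> says that the vertex \<open>a\<close> of the polygon of \<open>g\<close> lies in a translate of \<open>(0, 1)\<close> under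
  the translation of length \<open>3 (n - 1)\<close> by which the Garside element acts.\<close>

definition near :: "nat \<Rightarrow> nat word set \<Rightarrow> nat \<Rightarrow> bool" where
  "near n g a \<longleftrightarrow> (\<exists>q :: int. 0 < pt (act n g a) - of_int q * (3 * (real n - 1)) \<and>
    pt (act n g a) - of_int q * (3 * (real n - 1)) < 1)"

section \<open>Nearness and the Garside element\<close>

context
  fixes n :: nat
  assumes n: "n \<ge> 3"
begin

interpretation G: group "artin_B n" by (rule group_artin_B)

abbreviation (input) mul (infixl "\<cdot>" 70) where "x \<cdot> y \<equiv> x \<otimes>\<^bsub>artin_B n\<^esub> y"

abbreviation (input) "period \<equiv> 3 * (real n - 1)"

lemma finite_end: "g \<in> carrier (artin_B n) \<Longrightarrow> a \<in> {0, n} \<Longrightarrow> \<not> fixes_infinity (act n g a)"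
  using polygon_finite[OF act_polygon(1)] n by simp

lemma pt_act_Delta:
  assumes g: "g \<in> carrier (artin_B n)" and a: "a \<in> {0, n}"
  shows "pt (act n (g \<cdot> Delta_B n) a) = pt (act n g a) - period"
proof -
  have w: "concat (replicate n (delta_word n)) \<in> words {1..n}"
    using delta_word_words[of n] by (auto simp: words_def)
  have y: "half_turns (act n g)" using act_polygon(1)[OF _ g] n polygon_half_turns by simp
  have "act n (g \<cdot> Delta_B n) a = cnj (full n (act n g)) (act n g a)"
    unfolding Delta_cls act_mult_cls[OF g w] using hurwitz_garside[OF y, of n a] a n by auto
  also have "full n (act n g) = full n (base n)" using act_polygon(3)[OF _ g] n by simp
  also have "cnj (full n (base n)) (act n g a) = cnj (shift (- period)) (act n g a)"
    by (rule cnj_eq_pm[OF full_base]) (use n in simp)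
  finally show ?thesis by (simp add: pt_cnj_shift[OF finite_end[OF g a]])
qed

lemma pt_act_Delta_power:
  assumes a: "a \<in> {0, n}"
  shows "g \<in> carrier (artin_B n) \<Longrightarrow>
    pt (act n (g \<cdot> (Delta_B n [^]\<^bsub>artin_B n\<^esub> k)) a) = pt (act n g a) - of_nat k * period"
proof (induction k arbitrary: g)
  case (Suc k)
  have D: "Delta_B n \<in> carrier (artin_B n)" by (rule Delta_closed)
  have "g \<cdot> (Delta_B n [^]\<^bsub>artin_B n\<^esub> Suc k) = (g \<cdot> (Delta_B n [^]\<^bsub>artin_B n\<^esub> k)) \<cdot> Delta_B n"
    using D Suc.prems by (simp add: G.m_assoc)
  then show ?case
    using pt_act_Delta[OF _ a, of "g \<cdot> (Delta_B n [^]\<^bsub>artin_B n\<^esub> k)"] Suc D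
    by (simp add: algebra_simps)
qed simp

lemma near_translate:
  assumes "g \<in> carrier (artin_B n)" "g' \<in> carrier (artin_B n)" "a \<in> {0, n}"
    and "pt (act n g' a) = pt (act n g a) - of_int q * period"
  shows "near n g' a \<longleftrightarrow> near n g a"
proof
  assume "near n g' a"
  then obtain p where "0 < pt (act n g' a) - of_int p * period" "pt (act n g' a) - of_int p * period < 1"
    by (auto simp: near_def)
  then show "near n g a"
    unfolding near_def using assms(4) by (intro exI[of _ "p + q"]) (simp add: algebra_simps)
next
  assume "near n g a"
  then obtain p where "0 < pt (act n g a) - of_int p * period" "pt (act n g a) - of_int p * period < 1"
    by (auto simp: near_def)
  then show "near n g' a"
    unfolding near_def using assms(4) by (intro exI[of _ "p - q"]) (simp add: algebra_simps)
qed

lemma near_Delta_power: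
  assumes "g \<in> carrier (artin_B n)" "a \<in> {0, n}"
  shows "near n (g \<cdot> (Delta_B n [^]\<^bsub>artin_B n\<^esub> (k :: nat))) a \<longleftrightarrow> near n g a"
  by (rule near_translate[of _ _ _ "int k"])
    (use assms pt_act_Delta_power Delta_closed in simp_all)

lemma near_central:
  assumes "x \<in> generate (artin_B n) {Delta_B n [^]\<^bsub>artin_B n\<^esub> (2::nat)}" "a \<in> {0, n}"
    "g \<in> carrier (artin_B n)"
  shows "near n (g \<cdot> x) a \<longleftrightarrow> near n g a"
  using assms(1,3)
proof (induction arbitrary: g rule: generate.induct)
  case (incl h)
  then show ?case using near_Delta_power[OF _ assms(2)] by simp
next
  case (inv h)
  have h: "h \<in> carrier (artin_B n)" "h = Delta_B n [^]\<^bsub>artin_B n\<^esub> (2::nat)"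
    using inv.hyps Delta_closed by auto
  have "g \<cdot> inv\<^bsub>artin_B n\<^esub> h \<cdot> h = g" using h(1) inv.prems by (simp add: G.m_assoc)
  then show ?case
    using near_Delta_power[OF _ assms(2), of "g \<cdot> inv\<^bsub>artin_B n\<^esub> h" 2] h inv.prems by simp
next
  case (eng h1 h2)
  have "h1 \<in> carrier (artin_B n)" "h2 \<in> carrier (artin_B n)"
    using eng.hyps G.generate_in_carrier[of "{Delta_B n [^]\<^bsub>artin_B n\<^esub> (2::nat)}"] Delta_closed by blast+
  then show ?case using eng.IH(1)[OF eng.prems] eng.IH(2)[of "g \<cdot> h1"] eng.prems
    by (simp add: G.m_assoc)
qed simp

section \<open>Nearness and the pseudo-Anosov element\<close>

definition anosov :: "nat word set" where
  "anosov = cls n (anosov_word n @ anosov_word n)"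

lemma anosov_closed: "anosov \<in> carrier (artin_B n)"
  unfolding anosov_def using anosov_word_words[of n] n by (intro cls_closed) simp

text \<open>The control of one side passes to the other by \<open>adjacent_point\<close> with
  \<open>m = period - 1\<close>; its three matrices are found in the group generated by the base
  half-turns.\<close>

lemma near_of_interval:
  assumes g: "g \<in> carrier (artin_B n)" and a: "a \<in> {0, n}" "a' \<in> {0, n}"
    and J: "(period - 1) / ((period - 1)\<^sup>2 + 1) < pt (act n g a)" "pt (act n g a) < 1 / (period - 1)"
  shows "near n g a'"
proof -
  let ?y = "act n g"
  have y: "polygon n ?y" and gens: "gens n ?y = gens n (base n)"
    using act_polygon[OF _ g] n by simp_all
  have D: "full n (base n) \<in> gens n (base n)"
    unfolding gens_def full_def mem_Collect_eq
    by (intro exI[of _ "[0..<Suc n]"] conjI eq_pm_refl) auto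
  have "shift (- period) \<in> gens n (base n)"
  proof -
    have "full n (base n) \<simeq> shift (- period)" by (rule full_base) (use n in simp)
    then have "shift (- period) = full n (base n) \<or> shift (- period) = - full n (base n)"
      using eq_pm_sym by (auto simp: eq_pm_def)
    then show ?thesis using D gens_uminus[OF D] by auto
  qed
  from gens_adj2[OF half_turns_base this] this
  have s: "shift period \<in> gens n (base n)" "shift (- period) \<in> gens n (base n)"
    by (simp_all add: adj2_shift)
  have b: "Mat 0 1 (- 1) 0 \<in> gens n (base n)"
    using gens_entry[of n n "base n"] base_last[of n] n by simp
  have a1: "Mat 1 1 (- 2) (- 1) \<in> gens n (base n)"
    using gens_entry[of "n - Suc 0" n "base n"] base_penultimate[of n] n by simp
  \<comment> \<open>Conjugating the penultimate half-turn by the last one gives the half-turn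
    exchanging infinity and 1; the translation then takes 1 to \<open>1 - period\<close>.\<close>
  have "shift (- period) * (- (Mat 0 1 (- 1) 0 * Mat 1 1 (- 2) (- 1) * Mat 0 1 (- 1) 0)) * shift period
      \<in> gens n (base n)"
    by (intro gens_mult gens_uminus s b a1)
  also have "shift (- period) * (- (Mat 0 1 (- 1) 0 * Mat 1 1 (- 2) (- 1) * Mat 0 1 (- 1) 0)) * shift period
      = Mat (period - 1) ((period - 1)\<^sup>2 + 1) (- 1) (- (period - 1))"
    by (simp add: shift_def power2_eq_square algebra_simps)
  finally have A: "Mat (period - 1) ((period - 1)\<^sup>2 + 1) (- 1) (- (period - 1)) \<in> gens n (base n)" .
  show ?thesis
    unfolding near_def
    by (rule adjacent_point[OF y a, of "period - 1" period]) (use n J s b A gens in simp_all)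
qed

text \<open>Here one near end becomes two. A power of the Garside element on the right first brings
  the vertex into (0, 1) itself, where the contraction applies; the power does not affect nearness
  and is removed again.\<close>

lemma near_anosov_mult:
  assumes g: "g \<in> carrier (artin_B n)" and a: "a \<in> {0, n}" "a' \<in> {0, n}" and near: "near n g a"
  shows "near n (anosov \<cdot> g) a'"
proof -
  obtain q where q: "0 < pt (act n g a) - of_int q * period" "pt (act n g a) - of_int q * period < 1"
    using near by (auto simp: near_def)
  have D: "Delta_B n \<in> carrier (artin_B n)" by (rule Delta_closed)
  obtain g' where g': "g' \<in> carrier (artin_B n)" "pt (act n g' a) = pt (act n g a) - of_int q * period"
    and tr: "near n (anosov \<cdot> g') a' \<longleftrightarrow> near n (anosov \<cdot> g) a'"
  proof (cases "q \<ge> 0")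
    case True
    let ?g = "g \<cdot> (Delta_B n [^]\<^bsub>artin_B n\<^esub> nat q)"
    show thesis
      by (rule that[of ?g]) (use True g D a pt_act_Delta_power[OF a(1) g, of "nat q"]
          near_Delta_power[of "anosov \<cdot> g" a' "nat q"] anosov_closed
          in \<open>simp_all add: G.m_assoc\<close>)
  next
    case False
    let ?z = "Delta_B n [^]\<^bsub>artin_B n\<^esub> nat (- q)"
    let ?g = "g \<cdot> inv\<^bsub>artin_B n\<^esub> ?z"
    have z: "?z \<in> carrier (artin_B n)" using D by simp
    have cancel_z: "?g \<cdot> ?z = g" "(anosov \<cdot> ?g) \<cdot> ?z = anosov \<cdot> g"
      using z g anosov_closed by (simp_all add: G.m_assoc)
    show thesis
      by (rule that[of ?g]) (use False g z cancel_z pt_act_Delta_power[OF a(1), of ?g "nat (- q)"]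
          near_Delta_power[of "anosov \<cdot> ?g" a' "nat (- q)"] a anosov_closed in simp_all)
  qed
  obtain w where w: "w \<in> words {1..n}" "g' = cls n w" using carrier_cls[OF g'(1)] by blast
  have "act n (anosov \<cdot> g') = hurwitz w (anosov2 n)"
    using w anosov_word_words[of n] n by (simp add: anosov_def cls_mult act_cls hurwitz_append)
  moreover have "a \<le> n" using a by auto
  ultimately have J: "(period - 1) / ((period - 1)\<^sup>2 + 1) < pt (act n (anosov \<cdot> g') a)"
    "pt (act n (anosov \<cdot> g') a) < 1 / (period - 1)"
    using anosov2_contracts[OF _ w(1), of a] q g' n w by (simp_all add: act_cls)
  have "near n (anosov \<cdot> g') a'"
    by (rule near_of_interval[OF _ a J]) (use g' anosov_closed in simp)
  then show ?thesis using tr by simp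
qed

lemma near_anosov: "a \<in> {0, n} \<Longrightarrow> near n anosov a"
proof -
  assume a: "a \<in> {0, n}"
  have w: "anosov_word n @ anosov_word n \<in> words {1..n}" using anosov_word_words[of n] n by simp
  obtain p q r s where M: "anosov2 n n = Mat p q r s" by (cases "anosov2 n n")
  have "act n anosov n = anosov2 n n" unfolding anosov_def act_cls[OF w] ..
  moreover have "fst (anosov2 n n \<bullet>\<^sub>v (- 1, 0)) / snd (anosov2 n n \<bullet>\<^sub>v (- 1, 0)) = pt (anosov2 n n)"
    by (simp add: M)
  ultimately show ?thesis
    using near_of_interval[OF anosov_closed _ a, of n] attracting_interval(3,4)[of n] n by simp
qed

text \<open>The last finite vertex of the base polygon is 0, and no translate of the open interval
  (0, 1) contains 0 because the period is at least one.\<close>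

lemma not_near_one: "\<not> near n \<one>\<^bsub>artin_B n\<^esub> n"
proof
  assume "near n \<one>\<^bsub>artin_B n\<^esub> n"
  moreover have "act n \<one>\<^bsub>artin_B n\<^esub> n = Mat 0 1 (- 1) 0"
    using act_cls[of "[]" n] base_last[of n] n by (simp add: cls_Nil)
  ultimately obtain q :: int where q: "0 < - (of_int q * period)" "- (of_int q * period) < 1"
    by (auto simp: near_def)
  have per: "period \<ge> 1" using n by simp
  have "q < 0" using q(1) per by (simp add: mult_less_0_iff)
  then have "real_of_int q \<le> - 1" by simp
  then have "of_int q * period \<le> - 1 * period" using per by (intro mult_right_mono) simp_all
  then show False using q(2) per by simp
qed

text \<open>Among the generators only \<open>tau n 1\<close> changes entry \<open>0\<close> and only
  \<open>tau n n\<close> changes entry \<open>n\<close>. A proper interval of indices omits one of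
  them.\<close>

lemma near_parabolic_mult:
  assumes g: "g \<in> carrier (artin_B n)" and x: "x \<in> P_B n" and near: "\<And>a. a \<in> {0, n} \<Longrightarrow> near n g a"
  shows "\<exists>a\<in>{0, n}. near n (g \<cdot> x) a"
  using x unfolding P_B_def
proof (elim UnE UnionE)
  fix H assume H: "H \<in> proper_irred_std_parabolics n" "x \<in> H"
  then obtain I where I: "I \<subset> {1..n}" "H = std_parabolic n I" "\<exists>a b. I = {a..b}"
    by (auto simp: proper_irred_std_parabolics_def)
  then obtain c d where cd: "I = {c..d}" by blast
  have "1 \<notin> I \<or> n \<notin> I"
  proof (rule ccontr)
    assume "\<not> ?thesis"
    then have "{1..n} \<subseteq> I" by (auto simp: cd)
    then show False using I(1) by blast
  qed
  then show ?thesis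
  proof
    assume "1 \<notin> I"
    have "act n (g \<cdot> x) 0 = act n g 0"
    proof (rule act_parabolic[of I])
      show "letter_act (i, True) y 0 = y 0" if "i \<in> I" for i y
        using that \<open>1 \<notin> I\<close> I(1) by (cases "i \<le> 1") (auto simp: letter_act_def Let_def move_def)
    qed (use I H g in auto)
    then show ?thesis using near[of 0] by (auto simp: near_def)
  next
    assume "n \<notin> I"
    have "act n (g \<cdot> x) n = act n g n"
    proof (rule act_parabolic[of I])
      show "letter_act (i, True) y n = y n" if "i \<in> I" for i y
      proof -
        have "1 \<le> i" "i \<le> n" "i \<noteq> n" using that \<open>n \<notin> I\<close> I(1) by auto
        then show ?thesis by (auto simp: letter_act_def Let_def move_def)
      qed
    qed (use I H g in auto)
    then show ?thesis using near[of n] by (auto simp: near_def)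
  qed
next
  assume "x \<in> generate (artin_B n) {Delta_B n [^]\<^bsub>artin_B n\<^esub> (2::nat)}"
  then show ?thesis using near_central[of x 0 g] g near[of 0] by auto
qed

section \<open>Lower bound for word lengths with respect to \<open>P_B n\<close>\<close>

lemma P_B_inv: "x \<in> P_B n \<Longrightarrow> inv\<^bsub>artin_B n\<^esub> x \<in> P_B n"
  unfolding P_B_def
proof (elim UnE UnionE)
  fix H assume "H \<in> proper_irred_std_parabolics n" "x \<in> H"
  then have "inv\<^bsub>artin_B n\<^esub> x \<in> H"
    using subgroup.m_inv_closed[OF std_parabolic_subgroup] by blast
  then show "inv\<^bsub>artin_B n\<^esub> x \<in> \<Union> (proper_irred_std_parabolics n) \<union>
      generate (artin_B n) {Delta_B n [^]\<^bsub>artin_B n\<^esub> (2::nat)}"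
    using \<open>H \<in> proper_irred_std_parabolics n\<close> by blast
next
  assume "x \<in> generate (artin_B n) {Delta_B n [^]\<^bsub>artin_B n\<^esub> (2::nat)}"
  then have "inv\<^bsub>artin_B n\<^esub> x \<in> generate (artin_B n) {Delta_B n [^]\<^bsub>artin_B n\<^esub> (2::nat)}"
    using Delta_closed by (intro G.generate_m_inv_closed) auto
  then show "inv\<^bsub>artin_B n\<^esub> x \<in> \<Union> (proper_irred_std_parabolics n) \<union>
      generate (artin_B n) {Delta_B n [^]\<^bsub>artin_B n\<^esub> (2::nat)}" by blast
qed

lemma P_B_carrier: "P_B n \<subseteq> carrier (artin_B n)"
  using generate_P_B[of n] generate.incl[of _ "P_B n" "artin_B n"] n by auto

text \<open>Each letter on the right may spoil one end of \<open>g\<close>, and one factor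
  \<open>anosov\<close> absorbed from the left repairs it. So nearness lasts to the end of the word,
  where it contradicts \<open>not_near_one\<close>.\<close>

lemma not_near_short:
  assumes "set xs \<subseteq> P_B n" "g \<in> carrier (artin_B n)"
    and "\<And>a. a \<in> {0, n} \<Longrightarrow> near n g a"
    and "anosov [^]\<^bsub>artin_B n\<^esub> length xs \<cdot> (g \<cdot> list_product (artin_B n) xs) = \<one>\<^bsub>artin_B n\<^esub>"
  shows False
  using assms
proof (induction xs arbitrary: g)
  case Nil
  then show ?case using not_near_one by (simp add: list_product_def)
next
  case (Cons x xs)
  have x: "x \<in> P_B n" "x \<in> carrier (artin_B n)" using Cons.prems(1) P_B_carrier by auto
  have xs: "list_product (artin_B n) xs \<in> carrier (artin_B n)"
    using Cons.prems(1) P_B_carrier by (intro G.list_product_closed) auto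
  obtain a where a: "a \<in> {0, n}" "near n (g \<cdot> x) a"
    using near_parabolic_mult[OF Cons.prems(2) x(1) Cons.prems(3)] by blast
  show ?case
  proof (rule Cons.IH)
    show "set xs \<subseteq> P_B n" using Cons.prems(1) by simp
    show "anosov \<cdot> (g \<cdot> x) \<in> carrier (artin_B n)"
      using anosov_closed Cons.prems(2) x by simp
    show "near n (anosov \<cdot> (g \<cdot> x)) a'" if "a' \<in> {0, n}" for a'
      using near_anosov_mult[OF _ a(1) that a(2)] Cons.prems(2) x by simp
    have "anosov [^]\<^bsub>artin_B n\<^esub> length (x # xs) = anosov [^]\<^bsub>artin_B n\<^esub> length xs \<cdot> anosov"
      by simp
    then show "anosov [^]\<^bsub>artin_B n\<^esub> length xs \<cdot> (anosov \<cdot> (g \<cdot> x) \<cdot> list_product (artin_B n) xs) =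
        \<one>\<^bsub>artin_B n\<^esub>"
      using Cons.prems(2,4) x xs anosov_closed by (simp add: list_product_def G.m_assoc)
  qed
qed

lemma anosov_power_near: "near n (anosov [^]\<^bsub>artin_B n\<^esub> Suc k) a" if "a \<in> {0, n}"
proof (induction k)
  case 0
  then show ?case using near_anosov[OF that] anosov_closed by simp
next
  case (Suc k)
  have "anosov [^]\<^bsub>artin_B n\<^esub> Suc (Suc k) = anosov \<cdot> (anosov [^]\<^bsub>artin_B n\<^esub> Suc k)"
    by (rule G.nat_pow_Suc2[OF anosov_closed])
  then show ?case using near_anosov_mult[OF _ that that Suc] anosov_closed by simp
qed

text \<open>If \<open>k\<close> exceeded the length, a positive power of \<open>anosov\<close> would
  be left over as the initial \<open>g\<close>, and such a power is near at both ends.\<close>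

lemma anosov_power_long:
  assumes "set xs \<subseteq> P_B n" "list_product (artin_B n) xs = inv\<^bsub>artin_B n\<^esub> (anosov [^]\<^bsub>artin_B n\<^esub> k)"
  shows "k \<le> length xs"
proof (rule ccontr)
  assume "\<not> k \<le> length xs"
  then obtain j where k: "k = length xs + Suc j" by (metis less_iff_Suc_add not_le add_Suc_right)
  have pow: "anosov [^]\<^bsub>artin_B n\<^esub> length xs \<cdot> (anosov [^]\<^bsub>artin_B n\<^esub> Suc j) = anosov [^]\<^bsub>artin_B n\<^esub> k"
    unfolding k by (rule G.nat_pow_mult[OF anosov_closed])
  show False
  proof (rule not_near_short[OF assms(1), of "anosov [^]\<^bsub>artin_B n\<^esub> Suc j"])
    show "anosov [^]\<^bsub>artin_B n\<^esub> length xs \<cdot>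
        (anosov [^]\<^bsub>artin_B n\<^esub> Suc j \<cdot> list_product (artin_B n) xs) = \<one>\<^bsub>artin_B n\<^esub>"
      unfolding assms(2) using anosov_closed pow
      by (simp add: G.m_assoc[symmetric] del: nat_pow_Suc)
  qed (use anosov_closed anosov_power_near in auto)
qed


section \<open>Normalizers\<close>

lemma commuting_normalizes:
  assumes I: "I \<subseteq> {1..n}" and g: "g \<in> carrier (artin_B n)"
    and comm: "\<And>i. i \<in> I \<Longrightarrow> g \<cdot> tau n i = tau n i \<cdot> g"
  shows "g \<in> normalizer (artin_B n) (std_parabolic n I)"
proof -
  have tI: "tau n ` I \<subseteq> carrier (artin_B n)" using tau_closed I by blast
  have H: "std_parabolic n I \<subseteq> carrier (artin_B n)"
    unfolding std_parabolic_def by (rule G.generate_incl[OF tI])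
  have conj: "g \<cdot> x \<cdot> inv\<^bsub>artin_B n\<^esub> g = x" if "x \<in> std_parabolic n I" for x
  proof -
    have "g \<cdot> x = x \<cdot> g"
      using that unfolding std_parabolic_def
    proof (induction rule: generate.induct)
      case (incl h)
      then show ?case using comm by auto
    next
      case (inv h)
      have h: "h \<in> carrier (artin_B n)" "g \<cdot> h = h \<cdot> g" using inv comm tI by auto
      have "inv\<^bsub>artin_B n\<^esub> h \<cdot> (g \<cdot> h) \<cdot> inv\<^bsub>artin_B n\<^esub> h = inv\<^bsub>artin_B n\<^esub> h \<cdot> g"
        using h(1) g by (simp add: G.m_assoc)
      moreover have "inv\<^bsub>artin_B n\<^esub> h \<cdot> (h \<cdot> g) \<cdot> inv\<^bsub>artin_B n\<^esub> h = g \<cdot> inv\<^bsub>artin_B n\<^esub> h"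
        using h(1) g by (simp add: G.m_assoc[symmetric])
      ultimately show ?case using h(2) by simp
    next
      case (eng h1 h2)
      have "h1 \<in> carrier (artin_B n)" "h2 \<in> carrier (artin_B n)"
        using eng.hyps G.generate_in_carrier[OF tI] by blast+
      then show ?case using eng.IH g by (metis G.m_assoc)
    qed (use g in simp)
    moreover have "x \<in> carrier (artin_B n)" using that H by blast
    ultimately show ?thesis using g by (simp add: G.m_assoc)
  qed
  have "g <#\<^bsub>artin_B n\<^esub> std_parabolic n I #>\<^bsub>artin_B n\<^esub> inv\<^bsub>artin_B n\<^esub> g = std_parabolic n I"
  proof -
    have "g <#\<^bsub>artin_B n\<^esub> std_parabolic n I #>\<^bsub>artin_B n\<^esub> inv\<^bsub>artin_B n\<^esub> g =
        (\<lambda>x. g \<cdot> x \<cdot> inv\<^bsub>artin_B n\<^esub> g) ` std_parabolic n I"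
      by (auto simp: l_coset_def r_coset_def)
    also have "\<dots> = std_parabolic n I" using conj by (force simp: image_iff)
    finally show ?thesis .
  qed
  then show ?thesis using g H by (simp add: normalizer_def stabilizer_def)
qed

lemma normalizer_subgroup:
  "H \<in> proper_irred_std_parabolics n \<Longrightarrow> subgroup (normalizer (artin_B n) H) (artin_B n)"
  by (rule G.normalizer_imp_subgroup[OF subgroup.subset[OF std_parabolic_subgroup]])

lemma peq_cls: "peq n u v \<Longrightarrow> cls n (pos_word u) = cls n (pos_word v)"
  unfolding peq_def by (rule cls_eq)

lemma Delta_normalizes: "Delta_B n \<in> normalizer (artin_B n) (std_parabolic n {2})"
proof (rule commuting_normalizes[OF _ Delta_closed])
  have pw: "pos_word (concat (replicate k u)) = concat (replicate k (pos_word u))" for k u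
    by (induction k) simp_all
  have D: "Delta_B n = cls n (pos_word (concat (replicate n [1..<Suc n])))"
    by (simp add: Delta_cls delta_word_def pw del: upt_Suc)
  have w: "pos_word (concat (replicate n [1..<Suc n])) \<in> words {1..n}"
    by (auto simp: pos_word_words simp del: upt_Suc)
  show "Delta_B n \<cdot> tau n i = tau n i \<cdot> Delta_B n" if "i \<in> {2}" for i
    using that n w peq_cls[OF garside_commutes[OF n]] unfolding D tau_cls
    by (simp add: cls_mult del: upt_Suc)
qed (use n in auto)

lemma P_B_subset_NP_B: "P_B n \<subseteq> NP_B n"
proof -
  have two: "std_parabolic n {2} \<in> proper_irred_std_parabolics n"
    using n by (intro singleton_parabolic) auto
  have "generate (artin_B n) {Delta_B n [^]\<^bsub>artin_B n\<^esub> (2::nat)} \<subseteq> normalizer (artin_B n) (std_parabolic n {2})"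
    using normalizer_subgroup[OF two] Delta_normalizes
    by (intro G.generate_subgroup_incl) (auto intro!: G.nat_pow_subgroup)
  moreover have "H \<subseteq> normalizer (artin_B n) H" if "H \<in> proper_irred_std_parabolics n" for H
    using subgroup_subset_normalizer[OF std_parabolic_subgroup[OF that] group_artin_B] .
  ultimately show ?thesis using two unfolding P_B_def NP_B_def by blast
qed

text \<open>The generators of index at most \<open>n - 2\<close> braid only the strands that the
  twist circles, so they commute with it, and they commute with \<open>tau n n\<close> by distance.
  For \<open>n \<ge> 3\<close> there is at least one such generator.\<close>

lemma anosov_normalizes:
  "anosov \<in> normalizer (artin_B n) (std_parabolic n {1..n - 2})"
proof -
  let ?T = "cls n (pos_word (twist (n - 1)))"
  let ?h = "cls n (anosov_word n)"
  have tw: "set (twist (n - 1)) \<subseteq> {1..n}"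
    using subset_trans[OF twist_letters[of "n - 1"], of "{1..n}"] by simp
  have T: "?T \<in> carrier (artin_B n)" using tw by (intro cls_closed) (simp add: pos_word_words)
  have tn: "tau n n \<in> carrier (artin_B n)" using n by (intro tau_closed) simp
  have "inv_word (pos_word [n]) = [(n, False)]" by (simp add: inv_word_def)
  then have h: "?h = ?T \<cdot> inv\<^bsub>artin_B n\<^esub> tau n n"
    using tw n inv_cls[of "pos_word [n]" n]
    by (simp add: anosov_word_def tau_cls cls_mult pos_word_words)
  have comm: "?h \<cdot> tau n i = tau n i \<cdot> ?h" if i: "i \<in> {1..n - 2}" for i
  proof -
    have ti: "tau n i \<in> carrier (artin_B n)" using i by (intro tau_closed) auto
    have "peq n (i # twist (n - 1)) (twist (n - 1) @ [i])"
      using i n by (intro twist_commute) auto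
    from peq_cls[OF this] have 1: "tau n i \<cdot> ?T = ?T \<cdot> tau n i"
      using i tw n cls_mult[of "pos_word [i]" n "pos_word (twist (n - 1))"]
        cls_mult[of "pos_word (twist (n - 1))" n "pos_word [i]"]
      by (auto simp: tau_cls pos_word_words)
    have "peq n [i, n] [n, i]" using i n by (intro peq_commute_letter) auto
    from peq_cls[OF this] have "tau n i \<cdot> tau n n = tau n n \<cdot> tau n i"
      using i n cls_mult[of "pos_word [i]" n "pos_word [n]"] cls_mult[of "pos_word [n]" n "pos_word [i]"]
      by (auto simp: tau_cls)
    then have "inv\<^bsub>artin_B n\<^esub> tau n n \<cdot> (tau n i \<cdot> tau n n) \<cdot> inv\<^bsub>artin_B n\<^esub> tau n n =
        inv\<^bsub>artin_B n\<^esub> tau n n \<cdot> (tau n n \<cdot> tau n i) \<cdot> inv\<^bsub>artin_B n\<^esub> tau n n" by simp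
    moreover have "inv\<^bsub>artin_B n\<^esub> tau n n \<cdot> (tau n i \<cdot> tau n n) \<cdot> inv\<^bsub>artin_B n\<^esub> tau n n =
        inv\<^bsub>artin_B n\<^esub> tau n n \<cdot> tau n i" using ti tn by (simp add: G.m_assoc)
    moreover have "inv\<^bsub>artin_B n\<^esub> tau n n \<cdot> (tau n n \<cdot> tau n i) \<cdot> inv\<^bsub>artin_B n\<^esub> tau n n =
        tau n i \<cdot> inv\<^bsub>artin_B n\<^esub> tau n n" using ti tn by (simp add: G.m_assoc[symmetric])
    ultimately have 2: "inv\<^bsub>artin_B n\<^esub> tau n n \<cdot> tau n i = tau n i \<cdot> inv\<^bsub>artin_B n\<^esub> tau n n" by simp
    have "?h \<cdot> tau n i = ?T \<cdot> (tau n i \<cdot> inv\<^bsub>artin_B n\<^esub> tau n n)"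
      unfolding h using 2 T ti tn by (simp add: G.m_assoc)
    also have "\<dots> = tau n i \<cdot> ?h"
      unfolding h using 1 T ti tn by (simp add: G.m_assoc[symmetric])
    finally show ?thesis .
  qed
  have I: "std_parabolic n {1..n - 2} \<in> proper_irred_std_parabolics n"
  proof -
    have "{1..n - 2} \<noteq> {}" "{1..n - 2} \<subset> {1..n}" using n by auto
    then show ?thesis unfolding proper_irred_std_parabolics_def by blast
  qed
  have "?h \<in> normalizer (artin_B n) (std_parabolic n {1..n - 2})"
    by (rule commuting_normalizes) (use comm anosov_word_words[of n] n cls_closed in auto)
  moreover have "anosov = ?h \<cdot> ?h"
    using anosov_word_words[of n] n by (simp add: anosov_def cls_mult)
  ultimately show ?thesis using subgroup.m_closed[OF normalizer_subgroup[OF I]] by simp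
qed

lemma anosov_power_NP_B: "inv\<^bsub>artin_B n\<^esub> (anosov [^]\<^bsub>artin_B n\<^esub> (k :: nat)) \<in> NP_B n"
proof -
  have I: "std_parabolic n {1..n - 2} \<in> proper_irred_std_parabolics n"
  proof -
    have "{1..n - 2} \<noteq> {}" "{1..n - 2} \<subset> {1..n}" using n by auto
    then show ?thesis unfolding proper_irred_std_parabolics_def by blast
  qed
  have "inv\<^bsub>artin_B n\<^esub> (anosov [^]\<^bsub>artin_B n\<^esub> k) \<in> normalizer (artin_B n) (std_parabolic n {1..n - 2})"
    using normalizer_subgroup[OF I] anosov_normalizes G.nat_pow_subgroup subgroup.m_inv_closed by metis
  then show ?thesis using I unfolding NP_B_def by blast
qed

end

section \<open>Comparison of the two word metrics\<close>

lemma word_length_le: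
  "set xs \<subseteq> K \<union> m_inv G ` K \<Longrightarrow> word_length G K (list_product G xs) \<le> length xs"
  unfolding word_length_def by (rule Least_le) blast

lemma (in group) word_length_realized:
  assumes "generate G K = carrier G" "g \<in> carrier G"
  obtains xs where "length xs = word_length G K g" "set xs \<subseteq> K \<union> m_inv G ` K" "list_product G xs = g"
proof -
  have "K \<subseteq> carrier G" using assms(1) generate.incl by fastforce
  then have "\<exists>l xs. length xs = l \<and> set xs \<subseteq> K \<union> m_inv G ` K \<and> list_product G xs = g"
    using generate_list_product[of g K] assms by blast
  from LeastI_ex[OF this] show thesis using that unfolding word_length_def by blast
qed

lemma (in group) word_length_mono:
  assumes "generate G K = carrier G" "K \<subseteq> K'" "g \<in> carrier G"
  shows "word_length G K' g \<le> word_length G K g"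
proof -
  obtain xs where xs: "length xs = word_length G K g" "set xs \<subseteq> K \<union> m_inv G ` K" "list_product G xs = g"
    by (rule word_length_realized[OF assms(1,3)])
  then have "set xs \<subseteq> K' \<union> m_inv G ` K'" using assms(2) by blast
  from word_length_le[OF this] show ?thesis using xs by simp
qed

theorem mainTheorem4:
  fixes n :: nat
  assumes "n \<ge> 3"
  shows "Lipschitz_continuous_map (word_metric (artin_B n) (P_B n)) (word_metric (artin_B n) (NP_B n)) (\<lambda>g. g) \<and>
    \<not> quasi_isometry (word_metric (artin_B n) (P_B n)) (word_metric (artin_B n) (NP_B n)) (\<lambda>g. g)"
proof
  interpret group "artin_B n" by (rule group_artin_B)
  have n2: "n \<ge> 2" using assms by simp
  note P = generate_P_B[OF n2] and NP = generate_NP_B[OF n2]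
  note metric = mspace_word_metric[OF P] mdist_word_metric[OF P]
    mspace_word_metric[OF NP] mdist_word_metric[OF NP]
  show "Lipschitz_continuous_map (word_metric (artin_B n) (P_B n)) (word_metric (artin_B n) (NP_B n)) (\<lambda>g. g)"
    unfolding Lipschitz_continuous_map_def metric
  proof (intro conjI exI[of _ 1] ballI)
    \<comment> \<open>Enlarging the generating set can only shorten words, whence the Lipschitz
      constant 1.\<close>
    fix x y assume "x \<in> carrier (artin_B n)" "y \<in> carrier (artin_B n)"
    then show "word_dist (artin_B n) (NP_B n) x y \<le> 1 * word_dist (artin_B n) (P_B n) x y"
      using word_length_mono[OF P P_B_subset_NP_B[OF assms]] by (simp add: word_dist_def)
  qed simp
  show "\<not> quasi_isometry (word_metric (artin_B n) (P_B n)) (word_metric (artin_B n) (NP_B n)) (\<lambda>g. g)"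
  proof
    assume "quasi_isometry (word_metric (artin_B n) (P_B n)) (word_metric (artin_B n) (NP_B n)) (\<lambda>g. g)"
    then obtain L C where L: "L \<ge> 1" and
      lower: "\<And>x y. x \<in> carrier (artin_B n) \<Longrightarrow> y \<in> carrier (artin_B n) \<Longrightarrow>
        word_dist (artin_B n) (P_B n) x y / L - C \<le> word_dist (artin_B n) (NP_B n) x y"
      unfolding quasi_isometry_def metric by blast
    \<comment> \<open>The power below has length at most one over \<open>NP_B n\<close> but at least
      \<open>k\<close> over \<open>P_B n\<close>, so the lower estimate would give
      \<open>k / L - C \<le> 1\<close>.\<close>
    obtain k :: nat where k: "real k > L * (1 + C)" using reals_Archimedean2 by blast
    let ?x = "anosov n [^]\<^bsub>artin_B n\<^esub> k"
    have x: "?x \<in> carrier (artin_B n)" using anosov_closed[OF assms] by simp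
    have inv_x: "inv\<^bsub>artin_B n\<^esub> ?x \<otimes>\<^bsub>artin_B n\<^esub> \<one>\<^bsub>artin_B n\<^esub> = inv\<^bsub>artin_B n\<^esub> ?x"
      using x by simp
    have np: "word_length (artin_B n) (NP_B n) (inv\<^bsub>artin_B n\<^esub> ?x) \<le> 1"
      using word_length_le[of "[inv\<^bsub>artin_B n\<^esub> ?x]" "NP_B n" "artin_B n"] anosov_power_NP_B[OF assms, of k] x
      by (simp add: list_product_def)
    obtain xs where xs: "length xs = word_length (artin_B n) (P_B n) (inv\<^bsub>artin_B n\<^esub> ?x)"
      "set xs \<subseteq> P_B n \<union> m_inv (artin_B n) ` P_B n" "list_product (artin_B n) xs = inv\<^bsub>artin_B n\<^esub> ?x"
      by (rule word_length_realized[OF P inv_closed[OF x]])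
    have "set xs \<subseteq> P_B n" using xs(2) P_B_inv[OF assms] by auto
    then have p: "k \<le> word_length (artin_B n) (P_B n) (inv\<^bsub>artin_B n\<^esub> ?x)"
      using anosov_power_long[OF assms _ xs(3)] xs(1) by simp
    have "word_dist (artin_B n) (P_B n) ?x \<one>\<^bsub>artin_B n\<^esub> / L - C \<le> 1"
      using lower[OF x one_closed] np x unfolding word_dist_def inv_x by simp
    then have "word_dist (artin_B n) (P_B n) ?x \<one>\<^bsub>artin_B n\<^esub> \<le> L * (1 + C)"
      using L by (simp add: field_simps)
    moreover have "word_dist (artin_B n) (P_B n) ?x \<one>\<^bsub>artin_B n\<^esub> \<ge> real k"
      using p x unfolding word_dist_def inv_x by simp
    ultimately show False using k by linarith
  qed
qed

end
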